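(* Let $\mathcal{H},\mathcal{A},\mathcal{V}$, the maps $\mathcal{B},\mathcal{R},g$ satisfying Conditions (B), (R), (G), and the stochastic basis $(\Omega,\mathcal{F},\{\mathcal{F}_t\}_{t\ge0},\mathbb{P},\{\beta_k\}_{k\in\mathbb{N}})$ be as described in the context. Let $\tau>0$ be a stopping time such that $(\Phi^{(1)},\tau)$ and $(\Phi^{(2)},\tau)$ are local strong pathwise solutions of $$\mathrm{d}\Phi+\big(\mathcal{A}\Phi+\mathcal{B}(\Phi,\Phi)+\mathcal{R}(\Phi)\big)\,\mathrm{d}t=\sum_{k=1}^\infty g_k(\Phi)\,\mathrm{d}\beta_k$$ with the same initial data $\Phi_0\in L^\infty(\Omega;\mathcal{V})$. Then $$\mathbb{P}\left[\Phi^{(1)}(t\wedge\tau)=\Phi^{(2)}(t\wedge\tau),\ \forall t\in[0,\infty)\right]=1.$$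
   Context: Functional setting. $d\in\{1,2,3\}$ and $\mathscr{O}\subset\mathbb{R}^d$ is an open bounded domain with $C^2$ boundary or a convex Lipschitz domain. $(\mathcal{H},|\cdot|)$ is a separable Hilbert space. $\mathcal{A}$ is an unbounded, self-adjoint, positive linear operator on $\mathcal{H}$ with domain $\mathrm{D}(\mathcal{A})\subset\mathcal{H}$, bijective onto $\mathcal{H}$ with compact inverse. So there is an orthonormal basis $\{e_k\}$ of $\mathcal{H}$ of eigenvectors of $\mathcal{A}$, with positive eigenvalues $\lambda_k$ forming an unbounded increasing sequence. For $\alpha>0$, $\mathrm{D}(\mathcal{A}^\alpha)=\{v\in\mathcal{H}:\sum_k\lambda_k^{2\alpha}|\langle v,e_k\rangle_{\mathcal{H}}|^2<\infty\}$, $\mathcal{A}^\alpha v=\sum_k\lambda_k^\alpha\langle v,e_k\rangle_{\mathcal{H}}e_k$, $|v|_{\mathrm{D}(\mathcal{A}^\alpha)}=|\mathcal{A}^\alpha v|$. $\mathcal{V}=\mathrm{D}(\mathcal{A}^{1/2})$ with norm $\|v\|=|\mathcal{A}^{1/2}v|$. $\mathcal{V}'$ is the dual of $\mathcal{V}$ with respect to the inner product of $\mathcal{H}$, and $\langle\cdot,\cdot\rangle$ is the duality pairing between $\mathcal{V}'$ and $\mathcal{V}$, extending the inner product of $\mathcal{H}$. Write $\mathcal{B}(v)=\mathcal{B}(v,v)$. Conditions (B). (B1) $\mathcal{B}:\mathcal{V}\times\mathcal{V}\to\mathcal{V}'$ is bilinear and continuous. (B2) $\langle\mathcal{B}(v_1,v_2),v_3\rangle=-\langle\mathcal{B}(v_1,v_3),v_2\rangle$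 for all $v_1,v_2,v_3\in\mathcal{V}$. (B3) There is $C>0$ with $|\langle\mathcal{B}(v_1,v_2),v_3\rangle|\le C\|v_1\|\|v_2\||v_3|^{1/2}\|v_3\|^{1/2}$ for all $v_1,v_2,v_3\in\mathcal{V}$. (B4) There is $C>0$ such that for all $v_1\in\mathcal{V}$, $v_2\in\mathrm{D}(\mathcal{A})$: $|\mathcal{B}(v_1,v_2)|\le C|v_1|^{1/2}\|v_1\|^{1/2}\|v_2\|^{1/2}|\mathcal{A}v_2|^{1/2}$ if $d=2$, and $|\mathcal{B}(v_1,v_2)|\le C\|v_1\|\|v_2\|^{1/2}|\mathcal{A}v_2|^{1/2}$ if $d\le3$. (B5) There are $\alpha\in(0,\frac14)$, $p>0$, $C>0$ such that for every $v\in\mathrm{D}(\mathcal{A})$, $\mathcal{B}(v,v)\in\mathrm{D}(\mathcal{A}^\alpha)$ and $|\mathcal{B}(v,v)|_{\mathrm{D}(\mathcal{A}^\alpha)}\le C(1+\|v\|^p)(1+|\mathcal{A}v|)$. Conditions (R). (R1) $\mathcal{R}:\mathcal{V}\to\mathcal{H}$ is continuous, $\mathcal{R}=\mathcal{S}+\mathcal{F}$ with $\mathcal{S},\mathcal{F}:\mathcal{V}\to\mathcal{H}$ such that $\langle\mathcal{S}(v),v\rangle\ge0$ and $|\mathcal{F}(v)|\le C(1+\|v\|)$ for all $v\in\mathcal{V}$. (R2) There are $C>0$, $r\ge1$ with $|\mathcal{R}(v)|\le C(1+\|v\|^{r-1})\|v\|$ for all $v\in\mathcal{V}$. (R3) There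 are $C>0$, $r\ge1$ with $|\mathcal{R}(v_1)-\mathcal{R}(v_2)|\le C(1+\|v_1\|^{r-1}+\|v_2\|^{r-1})\|v_1-v_2\|$ for all $v_1,v_2\in\mathcal{V}$. (R4) There are $\beta\in(0,\frac14)$, $q>0$, $C>0$ such that for every $v\in\mathrm{D}(\mathcal{A})$, $\mathcal{R}(v)\in\mathrm{D}(\mathcal{A}^\beta)$ and $|\mathcal{R}(v)|_{\mathrm{D}(\mathcal{A}^\beta)}\le C(1+\|v\|^q)(1+|\mathcal{A}v|)$. Condition (G). For normed spaces $Y,Z$, $\mathrm{Lip}(Y,Z)$ is the set of progressively measurable maps $h:\Omega\times[0,\infty)\times Y\to Z$ for which there is a constant $L_Y$ with $|h(\omega,t,u)-h(\omega,t,v)|_Z\le L_Y|u-v|_Y$ and $|h(\omega,t,u)|_Z\le L_Y(1+|u|_Y)$ for all $u,v\in Y$, $(\omega,t)\in\Omega\times[0,\infty)$. $\ell^2(Z)$ is the space of square-summable $Z$-valued sequences. $g=\{g_k\}_{k\in\mathbb{N}}:\Omega\times[0,\infty)\times\mathcal{H}\to\ell^2(\mathcal{H})$ is progressively measurable and (by restriction) $g\in\mathrm{Lip}(\mathcal{H},\ell^2(\mathcal{H}))\cap\mathrm{Lip}(\mathcal{V},\ell^2(\mathcal{V}))\cap\mathrm{Lip}(\mathrm{D}(\mathcal{A}),\ell^2(\mathrm{D}(\mathcal{A})))$. Stochastic basis. $(\Omega,\mathcal{F},\{\mathcal{F}_t\}_{t\ge0},\mathbb{P},\{\beta_k\}_{k\in\mathbb{N}})$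 is fixed; the filtration satisfies the usual conditions and the $\beta_k$ are independent standard Brownian motions adapted to it. $\int g(\Phi)\,\mathrm{d}W:=\sum_k\int g_k(\Phi)\,\mathrm{d}\beta_k$. Solutions. A local weak pathwise solution with initial data $\Phi_0\in L^\infty(\Omega;\mathcal{H})$ is a pair $(\Phi,\tau)$ where $\tau$ is a strictly positive stopping time and $\Phi(\cdot\wedge\tau)$ is a predictable process in $\mathcal{V}'$ with $\Phi(\cdot\wedge\tau)\in L^2(\Omega;C_{\mathrm{w}}([0,\infty);\mathcal{H}))$ (weakly continuous), $\Phi\mathbf{1}_{t\le\tau}\in L^2(\Omega;L^2_{\mathrm{loc}}([0,\infty);\mathcal{V}))$, and for any $t>0$ $$\Phi(t\wedge\tau)+\int_0^{t\wedge\tau}\big(\mathcal{A}\Phi+\mathcal{B}(\Phi)+\mathcal{R}(\Phi)\big)\mathrm{d}s=\Phi_0+\int_0^{t\wedge\tau}g(\Phi)\,\mathrm{d}W\quad\text{in }\mathcal{V}'.$$ It is a local strong pathwise solution with initial data $\Phi_0\in L^\infty(\Omega;\mathcal{V})$ if moreover $\Phi(\cdot\wedge\tau)$ is predictable in $\mathcal{H}$, $\Phi(\cdot\wedge\tau)\in L^2(\Omega;C([0,\infty);\mathcal{V}))$, $\Phi\mathbf{1}_{t\le\tau}\in L^2(\Omega;L^2_{\mathrm{loc}}([0,\infty);\mathrm{D}(\mathcal{A})))$, and the equality holds in $\mathcal{H}$. (Spaces over $[0,\infty)$ are understood on $[0,T]$ for every $T>0$.) *)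

theory Defs
  imports "HOL-Probability.Probability"
begin

section \<open>Normed subspaces carrying their own norm\<close>

text \<open>
  A space such as \<open>V\<close> or \<open>D(A)\<close> is a subset \<open>Y\<close> of a larger type together with
  its own norm \<open>n\<close>. Topology and Borel sets always refer to that norm.
\<close>

definition norm_topology :: "'y::minus set \<Rightarrow> ('y \<Rightarrow> real) \<Rightarrow> 'y topology" where
  "norm_topology Y n = Metric_space.mtopology Y (\<lambda>u v. n (u - v))"

definition norm_borel :: "'y::minus set \<Rightarrow> ('y \<Rightarrow> real) \<Rightarrow> 'y measure" where
  "norm_borel Y n = sigma Y {U. openin (norm_topology Y n) U}"

definition l2_space :: "'z set \<Rightarrow> ('z \<Rightarrow> real) \<Rightarrow> (nat \<Rightarrow> 'z) set" where
  "l2_space Z n = {z. (\<forall>k. z k \<in> Z) \<and> summable (\<lambda>k. (n (z k))\<^sup>2)}"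

definition l2_norm :: "('z \<Rightarrow> real) \<Rightarrow> (nat \<Rightarrow> 'z) \<Rightarrow> real" where
  "l2_norm n z = sqrt (\<Sum>k. (n (z k))\<^sup>2)"


section \<open>The operator and its fractional powers\<close>

text \<open>An unbounded operator is a function \<open>A\<close> of which only the values on its domain \<open>D\<close> matter.\<close>

definition linear_operator_on :: "'h::real_vector set \<Rightarrow> ('h \<Rightarrow> 'h) \<Rightarrow> bool" where
  "linear_operator_on D A \<longleftrightarrow> subspace D \<and>
     (\<forall>u\<in>D. \<forall>v\<in>D. A (u + v) = A u + A v) \<and> (\<forall>c. \<forall>u\<in>D. A (c *\<^sub>R u) = c *\<^sub>R A u)"

text \<open>Density makes the adjoint well defined; the equivalence says that the graphs of the
  operator and of its adjoint coincide, domains included.\<close>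

definition self_adjoint_on :: "'h::real_inner set \<Rightarrow> ('h \<Rightarrow> 'h) \<Rightarrow> bool" where
  "self_adjoint_on D A \<longleftrightarrow> closure D = UNIV \<and>
     (\<forall>v w. (v \<in> D \<and> A v = w) \<longleftrightarrow> (\<forall>u\<in>D. A u \<bullet> v = u \<bullet> w))"

definition admissible_operator :: "'h::real_inner set \<Rightarrow> ('h \<Rightarrow> 'h) \<Rightarrow> bool" where
  "admissible_operator D A \<longleftrightarrow>
     linear_operator_on D A \<and>
     \<not> (\<exists>K. \<forall>v\<in>D. norm (A v) \<le> K * norm v) \<and>
     self_adjoint_on D A \<and>
     (\<forall>v\<in>D. v \<noteq> 0 \<longrightarrow> 0 < A v \<bullet> v) \<and>
     bij_betw A D UNIV \<and>
     (\<forall>S. bounded S \<longrightarrow> compact (closure (inv_into D A ` S)))"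

definition eigenbasis ::
  "'h::real_inner set \<Rightarrow> ('h \<Rightarrow> 'h) \<Rightarrow> (nat \<Rightarrow> 'h) \<Rightarrow> (nat \<Rightarrow> real) \<Rightarrow> bool" where
  "eigenbasis D A e lam \<longleftrightarrow>
     (\<forall>i j. e i \<bullet> e j = (if i = j then 1 else 0)) \<and> closure (span (range e)) = UNIV \<and>
     (\<forall>k. e k \<in> D \<and> A (e k) = lam k *\<^sub>R e k \<and> 0 < lam k) \<and>
     incseq lam \<and> filterlim lam at_top sequentially"

definition pow_dom :: "(nat \<Rightarrow> 'h::real_inner) \<Rightarrow> (nat \<Rightarrow> real) \<Rightarrow> real \<Rightarrow> 'h set" where
  "pow_dom e lam \<alpha> = {v. summable (\<lambda>k. lam k powr (2 * \<alpha>) * (v \<bullet> e k)\<^sup>2)}"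

definition pow_op :: "(nat \<Rightarrow> 'h::real_inner) \<Rightarrow> (nat \<Rightarrow> real) \<Rightarrow> real \<Rightarrow> 'h \<Rightarrow> 'h" where
  "pow_op e lam \<alpha> v = (\<Sum>k. (lam k powr \<alpha> * (v \<bullet> e k)) *\<^sub>R e k)"

definition pow_norm :: "(nat \<Rightarrow> 'h::real_inner) \<Rightarrow> (nat \<Rightarrow> real) \<Rightarrow> real \<Rightarrow> 'h \<Rightarrow> real" where
  "pow_norm e lam \<alpha> v = norm (pow_op e lam \<alpha> v)"

abbreviation V_space :: "(nat \<Rightarrow> 'h::real_inner) \<Rightarrow> (nat \<Rightarrow> real) \<Rightarrow> 'h set" where
  "V_space e lam \<equiv> pow_dom e lam (1/2)"

abbreviation V_norm :: "(nat \<Rightarrow> 'h::real_inner) \<Rightarrow> (nat \<Rightarrow> real) \<Rightarrow> 'h \<Rightarrow> real" where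
  "V_norm e lam \<equiv> pow_norm e lam (1/2)"

text \<open>
  Elements of the dual \<open>V'\<close> are the bounded linear functionals on \<open>V\<close>, extended by \<open>0\<close>
  outside \<open>V\<close> so that equality of functionals is equality in HOL. The pairing is application,
  and \<open>dual_embed\<close> is the inclusion of \<open>H\<close> into \<open>V'\<close> given by the inner product of \<open>H\<close>.
\<close>

definition dual_space :: "(nat \<Rightarrow> 'h::real_inner) \<Rightarrow> (nat \<Rightarrow> real) \<Rightarrow> ('h \<Rightarrow> real) set" where
  "dual_space e lam = {f.
     (\<forall>v. v \<notin> V_space e lam \<longrightarrow> f v = 0) \<and>
     (\<forall>u\<in>V_space e lam. \<forall>v\<in>V_space e lam. f (u + v) = f u + f v) \<and>
     (\<forall>c. \<forall>v\<in>V_space e lam. f (c *\<^sub>R v) = c * f v) \<and>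
     (\<exists>K. \<forall>v\<in>V_space e lam. \<bar>f v\<bar> \<le> K * V_norm e lam v)}"

definition dual_norm :: "(nat \<Rightarrow> 'h::real_inner) \<Rightarrow> (nat \<Rightarrow> real) \<Rightarrow> ('h \<Rightarrow> real) \<Rightarrow> real" where
  "dual_norm e lam f = (SUP v\<in>{v \<in> V_space e lam. V_norm e lam v \<le> 1}. \<bar>f v\<bar>)"

definition dual_embed :: "(nat \<Rightarrow> 'h::real_inner) \<Rightarrow> (nat \<Rightarrow> real) \<Rightarrow> 'h \<Rightarrow> 'h \<Rightarrow> real" where
  "dual_embed e lam h = (\<lambda>v. if v \<in> V_space e lam then h \<bullet> v else 0)"

text \<open>The element of \<open>H\<close> represented by a functional lying in the range of \<open>dual_embed\<close>;
  it is unique because \<open>V\<close> is dense in \<open>H\<close>.\<close>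

definition dual_rep :: "(nat \<Rightarrow> 'h::real_inner) \<Rightarrow> (nat \<Rightarrow> real) \<Rightarrow> ('h \<Rightarrow> real) \<Rightarrow> 'h" where
  "dual_rep e lam f = (THE h. dual_embed e lam h = f)"


section \<open>The nonlinear terms\<close>

definition cond_B1 ::
  "(nat \<Rightarrow> 'h::real_inner) \<Rightarrow> (nat \<Rightarrow> real) \<Rightarrow> ('h \<Rightarrow> 'h \<Rightarrow> 'h \<Rightarrow> real) \<Rightarrow> bool" where
  "cond_B1 e lam B \<longleftrightarrow>
     (\<forall>u\<in>V_space e lam. \<forall>v\<in>V_space e lam. B u v \<in> dual_space e lam) \<and>
     (\<forall>u\<in>V_space e lam. \<forall>u'\<in>V_space e lam. \<forall>v\<in>V_space e lam. \<forall>w\<in>V_space e lam. \<forall>c.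
        B (u + u') v w = B u v w + B u' v w \<and> B (c *\<^sub>R u) v w = c * B u v w \<and>
        B v (u + u') w = B v u w + B v u' w \<and> B v (c *\<^sub>R u) w = c * B v u w) \<and>
     continuous_map
       (prod_topology (norm_topology (V_space e lam) (V_norm e lam))
                      (norm_topology (V_space e lam) (V_norm e lam)))
       (norm_topology (dual_space e lam) (dual_norm e lam)) (\<lambda>(u, v). B u v)"

definition cond_B2 ::
  "(nat \<Rightarrow> 'h::real_inner) \<Rightarrow> (nat \<Rightarrow> real) \<Rightarrow> ('h \<Rightarrow> 'h \<Rightarrow> 'h \<Rightarrow> real) \<Rightarrow> bool" where
  "cond_B2 e lam B \<longleftrightarrow>
     (\<forall>v1\<in>V_space e lam. \<forall>v2\<in>V_space e lam. \<forall>v3\<in>V_space e lam. B v1 v2 v3 = - B v1 v3 v2)"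

definition cond_B3 ::
  "(nat \<Rightarrow> 'h::real_inner) \<Rightarrow> (nat \<Rightarrow> real) \<Rightarrow> ('h \<Rightarrow> 'h \<Rightarrow> 'h \<Rightarrow> real) \<Rightarrow> bool" where
  "cond_B3 e lam B \<longleftrightarrow>
     (\<exists>C>0. \<forall>v1\<in>V_space e lam. \<forall>v2\<in>V_space e lam. \<forall>v3\<in>V_space e lam.
        \<bar>B v1 v2 v3\<bar> \<le>
          C * V_norm e lam v1 * V_norm e lam v2 * sqrt (norm v3) * sqrt (V_norm e lam v3))"

text \<open>The \<open>H\<close>-norm of \<open>B v1 v2\<close> is that of the \<open>h\<close> with \<open>B v1 v2 = dual_embed e lam h\<close>;
  that such an \<open>h\<close> exists is part of the condition.\<close>

definition cond_B4 ::
  "nat \<Rightarrow> 'h::real_inner set \<Rightarrow> ('h \<Rightarrow> 'h) \<Rightarrow> (nat \<Rightarrow> 'h) \<Rightarrow> (nat \<Rightarrow> real) \<Rightarrow>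
     ('h \<Rightarrow> 'h \<Rightarrow> 'h \<Rightarrow> real) \<Rightarrow> bool" where
  "cond_B4 d D A e lam B \<longleftrightarrow>
     (\<exists>C>0. \<forall>v1\<in>V_space e lam. \<forall>v2\<in>D. \<exists>h. B v1 v2 = dual_embed e lam h \<and>
        (d = 2 \<longrightarrow> norm h \<le> C * sqrt (norm v1) * sqrt (V_norm e lam v1)
                             * sqrt (V_norm e lam v2) * sqrt (norm (A v2))) \<and>
        (d \<le> 3 \<longrightarrow> norm h \<le> C * V_norm e lam v1 * sqrt (V_norm e lam v2) * sqrt (norm (A v2))))"

definition cond_B5 ::
  "'h::real_inner set \<Rightarrow> ('h \<Rightarrow> 'h) \<Rightarrow> (nat \<Rightarrow> 'h) \<Rightarrow> (nat \<Rightarrow> real) \<Rightarrow>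
     ('h \<Rightarrow> 'h \<Rightarrow> 'h \<Rightarrow> real) \<Rightarrow> bool" where
  "cond_B5 D A e lam B \<longleftrightarrow>
     (\<exists>\<alpha> p C. 0 < \<alpha> \<and> \<alpha> < 1/4 \<and> 0 < p \<and> 0 < C \<and>
        (\<forall>v\<in>D. \<exists>h\<in>pow_dom e lam \<alpha>. B v v = dual_embed e lam h \<and>
           pow_norm e lam \<alpha> h \<le> C * (1 + V_norm e lam v powr p) * (1 + norm (A v))))"

definition cond_B ::
  "nat \<Rightarrow> 'h::real_inner set \<Rightarrow> ('h \<Rightarrow> 'h) \<Rightarrow> (nat \<Rightarrow> 'h) \<Rightarrow> (nat \<Rightarrow> real) \<Rightarrow>
     ('h \<Rightarrow> 'h \<Rightarrow> 'h \<Rightarrow> real) \<Rightarrow> bool" where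
  "cond_B d D A e lam B \<longleftrightarrow> cond_B1 e lam B \<and> cond_B2 e lam B \<and> cond_B3 e lam B \<and>
     cond_B4 d D A e lam B \<and> cond_B5 D A e lam B"

definition cond_R1 ::
  "(nat \<Rightarrow> 'h::real_inner) \<Rightarrow> (nat \<Rightarrow> real) \<Rightarrow> ('h \<Rightarrow> 'h) \<Rightarrow> bool" where
  "cond_R1 e lam R \<longleftrightarrow>
     continuous_map (norm_topology (V_space e lam) (V_norm e lam)) euclidean R \<and>
     (\<exists>S F C. 0 < C \<and> (\<forall>v\<in>V_space e lam.
        R v = S v + F v \<and> 0 \<le> S v \<bullet> v \<and> norm (F v) \<le> C * (1 + V_norm e lam v)))"

text \<open>Note \<open>0 powr 0 = 0\<close> in HOL: for \<open>r = 1\<close> this affects only the constants below.\<close>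

definition cond_R2 ::
  "(nat \<Rightarrow> 'h::real_inner) \<Rightarrow> (nat \<Rightarrow> real) \<Rightarrow> ('h \<Rightarrow> 'h) \<Rightarrow> bool" where
  "cond_R2 e lam R \<longleftrightarrow>
     (\<exists>C r. 0 < C \<and> 1 \<le> r \<and> (\<forall>v\<in>V_space e lam.
        norm (R v) \<le> C * (1 + V_norm e lam v powr (r - 1)) * V_norm e lam v))"

definition cond_R3 ::
  "(nat \<Rightarrow> 'h::real_inner) \<Rightarrow> (nat \<Rightarrow> real) \<Rightarrow> ('h \<Rightarrow> 'h) \<Rightarrow> bool" where
  "cond_R3 e lam R \<longleftrightarrow>
     (\<exists>C r. 0 < C \<and> 1 \<le> r \<and> (\<forall>v1\<in>V_space e lam. \<forall>v2\<in>V_space e lam.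
        norm (R v1 - R v2) \<le>
          C * (1 + V_norm e lam v1 powr (r - 1) + V_norm e lam v2 powr (r - 1))
            * V_norm e lam (v1 - v2)))"

definition cond_R4 ::
  "'h::real_inner set \<Rightarrow> ('h \<Rightarrow> 'h) \<Rightarrow> (nat \<Rightarrow> 'h) \<Rightarrow> (nat \<Rightarrow> real) \<Rightarrow> ('h \<Rightarrow> 'h) \<Rightarrow> bool" where
  "cond_R4 D A e lam R \<longleftrightarrow>
     (\<exists>\<beta> q C. 0 < \<beta> \<and> \<beta> < 1/4 \<and> 0 < q \<and> 0 < C \<and>
        (\<forall>v\<in>D. R v \<in> pow_dom e lam \<beta> \<and>
           pow_norm e lam \<beta> (R v) \<le> C * (1 + V_norm e lam v powr q) * (1 + norm (A v))))"

definition cond_R ::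
  "'h::real_inner set \<Rightarrow> ('h \<Rightarrow> 'h) \<Rightarrow> (nat \<Rightarrow> 'h) \<Rightarrow> (nat \<Rightarrow> real) \<Rightarrow> ('h \<Rightarrow> 'h) \<Rightarrow> bool" where
  "cond_R D A e lam R \<longleftrightarrow>
     cond_R1 e lam R \<and> cond_R2 e lam R \<and> cond_R3 e lam R \<and> cond_R4 D A e lam R"


section \<open>Stochastic basis\<close>

text \<open>
  Times range over \<open>[0,\<infinity>]\<close>, i.e. over type \<^typ>\<open>ennreal\<close>, so that the library notions
  \<^const>\<open>filtration\<close> and \<^const>\<open>stopping_time\<close> apply and stopping times may be infinite.
  The value of the filtration at infinity is merely some \<open>\<sigma>\<close>-algebra above all the others.
\<close>

definition usual_conditions :: "'w measure \<Rightarrow> (ennreal \<Rightarrow> 'w measure) \<Rightarrow> bool" where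
  "usual_conditions M F \<longleftrightarrow>
     complete_measure M \<and> null_sets M \<subseteq> sets (F 0) \<and>
     (\<forall>t. t < \<infinity> \<longrightarrow> sets (F t) = (\<Inter>s\<in>{t<..}. sets (F s)))"

text \<open>Independent standard Brownian motions relative to \<open>F\<close>: besides adaptedness, the
  sequence of increments after time \<open>s\<close> is independent of \<open>F s\<close>, as the Ito integral requires.\<close>

definition brownian_family ::
  "'w measure \<Rightarrow> (ennreal \<Rightarrow> 'w measure) \<Rightarrow> (nat \<Rightarrow> real \<Rightarrow> 'w \<Rightarrow> real) \<Rightarrow> bool" where
  "brownian_family M F \<beta> \<longleftrightarrow>
     (\<forall>k. \<forall>t\<ge>0. \<beta> k t \<in> borel_measurable (F (ennreal t))) \<and>
     (\<forall>k. AE \<omega> in M. \<beta> k 0 \<omega> = 0 \<and> continuous_on {0..} (\<lambda>t. \<beta> k t \<omega>)) \<and>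
     (\<forall>k s t. 0 \<le> s \<and> s < t \<longrightarrow>
        distributed M lborel (\<lambda>\<omega>. \<beta> k t \<omega> - \<beta> k s \<omega>) (normal_density 0 (sqrt (t - s)))) \<and>
     (\<forall>s t. 0 \<le> s \<and> s < t \<longrightarrow>
        prob_space.indep_set M (sets (F (ennreal s)))
          (sets (vimage_algebra (space M) (\<lambda>\<omega> k. \<beta> k t \<omega> - \<beta> k s \<omega>) (\<Pi>\<^sub>M k\<in>UNIV. borel)))) \<and>
     prob_space.indep_vars M (\<lambda>k. \<Pi>\<^sub>M t\<in>{0..}. borel) (\<lambda>k \<omega>. \<lambda>t\<in>{0..}. \<beta> k t \<omega>) UNIV"

definition stochastic_basis ::
  "'w measure \<Rightarrow> (ennreal \<Rightarrow> 'w measure) \<Rightarrow> (nat \<Rightarrow> real \<Rightarrow> 'w \<Rightarrow> real) \<Rightarrow> bool" where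
  "stochastic_basis M F \<beta> \<longleftrightarrow>
     prob_space M \<and> filtration (space M) F \<and> (\<forall>t. subalgebra M (F t)) \<and>
     usual_conditions M F \<and> brownian_family M F \<beta>"

definition progressive :: "(ennreal \<Rightarrow> 'w measure) \<Rightarrow> (real \<Rightarrow> 'w \<Rightarrow> 'h::topological_space) \<Rightarrow> bool" where
  "progressive F X \<longleftrightarrow> (\<forall>T\<ge>0. (\<lambda>(\<omega>, s). X s \<omega>) \<in>
     F (ennreal T) \<Otimes>\<^sub>M restrict_space borel {0..T} \<rightarrow>\<^sub>M borel)"

definition predictable_algebra ::
  "'w measure \<Rightarrow> (ennreal \<Rightarrow> 'w measure) \<Rightarrow> ('w \<times> real) measure" where
  "predictable_algebra M F = sigma (space M \<times> {0..})
     ({E \<times> {s<..t} | E s t. 0 \<le> s \<and> s \<le> t \<and> E \<in> sets (F (ennreal s))} \<union>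
      {E \<times> {0} | E. E \<in> sets (F 0)})"

text \<open>\<open>stopped \<tau> t \<omega>\<close> is \<open>t \<and> \<tau>(\<omega>)\<close>.\<close>

definition stopped :: "('w \<Rightarrow> ennreal) \<Rightarrow> real \<Rightarrow> 'w \<Rightarrow> real" where
  "stopped \<tau> t \<omega> = enn2real (min (ennreal t) (\<tau> \<omega>))"

definition Lip_class ::
  "'w measure \<Rightarrow> (ennreal \<Rightarrow> 'w measure) \<Rightarrow> 'y::minus set \<Rightarrow> ('y \<Rightarrow> real) \<Rightarrow>
     'z::minus set \<Rightarrow> ('z \<Rightarrow> real) \<Rightarrow> ('w \<Rightarrow> real \<Rightarrow> 'y \<Rightarrow> 'z) set" where
  "Lip_class M F Y nY Z nZ = {h.
     (\<forall>T\<ge>0. (\<lambda>(\<omega>, t, u). h \<omega> t u) \<in>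
        F (ennreal T) \<Otimes>\<^sub>M (restrict_space borel {0..T} \<Otimes>\<^sub>M norm_borel Y nY) \<rightarrow>\<^sub>M norm_borel Z nZ) \<and>
     (\<exists>L. \<forall>\<omega>\<in>space M. \<forall>t\<ge>0. \<forall>u\<in>Y. \<forall>v\<in>Y.
        nZ (h \<omega> t u - h \<omega> t v) \<le> L * nY (u - v) \<and> nZ (h \<omega> t u) \<le> L * (1 + nY u))}"

definition cond_G ::
  "'w measure \<Rightarrow> (ennreal \<Rightarrow> 'w measure) \<Rightarrow> 'h::real_inner set \<Rightarrow> ('h \<Rightarrow> 'h) \<Rightarrow> (nat \<Rightarrow> 'h) \<Rightarrow>
     (nat \<Rightarrow> real) \<Rightarrow> ('w \<Rightarrow> real \<Rightarrow> 'h \<Rightarrow> nat \<Rightarrow> 'h) \<Rightarrow> bool" where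
  "cond_G M F D A e lam g \<longleftrightarrow>
     g \<in> Lip_class M F UNIV norm (l2_space UNIV norm) (l2_norm norm) \<and>
     g \<in> Lip_class M F (V_space e lam) (V_norm e lam)
           (l2_space (V_space e lam) (V_norm e lam)) (l2_norm (V_norm e lam)) \<and>
     g \<in> Lip_class M F D (\<lambda>v. norm (A v))
           (l2_space D (\<lambda>v. norm (A v))) (l2_norm (\<lambda>v. norm (A v)))"


section \<open>Stochastic integral\<close>

text \<open>
  A simple process equals \<open>\<xi> i\<close> on \<open>(p i, p (i+1)]\<close> for \<open>i < n\<close>, with \<open>\<xi> i\<close> bounded and
  measurable at time \<open>p i\<close>. The Ito integral over \<open>[0,t]\<close> of a progressively measurable,
  square integrable process is the mean-square limit of the integrals of approximating simple
  processes; it is determined up to a null set.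
\<close>

definition simple_data ::
  "(ennreal \<Rightarrow> 'w measure) \<Rightarrow> nat \<Rightarrow> (nat \<Rightarrow> real) \<Rightarrow> (nat \<Rightarrow> 'w \<Rightarrow> 'h::real_normed_vector) \<Rightarrow> bool" where
  "simple_data F n p \<xi> \<longleftrightarrow> 0 \<le> p 0 \<and> (\<forall>i<n. p i \<le> p (Suc i) \<and>
     \<xi> i \<in> borel_measurable (F (ennreal (p i))) \<and> bounded (\<xi> i ` space (F (ennreal (p i)))))"

definition simple_process ::
  "nat \<Rightarrow> (nat \<Rightarrow> real) \<Rightarrow> (nat \<Rightarrow> 'w \<Rightarrow> 'h::real_normed_vector) \<Rightarrow> real \<Rightarrow> 'w \<Rightarrow> 'h" where
  "simple_process n p \<xi> s \<omega> = (\<Sum>i<n. indicator {p i<..p (Suc i)} s *\<^sub>R \<xi> i \<omega>)"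

definition simple_integral ::
  "(real \<Rightarrow> 'w \<Rightarrow> real) \<Rightarrow> nat \<Rightarrow> (nat \<Rightarrow> real) \<Rightarrow> (nat \<Rightarrow> 'w \<Rightarrow> 'h::real_normed_vector) \<Rightarrow>
     real \<Rightarrow> 'w \<Rightarrow> 'h" where
  "simple_integral b n p \<xi> t \<omega> =
     (\<Sum>i<n. (b (min t (p (Suc i))) \<omega> - b (min t (p i)) \<omega>) *\<^sub>R \<xi> i \<omega>)"

definition has_ito_integral ::
  "'w measure \<Rightarrow> (ennreal \<Rightarrow> 'w measure) \<Rightarrow> (real \<Rightarrow> 'w \<Rightarrow> real) \<Rightarrow>
     (real \<Rightarrow> 'w \<Rightarrow> 'h::real_normed_vector) \<Rightarrow> real \<Rightarrow> ('w \<Rightarrow> 'h) \<Rightarrow> bool" where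
  "has_ito_integral M F b X t I \<longleftrightarrow>
     progressive F X \<and> I \<in> borel_measurable M \<and>
     (\<exists>n p \<xi>. (\<forall>m. simple_data F (n m) (p m) (\<xi> m)) \<and>
        (\<lambda>m. \<integral>\<^sup>+\<omega>. (\<integral>\<^sup>+s\<in>{0..t}.
            ennreal ((norm (X s \<omega> - simple_process (n m) (p m) (\<xi> m) s \<omega>))\<^sup>2) \<partial>lborel) \<partial>M)
          \<longlonglongrightarrow> 0 \<and>
        (\<lambda>m. \<integral>\<^sup>+\<omega>. ennreal ((norm (I \<omega> - simple_integral b (n m) (p m) (\<xi> m) t \<omega>))\<^sup>2) \<partial>M)
          \<longlonglongrightarrow> 0)"

definition has_stochastic_integral ::
  "'w measure \<Rightarrow> (ennreal \<Rightarrow> 'w measure) \<Rightarrow> (nat \<Rightarrow> real \<Rightarrow> 'w \<Rightarrow> real) \<Rightarrow>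
     (nat \<Rightarrow> real \<Rightarrow> 'w \<Rightarrow> 'h::real_normed_vector) \<Rightarrow> real \<Rightarrow> ('w \<Rightarrow> 'h) \<Rightarrow> bool" where
  "has_stochastic_integral M F \<beta> G t I \<longleftrightarrow>
     I \<in> borel_measurable M \<and>
     (\<exists>J. (\<forall>k. has_ito_integral M F (\<beta> k) (G k) t (J k)) \<and>
        (\<lambda>n. \<integral>\<^sup>+\<omega>. ennreal ((norm (I \<omega> - (\<Sum>k<n. J k \<omega>)))\<^sup>2) \<partial>M) \<longlonglongrightarrow> 0)"


section \<open>Solutions\<close>

definition Linf_rv :: "'w measure \<Rightarrow> 'h::minus set \<Rightarrow> ('h \<Rightarrow> real) \<Rightarrow> ('w \<Rightarrow> 'h) \<Rightarrow> bool" where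
  "Linf_rv M Y n X \<longleftrightarrow> X \<in> M \<rightarrow>\<^sub>M norm_borel Y n \<and> (\<exists>K. AE \<omega> in M. n (X \<omega>) \<le> K)"

text \<open>
  Membership of a process in \<open>L\<^sup>2(\<Omega>; C([0,\<infinity>); Y))\<close>, in \<open>L\<^sup>2(\<Omega>; C\<^sub>w([0,\<infinity>); H))\<close> and,
  after multiplication with the indicator of \<open>t \<le> \<tau>\<close>, in \<open>L\<^sup>2(\<Omega>; L\<^sup>2\<^sub>l\<^sub>o\<^sub>c([0,\<infinity>); Y))\<close>.
  Joint measurability is not repeated here: it comes with the predictability demanded of every
  process to which these predicates are applied below.
\<close>

definition L2_cont ::
  "'w measure \<Rightarrow> 'h::minus set \<Rightarrow> ('h \<Rightarrow> real) \<Rightarrow> (real \<Rightarrow> 'w \<Rightarrow> 'h) \<Rightarrow> bool" where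
  "L2_cont M Y n X \<longleftrightarrow>
     (AE \<omega> in M. continuous_map (top_of_set {0..}) (norm_topology Y n) (\<lambda>t. X t \<omega>)) \<and>
     (\<forall>T\<ge>0. (\<integral>\<^sup>+\<omega>. (SUP t\<in>{0..T}. ennreal ((n (X t \<omega>))\<^sup>2)) \<partial>M) < \<infinity>)"

definition L2_weakly_cont :: "'w measure \<Rightarrow> (real \<Rightarrow> 'w \<Rightarrow> 'h::real_inner) \<Rightarrow> bool" where
  "L2_weakly_cont M X \<longleftrightarrow>
     (AE \<omega> in M. \<forall>h. continuous_on {0..} (\<lambda>t. X t \<omega> \<bullet> h)) \<and>
     (\<forall>T\<ge>0. (\<integral>\<^sup>+\<omega>. (SUP t\<in>{0..T}. ennreal ((norm (X t \<omega>))\<^sup>2)) \<partial>M) < \<infinity>)"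

definition L2_L2loc ::
  "'w measure \<Rightarrow> 'h set \<Rightarrow> ('h \<Rightarrow> real) \<Rightarrow> ('w \<Rightarrow> ennreal) \<Rightarrow> (real \<Rightarrow> 'w \<Rightarrow> 'h) \<Rightarrow> bool" where
  "L2_L2loc M Y n \<tau> X \<longleftrightarrow>
     (AE \<omega> in M. AE s in lborel. 0 \<le> s \<and> ennreal s \<le> \<tau> \<omega> \<longrightarrow> X s \<omega> \<in> Y) \<and>
     (\<forall>T\<ge>0. (\<integral>\<^sup>+\<omega>. (\<integral>\<^sup>+s\<in>{0..stopped \<tau> T \<omega>}. ennreal ((n (X s \<omega>))\<^sup>2) \<partial>lborel) \<partial>M) < \<infinity>)"

text \<open>The integrand of the stochastic integral from \<open>0\<close> to \<open>t \<and> \<tau>\<close>, viewed as an integral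
  from \<open>0\<close> to \<open>t\<close>.\<close>

definition noise_integrand ::
  "('w \<Rightarrow> real \<Rightarrow> 'h \<Rightarrow> nat \<Rightarrow> 'h::real_vector) \<Rightarrow> (real \<Rightarrow> 'w \<Rightarrow> 'h) \<Rightarrow> ('w \<Rightarrow> ennreal) \<Rightarrow>
     nat \<Rightarrow> real \<Rightarrow> 'w \<Rightarrow> 'h" where
  "noise_integrand g \<Phi> \<tau> k s \<omega> = (if ennreal s \<le> \<tau> \<omega> then g \<omega> s (\<Phi> s \<omega>) k else 0)"

text \<open>
  \<open>A v + B(v) + R(v)\<close> as an element of \<open>V'\<close> evaluated at \<open>w\<close>, where \<open>A\<close> is extended to \<open>V\<close> by
  \<open>\<langle>A v, w\<rangle> = \<langle>A\<^sup>1\<^sup>/\<^sup>2 v, A\<^sup>1\<^sup>/\<^sup>2 w\<rangle>\<close>, and as an element of \<open>H\<close> for \<open>v\<close> in \<open>D(A)\<close>.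
\<close>

definition drift_dual ::
  "(nat \<Rightarrow> 'h::real_inner) \<Rightarrow> (nat \<Rightarrow> real) \<Rightarrow> ('h \<Rightarrow> 'h \<Rightarrow> 'h \<Rightarrow> real) \<Rightarrow> ('h \<Rightarrow> 'h) \<Rightarrow>
     'h \<Rightarrow> 'h \<Rightarrow> real" where
  "drift_dual e lam B R v w =
     pow_op e lam (1/2) v \<bullet> pow_op e lam (1/2) w + B v v w + R v \<bullet> w"

definition drift ::
  "('h::real_inner \<Rightarrow> 'h) \<Rightarrow> (nat \<Rightarrow> 'h) \<Rightarrow> (nat \<Rightarrow> real) \<Rightarrow> ('h \<Rightarrow> 'h \<Rightarrow> 'h \<Rightarrow> real) \<Rightarrow>
     ('h \<Rightarrow> 'h) \<Rightarrow> 'h \<Rightarrow> 'h" where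
  "drift A e lam B R v = A v + dual_rep e lam (B v v) + R v"

text \<open>
  The time integral uses the complete measure \<^const>\<open>lebesgue\<close>, since the drift is
  meaningful only for almost every time. The equation in \<open>V'\<close> is equality of functionals on
  \<open>V\<close>, the integral in \<open>V'\<close> being evaluated at \<open>w\<close> under the integral sign.
\<close>

definition local_weak_solution ::
  "'w measure \<Rightarrow> (ennreal \<Rightarrow> 'w measure) \<Rightarrow> (nat \<Rightarrow> real \<Rightarrow> 'w \<Rightarrow> real) \<Rightarrow>
     (nat \<Rightarrow> 'h) \<Rightarrow> (nat \<Rightarrow> real) \<Rightarrow> ('h \<Rightarrow> 'h \<Rightarrow> 'h \<Rightarrow> real) \<Rightarrow> ('h \<Rightarrow> 'h) \<Rightarrow>
     ('w \<Rightarrow> real \<Rightarrow> 'h \<Rightarrow> nat \<Rightarrow> 'h) \<Rightarrow> ('w \<Rightarrow> 'h::{real_inner, banach, second_countable_topology}) \<Rightarrow>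
     (real \<Rightarrow> 'w \<Rightarrow> 'h) \<Rightarrow> ('w \<Rightarrow> ennreal) \<Rightarrow> bool" where
  "local_weak_solution M F \<beta> e lam B R g \<Phi>0 \<Phi> \<tau> \<longleftrightarrow>
     Linf_rv M UNIV norm \<Phi>0 \<and>
     stopping_time F \<tau> \<and> (AE \<omega> in M. 0 < \<tau> \<omega>) \<and>
     (\<lambda>(\<omega>, t). dual_embed e lam (\<Phi> (stopped \<tau> t \<omega>) \<omega>)) \<in>
       predictable_algebra M F \<rightarrow>\<^sub>M norm_borel (dual_space e lam) (dual_norm e lam) \<and>
     L2_weakly_cont M (\<lambda>t \<omega>. \<Phi> (stopped \<tau> t \<omega>) \<omega>) \<and>
     L2_L2loc M (V_space e lam) (V_norm e lam) \<tau> \<Phi> \<and>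
     (\<forall>t>0. \<exists>I. has_stochastic_integral M F \<beta> (noise_integrand g \<Phi> \<tau>) t I \<and>
        (AE \<omega> in M. \<forall>w\<in>V_space e lam.
           set_integrable lebesgue {0..stopped \<tau> t \<omega>} (\<lambda>s. drift_dual e lam B R (\<Phi> s \<omega>) w) \<and>
           \<Phi> (stopped \<tau> t \<omega>) \<omega> \<bullet> w +
             (LINT s:{0..stopped \<tau> t \<omega>}|lebesgue. drift_dual e lam B R (\<Phi> s \<omega>) w)
           = \<Phi>0 \<omega> \<bullet> w + I \<omega> \<bullet> w))"

definition local_strong_solution ::
  "'w measure \<Rightarrow> (ennreal \<Rightarrow> 'w measure) \<Rightarrow> (nat \<Rightarrow> real \<Rightarrow> 'w \<Rightarrow> real) \<Rightarrow>
     'h set \<Rightarrow> ('h \<Rightarrow> 'h) \<Rightarrow> (nat \<Rightarrow> 'h) \<Rightarrow> (nat \<Rightarrow> real) \<Rightarrow> ('h \<Rightarrow> 'h \<Rightarrow> 'h \<Rightarrow> real) \<Rightarrow> ('h \<Rightarrow> 'h) \<Rightarrow>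
     ('w \<Rightarrow> real \<Rightarrow> 'h \<Rightarrow> nat \<Rightarrow> 'h) \<Rightarrow> ('w \<Rightarrow> 'h::{real_inner, banach, second_countable_topology}) \<Rightarrow>
     (real \<Rightarrow> 'w \<Rightarrow> 'h) \<Rightarrow> ('w \<Rightarrow> ennreal) \<Rightarrow> bool" where
  "local_strong_solution M F \<beta> D A e lam B R g \<Phi>0 \<Phi> \<tau> \<longleftrightarrow>
     local_weak_solution M F \<beta> e lam B R g \<Phi>0 \<Phi> \<tau> \<and>
     Linf_rv M (V_space e lam) (V_norm e lam) \<Phi>0 \<and>
     (\<lambda>(\<omega>, t). \<Phi> (stopped \<tau> t \<omega>) \<omega>) \<in> predictable_algebra M F \<rightarrow>\<^sub>M borel \<and>
     L2_cont M (V_space e lam) (V_norm e lam) (\<lambda>t \<omega>. \<Phi> (stopped \<tau> t \<omega>) \<omega>) \<and>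
     L2_L2loc M D (\<lambda>v. norm (A v)) \<tau> \<Phi> \<and>
     (\<forall>t>0. \<exists>I. has_stochastic_integral M F \<beta> (noise_integrand g \<Phi> \<tau>) t I \<and>
        (AE \<omega> in M.
           set_integrable lebesgue {0..stopped \<tau> t \<omega>} (\<lambda>s. drift A e lam B R (\<Phi> s \<omega>)) \<and>
           \<Phi> (stopped \<tau> t \<omega>) \<omega> +
             (LINT s:{0..stopped \<tau> t \<omega>}|lebesgue. drift A e lam B R (\<Phi> s \<omega>))
           = \<Phi>0 \<omega> + I \<omega>))"

end

theory Submission
  imports Defs
begin

text \<open>
  For the difference \<open>W\<close> of two solutions one wants \<open>E 1\<^bsub>G(t)\<^esub>|W(t)|\<^sup>2 \<le> C \<integral>\<^sub>0\<^sup>t E 1\<^bsub>G(s)\<^esub>|W(s)|\<^sup>2 ds\<close>, where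
  \<open>G(t)\<close> is the event that \<open>t \<le> \<tau>\<close> and both \<open>V\<close>-norms stay below \<open>n\<close> on \<open>[0,t]\<close>. Instead of
  applying an Ito formula and stopping the stochastic integral, expand \<open>|W|\<^sup>2\<close> along a grid of mesh
  \<open>h\<close>. With noise increment \<open>\<Delta>N\<close> and drift increment \<open>\<Delta>Y\<close>,
  \<open>|W(t)|\<^sup>2 \<le> |W(s) + \<Delta>N|\<^sup>2 - 2 \<langle>W(t), \<Delta>Y\<rangle>\<close> on \<open>G(t)\<close>; in the first term \<open>G(t)\<close> may be enlarged to
  \<open>G(s)\<close>, which is known at time \<open>s\<close>, so that the cross term \<open>\<langle>W(s), \<Delta>N\<rangle>\<close> has mean zero. The
  monotonicity of the drift on \<open>V\<close>-balls (from (B2), (B3), (R3) and Young) bounds the second term.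
  The errors sum up to \<open>O(\<surd>h)\<close>; the one caused by the mismatch of \<open>G(s)\<close> and \<open>G(t)\<close> telescopes.
\<close>

section \<open>Moments of Brownian increments\<close>

text \<open>The stochastic integral is given for each fixed time separately, up to a null set and
  without a continuous version, and the equation holds almost surely at each fixed time. Random
  times therefore cannot be substituted into it, whereas deterministic grids and events known at the
  grid points can be handled with what is given. The square is expanded at the right end point
  because the square of the drift increment then has the good sign. The price is that
  \<open>W(t)\<close> is paired with the drift difference at time \<open>r\<close>, while
  monotonicity compares values at one and the same time. Replacing \<open>W(t)\<close> by
  \<open>W(r)\<close> costs \<open>2 <W(r) - W(t), drift>\<close>. The oscillation has mean square
  of order h, and the drift difference is square integrable in time because the solutions are square
  integrable in D(A). Young's inequality with weight \<open>sqrt h\<close> hence bounds this cost by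
  \<open>sqrt h\<close> times an integrable density. The constants in the noise estimates are not
  sharp: Gronwall's lemma absorbs any multiple of the energy.\<close>

locale brownian_basis = prob_space M for M :: "'w measure" +
  fixes F :: "ennreal \<Rightarrow> 'w measure" and \<beta> :: "nat \<Rightarrow> real \<Rightarrow> 'w \<Rightarrow> real"
  assumes stochastic_basis: "stochastic_basis M F \<beta>"
begin

lemma space_F [simp]: "space (F t) = space M"
  and sets_F_subset: "sets (F t) \<subseteq> sets M"
  and sets_F_mono: "s \<le> t \<Longrightarrow> sets (F s) \<subseteq> sets (F t)"
  using stochastic_basis
  by (auto simp: stochastic_basis_def subalgebra_def filtration_def dest: subsetD)

lemma measurable_F_mono: "X \<in> measurable (F s) N \<Longrightarrow> s \<le> t \<Longrightarrow> X \<in> measurable (F t) N"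
  using measurable_mono[OF order_refl refl sets_F_mono[of s t], of N] by auto

lemma measurable_F_M: "X \<in> measurable (F s) N \<Longrightarrow> X \<in> measurable M N"
  using measurable_mono[OF order_refl refl sets_F_subset, of s N] by auto

lemma brownian_adapted: "0 \<le> t \<Longrightarrow> \<beta> k t \<in> borel_measurable (F (ennreal t))"
  using stochastic_basis by (auto simp: stochastic_basis_def brownian_family_def)

lemma brownian_measurable: "0 \<le> t \<Longrightarrow> \<beta> k t \<in> borel_measurable M"
  using brownian_adapted measurable_F_M by blast

text \<open>The Gaussian law is prescribed for \<open>s < t\<close> only. The degenerate case
  \<open>s = t\<close>, which occurs when intervals are cut off by minima or maxima of times, is
  separate and trivial.\<close>

lemma increment_moments:
  assumes "0 \<le> s" "s \<le> t"
  shows "integrable M (\<lambda>\<omega>. \<beta> k t \<omega> - \<beta> k s \<omega>)" "expectation (\<lambda>\<omega>. \<beta> k t \<omega> - \<beta> k s \<omega>) = 0"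
    "integrable M (\<lambda>\<omega>. (\<beta> k t \<omega> - \<beta> k s \<omega>)\<^sup>2)" "expectation (\<lambda>\<omega>. (\<beta> k t \<omega> - \<beta> k s \<omega>)\<^sup>2) = t - s"
proof -
  let ?d = "\<lambda>\<omega>. \<beta> k t \<omega> - \<beta> k s \<omega>"
  have "integrable M ?d \<and> expectation ?d = 0 \<and> integrable M (\<lambda>\<omega>. (?d \<omega>)\<^sup>2) \<and> expectation (\<lambda>\<omega>. (?d \<omega>)\<^sup>2) = t - s"
  proof (cases "s = t")
    case False
    then have pos: "0 < sqrt (t - s)" using assms by simp
    have D: "distributed M lborel ?d (normal_density 0 (sqrt (t - s)))"
      using stochastic_basis assms False by (auto simp: stochastic_basis_def brownian_family_def)
    have E: "expectation ?d = 0" by (rule normal_distributed_expectation[OF pos D])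
    have V: "variance ?d = (sqrt (t - s))\<^sup>2" by (rule normal_distributed_variance[OF pos D])
    have I: "integrable M (\<lambda>\<omega>. (?d \<omega>)^n)" for n
      using integrable_normal_moment[OF pos, of 0 n]
      by (subst distributed_integrable[OF D, symmetric]) (auto simp: mult.commute)
    have "integrable M ?d" using I[of 1] by simp
    then show ?thesis using E V I[of 2] assms by simp
  qed (simp)
  then show "integrable M ?d" "expectation ?d = 0" "integrable M (\<lambda>\<omega>. (?d \<omega>)\<^sup>2)"
    "expectation (\<lambda>\<omega>. (?d \<omega>)\<^sup>2) = t - s" by auto
qed

text \<open>Independence of the past is postulated for the sigma-algebra generated by the whole
  sequence of increments, so it passes to every measurable functional \<open>\<phi>\<close> of that
  sequence. Below, \<open>\<phi>\<close> is a single coordinate or a product of two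
  coordinates.\<close>

lemma indep_past_increments:
  fixes X :: "'w \<Rightarrow> real" and \<phi> :: "(nat \<Rightarrow> real) \<Rightarrow> real"
  assumes st: "0 \<le> s" "s < t" and X: "X \<in> borel_measurable (F (ennreal s))"
    and \<phi>: "\<phi> \<in> borel_measurable (\<Pi>\<^sub>M k\<in>UNIV. borel)"
  shows "indep_var borel X borel (\<lambda>\<omega>. \<phi> (\<lambda>k. \<beta> k t \<omega> - \<beta> k s \<omega>))"
proof -
  let ?d = "\<lambda>\<omega> k. \<beta> k t \<omega> - \<beta> k s \<omega>"
  let ?V = "vimage_algebra (space M) ?d (\<Pi>\<^sub>M k\<in>UNIV. borel)"
  have ind: "indep_set (sets (F (ennreal s))) (sets ?V)"
    using stochastic_basis st by (auto simp: stochastic_basis_def brownian_family_def)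
  have dM: "?d \<in> M \<rightarrow>\<^sub>M (\<Pi>\<^sub>M k\<in>UNIV. borel)"
    using st by (intro measurable_PiM_single') (auto intro!: borel_measurable_diff brownian_measurable)
  have \<phi>M: "(\<lambda>\<omega>. \<phi> (?d \<omega>)) \<in> borel_measurable M"
    using measurable_compose[OF dM \<phi>] by simp
  have \<phi>V: "(\<lambda>\<omega>. \<phi> (?d \<omega>)) \<in> borel_measurable ?V"
    by (rule measurable_compose[OF _ \<phi>], rule measurable_vimage_algebra1) (auto simp: space_PiM)
  interpret S: sigma_algebra "space M" "sets (F (ennreal s))"
    using sets.sigma_algebra_axioms[of "F (ennreal s)"] by simp
  interpret V: sigma_algebra "space M" "sets ?V"
    using sets.sigma_algebra_axioms[of ?V] by simp
  have "sigma_sets (space M) {X -` A \<inter> space M |A. A \<in> sets borel} \<subseteq> sets (F (ennreal s))"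
    by (rule S.sigma_sets_subset) (use measurable_sets[OF X] in auto)
  moreover have "sigma_sets (space M) {(\<lambda>\<omega>. \<phi> (?d \<omega>)) -` A \<inter> space M |A. A \<in> sets borel} \<subseteq> sets ?V"
    by (rule V.sigma_sets_subset) (use measurable_sets[OF \<phi>V] in auto)
  moreover have "X \<in> borel_measurable M" using X by (rule measurable_F_M)
  ultimately show ?thesis
    using ind \<phi>M unfolding indep_var_eq indep_sets2_eq by (meson subset_iff)
qed

text \<open>The product of two increments is a functional of the sequence of increments as well, so
  \<open>X\<close> splits off from it in one step. What remains is a variance or, for distinct
  motions, a product of two means.\<close>

lemma expectation_past_times_increment:
  fixes X :: "'w \<Rightarrow> real"
  assumes st: "0 \<le> s" "s \<le> t" and X: "X \<in> borel_measurable (F (ennreal s))" "integrable M X"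
  shows "integrable M (\<lambda>\<omega>. X \<omega> * (\<beta> k t \<omega> - \<beta> k s \<omega>))"
    "expectation (\<lambda>\<omega>. X \<omega> * (\<beta> k t \<omega> - \<beta> k s \<omega>)) = 0"
    "integrable M (\<lambda>\<omega>. X \<omega> * ((\<beta> k t \<omega> - \<beta> k s \<omega>) * (\<beta> j t \<omega> - \<beta> j s \<omega>)))"
    "expectation (\<lambda>\<omega>. X \<omega> * ((\<beta> k t \<omega> - \<beta> k s \<omega>) * (\<beta> j t \<omega> - \<beta> j s \<omega>)))
      = (if j = k then (t - s) * expectation X else 0)"
proof -
  let ?d = "\<lambda>k \<omega>. \<beta> k t \<omega> - \<beta> k s \<omega>"
  have "integrable M (\<lambda>\<omega>. X \<omega> * ?d k \<omega>) \<and> expectation (\<lambda>\<omega>. X \<omega> * ?d k \<omega>) = 0 \<and>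
    integrable M (\<lambda>\<omega>. X \<omega> * (?d k \<omega> * ?d j \<omega>)) \<and>
    expectation (\<lambda>\<omega>. X \<omega> * (?d k \<omega> * ?d j \<omega>)) = (if j = k then (t - s) * expectation X else 0)"
  proof (cases "s = t")
    case False
    then have st': "s < t" using st by simp
    have 1: "indep_var borel X borel (?d k)"
      using indep_past_increments[OF st(1) st' X(1), of "\<lambda>f. f k"] by simp
    have 2: "indep_var borel X borel (\<lambda>\<omega>. ?d k \<omega> * ?d j \<omega>)"
      using indep_past_increments[OF st(1) st' X(1), of "\<lambda>f. f k * f j"] by simp
    have D: "integrable M (\<lambda>\<omega>. ?d k \<omega> * ?d j \<omega>) \<and>
        expectation (\<lambda>\<omega>. ?d k \<omega> * ?d j \<omega>) = (if j = k then t - s else 0)"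
    proof (cases "j = k")
      case True then show ?thesis using increment_moments(3,4)[OF st, of k] by (simp add: power2_eq_square)
    next
      case False
      have iv: "indep_vars (\<lambda>k. \<Pi>\<^sub>M t\<in>{0..}. borel) (\<lambda>k \<omega>. \<lambda>t\<in>{0..}. \<beta> k t \<omega>) UNIV"
        using stochastic_basis by (auto simp: stochastic_basis_def brownian_family_def)
      \<comment> \<open>Independence is given for whole paths as elements of a product space;
        evaluating a path at \<open>s\<close> and \<open>t\<close> transfers it to the
        increments.\<close>
      have "indep_vars (\<lambda>k. borel) (\<lambda>k. (\<lambda>f. f t - f s) \<circ> (\<lambda>\<omega>. \<lambda>t\<in>{0..}. \<beta> k t \<omega>)) UNIV"
        using st by (intro indep_vars_compose[OF iv] borel_measurable_diff measurable_component_singleton) auto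
      then have "indep_vars (\<lambda>k. borel) ?d UNIV"
        using st by (simp add: o_def)
      then have iv2: "indep_var borel (?d k) borel (?d j)"
        using indep_vars_sum[of "{j}" k ?d] indep_vars_subset[of "\<lambda>_. borel" ?d UNIV "{k, j}"] False by simp
      show ?thesis
        using indep_var_lebesgue_integral[OF iv2] indep_var_integrable[OF iv2]
          increment_moments(1,2)[OF st] False by simp
    qed
    show ?thesis
      using indep_var_lebesgue_integral[OF 1 X(2)] indep_var_integrable[OF 1 X(2)]
        indep_var_lebesgue_integral[OF 2 X(2)] indep_var_integrable[OF 2 X(2)]
        increment_moments(1,2)[OF st, of k] D
      by (simp add: mult.commute)
  qed simp
  then show "integrable M (\<lambda>\<omega>. X \<omega> * ?d k \<omega>)" "expectation (\<lambda>\<omega>. X \<omega> * ?d k \<omega>) = 0"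
    "integrable M (\<lambda>\<omega>. X \<omega> * (?d k \<omega> * ?d j \<omega>))"
    "expectation (\<lambda>\<omega>. X \<omega> * (?d k \<omega> * ?d j \<omega>)) = (if j = k then (t - s) * expectation X else 0)"
    by auto
qed

end

section \<open>Simple integrands and the Ito isometry\<close>

lemma integral_double_sum:
  fixes f :: "'i \<Rightarrow> 'j \<Rightarrow> 'a \<Rightarrow> real"
  assumes "\<And>i j. i \<in> I \<Longrightarrow> j \<in> J \<Longrightarrow> integrable N (f i j)"
  shows "(\<integral>x. (\<Sum>i\<in>I. \<Sum>j\<in>J. f i j x) \<partial>N) = (\<Sum>i\<in>I. \<Sum>j\<in>J. \<integral>x. f i j x \<partial>N)"
  using assms by (simp add: Bochner_Integration.integral_sum Bochner_Integration.integrable_sum)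

context brownian_basis
begin

lemma increment_measurable: "0 \<le> s \<Longrightarrow> s \<le> t \<Longrightarrow> t \<le> u \<Longrightarrow>
    (\<lambda>\<omega>. \<beta> k t \<omega> - \<beta> k s \<omega>) \<in> borel_measurable (F (ennreal u))"
  by (intro borel_measurable_diff measurable_F_mono[OF brownian_adapted]) (auto intro: ennreal_leI)

text \<open>The first increment and \<open>Y\<close> are both known at time \<open>r\<close>, so
  their product is the past factor for the increment that starts at \<open>r\<close>.\<close>

lemma expectation_disjoint_increments:
  fixes Y :: "'w \<Rightarrow> real"
  assumes "0 \<le> p" "p \<le> q" "q \<le> r" "r \<le> u"
    and Y: "Y \<in> borel_measurable (F (ennreal r))" and K: "\<And>\<omega>. \<omega> \<in> space M \<Longrightarrow> \<bar>Y \<omega>\<bar> \<le> K"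
  shows "integrable M (\<lambda>\<omega>. (\<beta> k q \<omega> - \<beta> k p \<omega>) * (\<beta> j u \<omega> - \<beta> j r \<omega>) * Y \<omega>)"
    "expectation (\<lambda>\<omega>. (\<beta> k q \<omega> - \<beta> k p \<omega>) * (\<beta> j u \<omega> - \<beta> j r \<omega>) * Y \<omega>) = 0"
proof -
  let ?X = "\<lambda>\<omega>. (\<beta> k q \<omega> - \<beta> k p \<omega>) * Y \<omega>"
  have m: "?X \<in> borel_measurable (F (ennreal r))"
    using assms by (intro borel_measurable_times increment_measurable) auto
  have i: "integrable M ?X"
  proof (rule Bochner_Integration.integrable_bound)
    show "integrable M (\<lambda>\<omega>. K * (\<beta> k q \<omega> - \<beta> k p \<omega>))"
      using increment_moments(1)[of p q k] assms by simp
    show "?X \<in> borel_measurable M" using m by (rule measurable_F_M)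
    show "AE \<omega> in M. norm (?X \<omega>) \<le> norm (K * (\<beta> k q \<omega> - \<beta> k p \<omega>))"
      using K by (intro AE_I2) (force simp: abs_mult mult.commute intro!: mult_right_mono)
  qed
  have eq: "(\<beta> k q \<omega> - \<beta> k p \<omega>) * (\<beta> j u \<omega> - \<beta> j r \<omega>) * Y \<omega> = ?X \<omega> * (\<beta> j u \<omega> - \<beta> j r \<omega>)" for \<omega>
    by simp
  show "integrable M (\<lambda>\<omega>. (\<beta> k q \<omega> - \<beta> k p \<omega>) * (\<beta> j u \<omega> - \<beta> j r \<omega>) * Y \<omega>)"
    "expectation (\<lambda>\<omega>. (\<beta> k q \<omega> - \<beta> k p \<omega>) * (\<beta> j u \<omega> - \<beta> j r \<omega>) * Y \<omega>) = 0"
    unfolding eq using expectation_past_times_increment(1,2)[of r u ?X j] assms m i by auto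
qed

text \<open>The expression is bilinear in the increments: cutting the two intervals at common points
  leaves pieces that either coincide or lie one after the other. By symmetry the second interval may
  be taken to start later.\<close>

lemma expectation_product_increments:
  fixes Y :: "'w \<Rightarrow> real"
  assumes pq: "0 \<le> p" "p \<le> q" "0 \<le> r" "r \<le> u"
    and Y: "Y \<in> borel_measurable (F (ennreal (max p r)))" and K: "\<And>\<omega>. \<omega> \<in> space M \<Longrightarrow> \<bar>Y \<omega>\<bar> \<le> K"
  shows "integrable M (\<lambda>\<omega>. (\<beta> k q \<omega> - \<beta> k p \<omega>) * (\<beta> j u \<omega> - \<beta> j r \<omega>) * Y \<omega>) \<and>
    expectation (\<lambda>\<omega>. (\<beta> k q \<omega> - \<beta> k p \<omega>) * (\<beta> j u \<omega> - \<beta> j r \<omega>) * Y \<omega>)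
      = (if j = k then max 0 (min q u - max p r) * expectation Y else 0)"
  using pq Y
proof (induction p r arbitrary: q u k j rule: linorder_wlog)
  case (le p r)
  let ?d = "\<lambda>k s t \<omega>. \<beta> k t \<omega> - \<beta> k s \<omega>"
  have Yr: "Y \<in> borel_measurable (F (ennreal r))" using le by (simp add: max_def)
  show ?case
  proof (cases "q \<le> r")
    case True
    then show ?thesis using expectation_disjoint_increments[OF _ _ True _ Yr K, of p u k j] le by auto
  next
    case False
    define m where "m = min q u"
    have m: "r \<le> m" "m \<le> q" "m \<le> u" "m = q \<or> m = u" using False le by (auto simp: m_def)
    have Ym: "Y \<in> borel_measurable (F (ennreal m))"
      using Yr m by (auto intro: measurable_F_mono ennreal_leI)
    have iY: "integrable M Y"
      by (rule integrable_const_bound[of _ K]) (use K Yr in \<open>auto intro: measurable_F_M\<close>)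
    \<comment> \<open>Of the five products that arise from cutting at \<open>r\<close> and
      \<open>m\<close>, the one of the two pieces beyond \<open>m\<close> is missing, because one of
      these pieces is empty. Only the product over \<open>[r, m]\<close> can have a nonzero
      mean.\<close>
    have eq: "?d k p q \<omega> * ?d j r u \<omega> * Y \<omega> =
      (?d k p r \<omega> * ?d j r u \<omega> * Y \<omega> + Y \<omega> * (?d k r m \<omega> * ?d j r m \<omega>)) +
      (?d k r m \<omega> * ?d j m u \<omega> * Y \<omega> + ?d j r m \<omega> * ?d k m q \<omega> * Y \<omega>)" for \<omega>
      using m(4) by (auto simp: algebra_simps)
    have 1: "integrable M (\<lambda>\<omega>. ?d k p r \<omega> * ?d j r u \<omega> * Y \<omega>)" "expectation (\<lambda>\<omega>. ?d k p r \<omega> * ?d j r u \<omega> * Y \<omega>) = 0"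
      using expectation_disjoint_increments[OF _ _ _ _ Yr K, of p r u k j] le m by auto
    have 2: "integrable M (\<lambda>\<omega>. ?d k r m \<omega> * ?d j m u \<omega> * Y \<omega>)" "expectation (\<lambda>\<omega>. ?d k r m \<omega> * ?d j m u \<omega> * Y \<omega>) = 0"
      using expectation_disjoint_increments[OF _ _ _ _ Ym K, of r m u k j] le m by auto
    have 3: "integrable M (\<lambda>\<omega>. ?d j r m \<omega> * ?d k m q \<omega> * Y \<omega>)" "expectation (\<lambda>\<omega>. ?d j r m \<omega> * ?d k m q \<omega> * Y \<omega>) = 0"
      using expectation_disjoint_increments[OF _ _ _ _ Ym K, of r m q j k] le m by auto
    have 4: "integrable M (\<lambda>\<omega>. Y \<omega> * (?d k r m \<omega> * ?d j r m \<omega>))"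
      "expectation (\<lambda>\<omega>. Y \<omega> * (?d k r m \<omega> * ?d j r m \<omega>)) = (if j = k then (m - r) * expectation Y else 0)"
      using expectation_past_times_increment(3,4)[OF _ _ Yr iY, of m k j] le m by auto
    have "max 0 (min q u - max p r) = m - r" using m le by (auto simp: m_def)
    then show ?thesis unfolding eq using 1 2 3 4 by simp
  qed
next
  case (sym r p)
  have "(\<lambda>\<omega>. (\<beta> k q \<omega> - \<beta> k r \<omega>) * (\<beta> j u \<omega> - \<beta> j p \<omega>) * Y \<omega>) =
    (\<lambda>\<omega>. (\<beta> j u \<omega> - \<beta> j p \<omega>) * (\<beta> k q \<omega> - \<beta> k r \<omega>) * Y \<omega>)" by (simp add: mult.commute)
  then show ?case using sym(1)[of u q j k] sym(2-)
    by (simp add: max.commute min.commute eq_commute[of j k])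
qed

end

text \<open>A list of tuples \<open>(k, p, q, \<xi>)\<close> encodes a family of simple integrands, one for each
  Brownian motion: the tuple contributes \<open>\<xi>\<close> on \<open>(p, q]\<close> to the \<open>k\<close>-th one.\<close>

type_synonym ('w, 'h) elem = "nat \<times> real \<times> real \<times> ('w \<Rightarrow> 'h)"

fun elem_ok :: "(ennreal \<Rightarrow> 'w measure) \<Rightarrow> ('w, 'h::real_normed_vector) elem \<Rightarrow> bool" where
  "elem_ok F (k, p, q, \<xi>) \<longleftrightarrow>
     0 \<le> p \<and> p \<le> q \<and> \<xi> \<in> borel_measurable (F (ennreal p)) \<and> bounded (\<xi> ` space (F (ennreal p)))"

fun elem_int :: "(nat \<Rightarrow> real \<Rightarrow> 'w \<Rightarrow> real) \<Rightarrow> real \<Rightarrow> 'w \<Rightarrow> ('w, 'h::real_normed_vector) elem \<Rightarrow> 'h" where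
  "elem_int \<beta> t \<omega> (k, p, q, \<xi>) = (\<beta> k (min t q) \<omega> - \<beta> k (min t p) \<omega>) *\<^sub>R \<xi> \<omega>"

fun elem_val :: "nat \<Rightarrow> real \<Rightarrow> 'w \<Rightarrow> ('w, 'h::real_normed_vector) elem \<Rightarrow> 'h" where
  "elem_val j s \<omega> (k, p, q, \<xi>) = (if j = k then indicator {p<..q} s *\<^sub>R \<xi> \<omega> else 0)"

definition list_int :: "(nat \<Rightarrow> real \<Rightarrow> 'w \<Rightarrow> real) \<Rightarrow> real \<Rightarrow> ('w, 'h::real_normed_vector) elem list \<Rightarrow> 'w \<Rightarrow> 'h" where
  "list_int \<beta> t P \<omega> = (\<Sum>e\<leftarrow>P. elem_int \<beta> t \<omega> e)"

definition list_val :: "('w, 'h::real_normed_vector) elem list \<Rightarrow> nat \<Rightarrow> real \<Rightarrow> 'w \<Rightarrow> 'h" where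
  "list_val P j s \<omega> = (\<Sum>e\<leftarrow>P. elem_val j s \<omega> e)"

context brownian_basis
begin

text \<open>Polarised isometry. Both sides equal the mean of the inner product of the coefficients
  times the length of the overlap of the two intervals within \<open>[0, t]\<close>, or zero if the
  Brownian indices differ. The number \<open>n\<close> exceeds both indices so that the sum over
  \<open>j\<close> sees both components.\<close>

lemma elem_val_covariance:
  fixes a b :: "('w, 'h::{real_inner, banach, second_countable_topology}) elem"
  assumes ok: "elem_ok F a" "elem_ok F b" and t: "0 \<le> t" and n: "fst a < n" "fst b < n"
  defines "h \<equiv> \<lambda>s \<omega>. indicator {0..t} s * (\<Sum>j<n. elem_val j s \<omega> a \<bullet> elem_val j s \<omega> b)"
  shows "integrable lborel (\<lambda>s. h s \<omega>)"
    "integrable M (\<lambda>\<omega>. \<integral>s. h s \<omega> \<partial>lborel)"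
    "integrable M (\<lambda>\<omega>. elem_int \<beta> t \<omega> a \<bullet> elem_int \<beta> t \<omega> b)"
    "expectation (\<lambda>\<omega>. elem_int \<beta> t \<omega> a \<bullet> elem_int \<beta> t \<omega> b) = expectation (\<lambda>\<omega>. \<integral>s. h s \<omega> \<partial>lborel)"
proof -
  obtain k p q \<xi> where a: "a = (k, p, q, \<xi>)" by (cases a)
  obtain j r u \<eta> where b: "b = (j, r, u, \<eta>)" by (cases b)
  have pq: "0 \<le> p" "p \<le> q" "0 \<le> r" "r \<le> u" using ok by (auto simp: a b)
  let ?Y = "\<lambda>\<omega>. \<xi> \<omega> \<bullet> \<eta> \<omega>"
  have "bounded (\<xi> ` space M)" "bounded (\<eta> ` space M)" using ok by (auto simp: a b)
  then obtain K L where KL: "\<And>\<omega>. \<omega> \<in> space M \<Longrightarrow> norm (\<xi> \<omega>) \<le> K" "\<And>\<omega>. \<omega> \<in> space M \<Longrightarrow> norm (\<eta> \<omega>) \<le> L"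
    by (auto simp: bounded_iff)
  have YK: "\<bar>?Y \<omega>\<bar> \<le> K * L" if "\<omega> \<in> space M" for \<omega>
    using Cauchy_Schwarz_ineq2[of "\<xi> \<omega>" "\<eta> \<omega>"] mult_mono[OF KL[OF that]] norm_ge_zero[of "\<xi> \<omega>"] KL(1)[OF that]
    by (meson norm_ge_zero order_trans)
  have Ym: "?Y \<in> borel_measurable (F (ennreal (max p r)))"
    using ok by (intro borel_measurable_inner) (auto simp: a b intro: measurable_F_mono ennreal_leI)
  have iY: "integrable M ?Y"
    by (rule integrable_const_bound[of _ "K * L"]) (use YK Ym in \<open>auto intro: measurable_F_M\<close>)
  define c where "c = (if j = k then measure lborel ({0..t} \<inter> {p<..q} \<inter> {r<..u}) else 0)"
  have h: "h s \<omega> = (if j = k then indicator ({0..t} \<inter> {p<..q} \<inter> {r<..u}) s * ?Y \<omega> else 0)" for s \<omega>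
    using n by (cases "j = k") (auto simp: h_def a b indicator_def if_distrib[of "\<lambda>x. inner x _"]
        if_distrib[of "\<lambda>x. inner _ x"] cong: if_cong)
  have fin: "emeasure lborel ({0..t} \<inter> {p<..q} \<inter> {r<..u}) < \<infinity>"
    by (rule le_less_trans[OF emeasure_mono[of _ "{0..t}"]]) (use t in auto)
  show "integrable lborel (\<lambda>s. h s \<omega>)"
    unfolding h using fin by (cases "j = k") auto
  have ih: "(\<integral>s. h s \<omega> \<partial>lborel) = c * ?Y \<omega>" for \<omega>
    unfolding h c_def by (cases "j = k") auto
  show "integrable M (\<lambda>\<omega>. \<integral>s. h s \<omega> \<partial>lborel)"
    unfolding ih using iY by simp
  have "integrable M (\<lambda>\<omega>. elem_int \<beta> t \<omega> a \<bullet> elem_int \<beta> t \<omega> b) \<and>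
    expectation (\<lambda>\<omega>. elem_int \<beta> t \<omega> a \<bullet> elem_int \<beta> t \<omega> b) = c * expectation ?Y"
  \<comment> \<open>If an interval starts after \<open>t\<close>, truncation at \<open>t\<close>
    makes its increment zero. Otherwise only the right end points are truncated, and the
    coefficients are still known at the left ones.\<close>
  proof (cases "p \<le> t \<and> r \<le> t")
    case True
    have eq: "elem_int \<beta> t \<omega> a \<bullet> elem_int \<beta> t \<omega> b =
      (\<beta> k (min t q) \<omega> - \<beta> k p \<omega>) * (\<beta> j (min t u) \<omega> - \<beta> j r \<omega>) * ?Y \<omega>" for \<omega>
      using True by (simp add: a b min_absorb2)
    have "{0..t} \<inter> {p<..q} \<inter> {r<..u} = {max p r<..min (min t q) (min t u)}"
      using pq by auto
    then have c: "c = (if j = k then max 0 (min (min t q) (min t u) - max p r) else 0)"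
      by (cases "max p r \<le> min (min t q) (min t u)") (auto simp: c_def)
    show ?thesis unfolding eq c
      using expectation_product_increments[of p "min t q" r "min t u" ?Y "K * L" k j] pq True Ym YK by auto
  next
    case False
    then have "elem_int \<beta> t \<omega> a \<bullet> elem_int \<beta> t \<omega> b = 0" for \<omega> using pq by (auto simp: a b min_def)
    moreover have "{0..t} \<inter> {p<..q} \<inter> {r<..u} = {}" using False by auto
    ultimately show ?thesis by (auto simp: c_def)
  qed
  then show "integrable M (\<lambda>\<omega>. elem_int \<beta> t \<omega> a \<bullet> elem_int \<beta> t \<omega> b)"
    "expectation (\<lambda>\<omega>. elem_int \<beta> t \<omega> a \<bullet> elem_int \<beta> t \<omega> b) = expectation (\<lambda>\<omega>. \<integral>s. h s \<omega> \<partial>lborel)"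
    unfolding ih by auto
qed

text \<open>Intervals of different tuples may overlap, and no disjoint normal form is sought: both
  squares are expanded into double sums over pairs of tuples, whose summands agree by the polarised
  identity. The single summands have no sign; the passage to nonnegative integrals uses that the
  full double sums are nonnegative.\<close>

lemma list_isometry:
  fixes P :: "('w, 'h::{real_inner, banach, second_countable_topology}) elem list"
  assumes ok: "\<And>e. e \<in> set P \<Longrightarrow> elem_ok F e \<and> fst e < n" and t: "0 \<le> t"
  shows "(\<integral>\<^sup>+\<omega>. ennreal ((norm (list_int \<beta> t P \<omega>))\<^sup>2) \<partial>M) =
    (\<integral>\<^sup>+\<omega>. (\<integral>\<^sup>+s\<in>{0..t}. ennreal (\<Sum>j<n. (norm (list_val P j s \<omega>))\<^sup>2) \<partial>lborel) \<partial>M)"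
proof -
  let ?I = "{..<length P}"
  let ?h = "\<lambda>i i' s \<omega>. indicator {0..t} s * (\<Sum>j<n. elem_val j s \<omega> (P ! i) \<bullet> elem_val j s \<omega> (P ! i'))"
  have ok': "elem_ok F (P ! i)" "fst (P ! i) < n" if "i < length P" for i
    using ok[of "P ! i"] that by auto
  note cov = elem_val_covariance[OF ok'(1) ok'(1) t ok'(2) ok'(2)]
  have li: "list_int \<beta> t P \<omega> = (\<Sum>i\<in>?I. elem_int \<beta> t \<omega> (P ! i))" for \<omega>
    by (simp add: list_int_def sum_list_sum_nth atLeast0LessThan)
  have lv: "list_val P j s \<omega> = (\<Sum>i\<in>?I. elem_val j s \<omega> (P ! i))" for j s \<omega>
    by (simp add: list_val_def sum_list_sum_nth atLeast0LessThan)
  have ni: "(norm (list_int \<beta> t P \<omega>))\<^sup>2 = (\<Sum>i\<in>?I. \<Sum>i'\<in>?I. elem_int \<beta> t \<omega> (P ! i) \<bullet> elem_int \<beta> t \<omega> (P ! i'))" for \<omega>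
    by (simp add: li power2_norm_eq_inner inner_sum_left inner_sum_right) (subst sum.swap, rule refl)
  have nv: "indicator {0..t} s * (\<Sum>j<n. (norm (list_val P j s \<omega>))\<^sup>2) = (\<Sum>i\<in>?I. \<Sum>i'\<in>?I. ?h i i' s \<omega>)" for s \<omega>
  proof -
    have "(\<Sum>j<n. (norm (list_val P j s \<omega>))\<^sup>2) =
        (\<Sum>j<n. \<Sum>i\<in>?I. \<Sum>i'\<in>?I. elem_val j s \<omega> (P ! i) \<bullet> elem_val j s \<omega> (P ! i'))"
      by (simp add: lv power2_norm_eq_inner inner_sum_left inner_sum_right) (subst (2) sum.swap, rule refl)
    also have "\<dots> = (\<Sum>i\<in>?I. \<Sum>i'\<in>?I. \<Sum>j<n. elem_val j s \<omega> (P ! i) \<bullet> elem_val j s \<omega> (P ! i'))"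
      by (subst sum.swap, intro sum.cong refl sum.swap)
    finally show ?thesis by (simp only: sum_distrib_left)
  qed
  have h_nonneg: "0 \<le> (\<Sum>i\<in>?I. \<Sum>i'\<in>?I. ?h i i' s \<omega>)" for s \<omega>
    unfolding nv[symmetric] by (intro mult_nonneg_nonneg sum_nonneg) auto
  have "(\<integral>\<^sup>+s\<in>{0..t}. ennreal (\<Sum>j<n. (norm (list_val P j s \<omega>))\<^sup>2) \<partial>lborel) =
      (\<integral>\<^sup>+s. ennreal (\<Sum>i\<in>?I. \<Sum>i'\<in>?I. ?h i i' s \<omega>) \<partial>lborel)" for \<omega>
    unfolding nv[symmetric] by (intro nn_integral_cong) (auto simp: indicator_def)
  also have "\<dots> \<omega> = ennreal (\<integral>s. (\<Sum>i\<in>?I. \<Sum>i'\<in>?I. ?h i i' s \<omega>) \<partial>lborel)" for \<omega>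
    by (rule nn_integral_eq_integral)
      (intro Bochner_Integration.integrable_sum cov(1), auto simp only: h_nonneg)
  also have "(\<integral>s. (\<Sum>i\<in>?I. \<Sum>i'\<in>?I. ?h i i' s \<omega>) \<partial>lborel) = (\<Sum>i\<in>?I. \<Sum>i'\<in>?I. (\<integral>s. ?h i i' s \<omega> \<partial>lborel))" for \<omega>
    by (intro integral_double_sum cov(1)) auto
  finally have inner: "(\<integral>\<^sup>+s\<in>{0..t}. ennreal (\<Sum>j<n. (norm (list_val P j s \<omega>))\<^sup>2) \<partial>lborel) =
    ennreal (\<Sum>i\<in>?I. \<Sum>i'\<in>?I. (\<integral>s. ?h i i' s \<omega> \<partial>lborel))" for \<omega> .
  have pos: "0 \<le> (\<Sum>i\<in>?I. \<Sum>i'\<in>?I. (\<integral>s. ?h i i' s \<omega> \<partial>lborel))" for \<omega>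
  proof -
    have "(\<Sum>i\<in>?I. \<Sum>i'\<in>?I. (\<integral>s. ?h i i' s \<omega> \<partial>lborel)) = (\<integral>s. (\<Sum>i\<in>?I. \<Sum>i'\<in>?I. ?h i i' s \<omega>) \<partial>lborel)"
      by (intro integral_double_sum[symmetric] cov(1)) auto
    also have "\<dots> \<ge> 0" by (intro Bochner_Integration.integral_nonneg) (simp_all only: h_nonneg)
    finally show ?thesis .
  qed
  have "(\<integral>\<^sup>+\<omega>. ennreal (\<Sum>i\<in>?I. \<Sum>i'\<in>?I. (\<integral>s. ?h i i' s \<omega> \<partial>lborel)) \<partial>M) =
      ennreal (expectation (\<lambda>\<omega>. \<Sum>i\<in>?I. \<Sum>i'\<in>?I. (\<integral>s. ?h i i' s \<omega> \<partial>lborel)))"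
    using pos by (intro nn_integral_eq_integral) (auto intro!: Bochner_Integration.integrable_sum cov(2))
  also have "expectation (\<lambda>\<omega>. \<Sum>i\<in>?I. \<Sum>i'\<in>?I. (\<integral>s. ?h i i' s \<omega> \<partial>lborel)) =
      (\<Sum>i\<in>?I. \<Sum>i'\<in>?I. expectation (\<lambda>\<omega>. \<integral>s. ?h i i' s \<omega> \<partial>lborel))"
    by (intro integral_double_sum cov(2)) auto
  also have "\<dots> = (\<Sum>i\<in>?I. \<Sum>i'\<in>?I. expectation (\<lambda>\<omega>. elem_int \<beta> t \<omega> (P ! i) \<bullet> elem_int \<beta> t \<omega> (P ! i')))"
    by (intro sum.cong refl) (simp add: cov(4))
  also have "\<dots> = expectation (\<lambda>\<omega>. (norm (list_int \<beta> t P \<omega>))\<^sup>2)"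
    unfolding ni by (intro integral_double_sum[symmetric] cov(3)) auto
  also have "ennreal \<dots> = (\<integral>\<^sup>+\<omega>. ennreal ((norm (list_int \<beta> t P \<omega>))\<^sup>2) \<partial>M)"
    by (rule nn_integral_eq_integral[symmetric], unfold ni, intro Bochner_Integration.integrable_sum cov(3))
      (auto simp flip: ni)
  finally show ?thesis unfolding inner by simp
qed

end

section \<open>Mean-square distances of random vectors\<close>

lemma norm_add_sq_le: "(norm (x + y :: 'a::real_normed_vector))\<^sup>2 \<le> 2 * (norm x)\<^sup>2 + 2 * (norm y)\<^sup>2"
proof -
  have "(norm (x + y))\<^sup>2 \<le> (norm x + norm y)\<^sup>2" by (intro power_mono norm_triangle_ineq) auto
  also have "\<dots> \<le> 2 * (norm x)\<^sup>2 + 2 * (norm y)\<^sup>2"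
    using sum_squares_bound[of "norm x" "norm y"] by (simp add: power2_sum)
  finally show ?thesis .
qed

lemma ennreal_norm_add_sq_le: "ennreal ((norm (x + y :: 'a::real_normed_vector))\<^sup>2) \<le>
    2 * ennreal ((norm x)\<^sup>2) + 2 * ennreal ((norm y)\<^sup>2)"
  using ennreal_leI[OF norm_add_sq_le[of x y]] by (simp add: ennreal_plus ennreal_mult)

text \<open>Squared \<open>L^2\<close> norm with values in \<open>ennreal\<close>, meaningful before
  integrability is known. The inequality with two factors 2 serves as its triangle inequality
  throughout.\<close>

definition mean_sq :: "'w measure \<Rightarrow> ('w \<Rightarrow> 'h::real_normed_vector) \<Rightarrow> ennreal" where
  "mean_sq M X = (\<integral>\<^sup>+\<omega>. ennreal ((norm (X \<omega>))\<^sup>2) \<partial>M)"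

lemma mean_sq_add_le:
  fixes X Y :: "'w \<Rightarrow> 'h::{real_normed_vector, second_countable_topology}"
  assumes [measurable]: "X \<in> borel_measurable M" "Y \<in> borel_measurable M"
  shows "mean_sq M (\<lambda>\<omega>. X \<omega> + Y \<omega>) \<le> 2 * mean_sq M X + 2 * mean_sq M Y"
proof -
  have "mean_sq M (\<lambda>\<omega>. X \<omega> + Y \<omega>) \<le> (\<integral>\<^sup>+\<omega>. 2 * ennreal ((norm (X \<omega>))\<^sup>2) + 2 * ennreal ((norm (Y \<omega>))\<^sup>2) \<partial>M)"
    unfolding mean_sq_def by (intro nn_integral_mono ennreal_norm_add_sq_le)
  also have "\<dots> = 2 * mean_sq M X + 2 * mean_sq M Y"
    by (simp add: mean_sq_def nn_integral_add nn_integral_cmult)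
  finally show ?thesis .
qed

lemma mean_sq_uminus [simp]: "mean_sq M (\<lambda>\<omega>. - X \<omega>) = mean_sq M X"
  by (simp add: mean_sq_def)

lemma mean_sq_diff_le:
  fixes X Y Z :: "'w \<Rightarrow> 'h::{real_normed_vector, second_countable_topology}"
  assumes "X \<in> borel_measurable M" "Y \<in> borel_measurable M" "Z \<in> borel_measurable M"
  shows "mean_sq M (\<lambda>\<omega>. X \<omega> - Z \<omega>) \<le> 2 * mean_sq M (\<lambda>\<omega>. X \<omega> - Y \<omega>) + 2 * mean_sq M (\<lambda>\<omega>. Y \<omega> - Z \<omega>)"
  using mean_sq_add_le[of "\<lambda>\<omega>. X \<omega> - Y \<omega>" M "\<lambda>\<omega>. Y \<omega> - Z \<omega>"] assms by simp

lemma mean_sq_triangle: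
  fixes X Y :: "'w \<Rightarrow> 'h::{real_normed_vector, second_countable_topology}"
  assumes "X \<in> borel_measurable M" "Y \<in> borel_measurable M"
  shows "mean_sq M X \<le> 2 * mean_sq M (\<lambda>\<omega>. X \<omega> - Y \<omega>) + 2 * mean_sq M Y"
  using mean_sq_diff_le[of X M Y "\<lambda>_. 0"] assms by simp

lemma tendsto_zero_double_sum_ennreal:
  fixes a b :: "'i \<Rightarrow> ennreal"
  assumes "(a \<longlongrightarrow> 0) \<F>" "(b \<longlongrightarrow> 0) \<F>"
  shows "((\<lambda>m. 2 * a m + 2 * b m) \<longlongrightarrow> 0) \<F>"
  using tendsto_add[OF ennreal_tendsto_cmult[OF _ assms(1)] ennreal_tendsto_cmult[OF _ assms(2)], of 2 2]
  by simp

lemma tendsto_zero_le_ennreal: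
  fixes a b :: "'i \<Rightarrow> ennreal"
  assumes "(b \<longlongrightarrow> 0) \<F>" "\<And>m. a m \<le> b m" shows "(a \<longlongrightarrow> 0) \<F>"
  by (rule tendsto_sandwich[OF _ _ tendsto_const assms(1)]) (use assms(2) in auto)

lemma mean_sq_finite_integrable:
  fixes X :: "'w \<Rightarrow> 'h::{real_normed_vector, second_countable_topology}"
  assumes "X \<in> borel_measurable M"
  shows "mean_sq M X < \<top> \<longleftrightarrow> integrable M (\<lambda>\<omega>. (norm (X \<omega>))\<^sup>2)"
  using assms by (simp add: mean_sq_def integrable_iff_bounded)

lemma mean_sq_inner_integrable:
  fixes X Y :: "'w \<Rightarrow> 'h::{real_inner, second_countable_topology}"
  assumes [measurable]: "X \<in> borel_measurable M" "Y \<in> borel_measurable M"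
    and "mean_sq M X < \<top>" "mean_sq M Y < \<top>"
  shows "integrable M (\<lambda>\<omega>. X \<omega> \<bullet> Y \<omega>)"
proof (rule Bochner_Integration.integrable_bound)
  show "integrable M (\<lambda>\<omega>. (norm (X \<omega>))\<^sup>2 + (norm (Y \<omega>))\<^sup>2)"
    using assms by (simp add: mean_sq_finite_integrable)
  have "\<bar>x \<bullet> y\<bar> \<le> (norm x)\<^sup>2 + (norm y)\<^sup>2" for x y :: 'h
    using Cauchy_Schwarz_ineq2[of x y] sum_squares_bound[of "norm x" "norm y"]
      zero_le_power2[of "norm x"] zero_le_power2[of "norm y"] mult_nonneg_nonneg[OF norm_ge_zero[of x] norm_ge_zero[of y]]
    by linarith
  then show "AE \<omega> in M. norm (X \<omega> \<bullet> Y \<omega>) \<le> norm ((norm (X \<omega>))\<^sup>2 + (norm (Y \<omega>))\<^sup>2)"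
    by auto
qed measurable

text \<open>Young's inequality with a weight \<open>\<epsilon>\<close> replaces the Cauchy-Schwarz
  inequality for integrals: the error of \<open>Zm m\<close> is paired with \<open>Y\<close>, the
  limit in \<open>m\<close> is taken first, and then \<open>\<epsilon>\<close> tends to
  zero.\<close>

lemma inner_integral_zero_limit:
  fixes Y Z :: "'w \<Rightarrow> 'h::{real_inner, second_countable_topology}" and Zm :: "nat \<Rightarrow> 'w \<Rightarrow> 'h"
  assumes [measurable]: "Y \<in> borel_measurable M" "Z \<in> borel_measurable M" "\<And>m. Zm m \<in> borel_measurable M"
    and fin: "mean_sq M Y < \<top>" "mean_sq M Z < \<top>" "\<And>m. mean_sq M (Zm m) < \<top>"
    and zero: "\<And>m. (\<integral>\<omega>. Y \<omega> \<bullet> Zm m \<omega> \<partial>M) = 0"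
    and lim: "(\<lambda>m. mean_sq M (\<lambda>\<omega>. Z \<omega> - Zm m \<omega>)) \<longlonglongrightarrow> 0"
  shows "(\<integral>\<omega>. Y \<omega> \<bullet> Z \<omega> \<partial>M) = 0"
proof -
  let ?c = "\<integral>\<omega>. (norm (Y \<omega>))\<^sup>2 \<partial>M" and ?d = "\<lambda>m \<omega>. Z \<omega> - Zm m \<omega>"
  have df: "mean_sq M (?d m) < \<top>" for m
    using mean_sq_add_le[of Z M "\<lambda>\<omega>. - Zm m \<omega>"] fin
    by (auto simp: ennreal_mult_less_top less_top intro: le_less_trans)
  have iY: "integrable M (\<lambda>\<omega>. (norm (Y \<omega>))\<^sup>2)" and iD: "integrable M (\<lambda>\<omega>. (norm (?d m \<omega>))\<^sup>2)" for m
    using fin(1) df[of m] mean_sq_finite_integrable[of Y M] mean_sq_finite_integrable[of "?d m" M] by auto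
  have c0: "0 \<le> ?c" by simp
  have limr: "(\<lambda>m. \<integral>\<omega>. (norm (?d m \<omega>))\<^sup>2 \<partial>M) \<longlonglongrightarrow> 0"
  proof -
    have "mean_sq M (?d m) = ennreal (\<integral>\<omega>. (norm (?d m \<omega>))\<^sup>2 \<partial>M)" for m
      unfolding mean_sq_def by (rule nn_integral_eq_integral[OF iD]) auto
    then show ?thesis using lim by (simp add: tendsto_ennreal_iff flip: ennreal_0)
  qed
  have bound: "\<bar>\<integral>\<omega>. Y \<omega> \<bullet> Z \<omega> \<partial>M\<bar> \<le> \<epsilon> * ?c + (\<integral>\<omega>. (norm (?d m \<omega>))\<^sup>2 \<partial>M) / \<epsilon>" if "\<epsilon> > 0" for \<epsilon> m
  proof -
    have "(\<integral>\<omega>. Y \<omega> \<bullet> Z \<omega> \<partial>M) = (\<integral>\<omega>. Y \<omega> \<bullet> Zm m \<omega> + Y \<omega> \<bullet> ?d m \<omega> \<partial>M)"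
      by (simp add: inner_diff_right)
    also have "\<dots> = (\<integral>\<omega>. Y \<omega> \<bullet> ?d m \<omega> \<partial>M)"
      using zero[of m] fin df by (subst Bochner_Integration.integral_add) (auto intro!: mean_sq_inner_integrable)
    also have "\<bar>\<dots>\<bar> \<le> (\<integral>\<omega>. \<epsilon> * (norm (Y \<omega>))\<^sup>2 + (norm (?d m \<omega>))\<^sup>2 / \<epsilon> \<partial>M)"
    proof (rule order_trans[OF integral_abs_bound], rule integral_mono)
      show "integrable M (\<lambda>\<omega>. \<bar>Y \<omega> \<bullet> ?d m \<omega>\<bar>)"
        using fin df by (intro integrable_abs mean_sq_inner_integrable) auto
      fix \<omega>
      let ?u = "norm (Y \<omega>)" and ?v = "norm (?d m \<omega>)"
      have "0 \<le> (\<epsilon> * ?u - ?v)\<^sup>2" by simp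
      then have "\<epsilon> * (2 * (?u * ?v)) \<le> \<epsilon> * (\<epsilon> * ?u\<^sup>2 + ?v\<^sup>2 / \<epsilon>)"
        using that by (simp add: power2_diff power_mult_distrib distrib_left) (simp add: power2_eq_square mult.assoc)
      then have "2 * (?u * ?v) \<le> \<epsilon> * ?u\<^sup>2 + ?v\<^sup>2 / \<epsilon>" using that by (simp only: mult_le_cancel_left_pos)
      moreover have "\<bar>Y \<omega> \<bullet> ?d m \<omega>\<bar> \<le> ?u * ?v" by (rule Cauchy_Schwarz_ineq2)
      moreover have "0 \<le> ?u * ?v" by simp
      ultimately show "\<bar>Y \<omega> \<bullet> ?d m \<omega>\<bar> \<le> \<epsilon> * ?u\<^sup>2 + ?v\<^sup>2 / \<epsilon>" by linarith
    qed (use iY iD in auto)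
    also have "\<dots> = \<epsilon> * ?c + (\<integral>\<omega>. (norm (?d m \<omega>))\<^sup>2 \<partial>M) / \<epsilon>"
      using iY iD by simp
    finally show ?thesis .
  qed
  have small: "\<bar>\<integral>\<omega>. Y \<omega> \<bullet> Z \<omega> \<partial>M\<bar> \<le> \<epsilon> * ?c" if "\<epsilon> > 0" for \<epsilon>
  proof (rule LIMSEQ_le_const)
    show "(\<lambda>m. \<epsilon> * ?c + (\<integral>\<omega>. (norm (?d m \<omega>))\<^sup>2 \<partial>M) / \<epsilon>) \<longlonglongrightarrow> \<epsilon> * ?c"
      using tendsto_add[OF tendsto_const tendsto_divide[OF limr tendsto_const, of \<epsilon>]] that by simp
  qed (use bound[OF that] in blast)
  have *: "\<bar>\<integral>\<omega>. Y \<omega> \<bullet> Z \<omega> \<partial>M\<bar> \<le> 1 / real (Suc n) * ?c" for n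
    by (rule small) simp
  have "(\<lambda>n. 1 / real (Suc n) * ?c) \<longlonglongrightarrow> 0 * ?c"
    by (intro tendsto_mult tendsto_const LIMSEQ_Suc lim_1_over_n)
  then have "\<bar>\<integral>\<omega>. Y \<omega> \<bullet> Z \<omega> \<partial>M\<bar> \<le> 0 * ?c"
    by (rule LIMSEQ_le_const) (use * in blast)
  then show ?thesis by simp
qed

section \<open>Negation and localisation of elementary integrands\<close>

fun elem_neg :: "('w, 'h::real_normed_vector) elem \<Rightarrow> ('w, 'h) elem" where
  "elem_neg (k, p, q, \<xi>) = (k, p, q, \<lambda>\<omega>. - \<xi> \<omega>)"

text \<open>Multiplication of the integrand by the indicators of \<open>A\<close> and of
  \<open>(s, infinity)\<close>. For \<open>A\<close> known at time \<open>s\<close> the result is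
  again an admissible tuple, since its coefficient is used from \<open>max s p\<close> on. An
  interval that ends before \<open>s\<close> degenerates to the empty interval
  \<open>(s, s]\<close>.\<close>

fun elem_restrict :: "real \<Rightarrow> 'w set \<Rightarrow> ('w, 'h::real_normed_vector) elem \<Rightarrow> ('w, 'h) elem" where
  "elem_restrict s A (k, p, q, \<xi>) = (k, max s p, max s q, \<lambda>\<omega>. indicator A \<omega> *\<^sub>R \<xi> \<omega>)"

lemma list_int_append [simp]: "list_int \<beta> t (P @ Q) \<omega> = list_int \<beta> t P \<omega> + list_int \<beta> t Q \<omega>"
  and list_val_append [simp]: "list_val (P @ Q) j s \<omega> = list_val P j s \<omega> + list_val Q j s \<omega>"
  by (simp_all add: list_int_def list_val_def)

lemma list_int_Cons: "list_int \<beta> t (e # P) \<omega> = elem_int \<beta> t \<omega> e + list_int \<beta> t P \<omega>"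
  and list_val_Cons: "list_val (e # P) j s \<omega> = elem_val j s \<omega> e + list_val P j s \<omega>"
  and list_int_Nil [simp]: "list_int \<beta> t [] \<omega> = 0"
  and list_val_Nil [simp]: "list_val [] j s \<omega> = 0"
  by (simp_all add: list_int_def list_val_def)

lemma list_int_neg [simp]: "list_int \<beta> t (map elem_neg P) \<omega> = - list_int \<beta> t P \<omega>"
proof (induction P)
  case (Cons e P) then show ?case by (cases e) (simp add: list_int_Cons)
qed simp

lemma list_val_neg [simp]: "list_val (map elem_neg P) j s \<omega> = - list_val P j s \<omega>"
proof (induction P)
  case (Cons e P) then show ?case by (cases e) (simp add: list_val_Cons)
qed simp

lemma fst_elem [simp]: "fst (elem_neg e) = fst e" "fst (elem_restrict s A e) = fst e"
  by (cases e; simp)+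

lemma elem_ok_neg:
  fixes e :: "('w, 'h::{real_normed_vector, second_countable_topology}) elem"
  shows "elem_ok F e \<Longrightarrow> elem_ok F (elem_neg e)"
proof (cases e)
  case (fields k p q \<xi>)
  assume "elem_ok F e"
  moreover have "bounded (uminus ` X) \<longleftrightarrow> bounded X" for X :: "'h set"
    by (auto simp: bounded_iff)
  from this[of "\<xi> ` space (F (ennreal p))"]
  have "bounded ((\<lambda>\<omega>. - \<xi> \<omega>) ` space (F (ennreal p))) \<longleftrightarrow> bounded (\<xi> ` space (F (ennreal p)))"
    by (simp add: image_image)
  ultimately show ?thesis by (auto simp: fields)
qed

text \<open>Localisation commutes with integration, interval by interval, because \<open>A\<close>
  does not depend on time. This is how the isometry later acquires the indicator of
  \<open>G n s\<close>.\<close>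

lemma list_int_restrict:
  assumes "0 \<le> s" "s \<le> t" "\<And>e. e \<in> set P \<Longrightarrow> elem_ok F e"
  shows "list_int \<beta> t (map (elem_restrict s A) P) \<omega> = indicator A \<omega> *\<^sub>R (list_int \<beta> t P \<omega> - list_int \<beta> s P \<omega>)"
  using assms(3)
proof (induction P)
  case (Cons e P)
  obtain k p q \<xi> where e: "e = (k, p, q, \<xi>)" by (cases e)
  have pq: "0 \<le> p" "p \<le> q" using Cons.prems[of e] by (auto simp: e)
  \<comment> \<open>The end points clamped to \<open>[s, t]\<close> delimit exactly the part of the
    interval that lies in \<open>(s, t]\<close>.\<close>
  have "\<beta> k (min t (max s q)) \<omega> - \<beta> k (min t (max s p)) \<omega> =
    (\<beta> k (min t q) \<omega> - \<beta> k (min t p) \<omega>) - (\<beta> k (min s q) \<omega> - \<beta> k (min s p) \<omega>)"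
    using pq assms(1,2) by (auto simp: min_def max_def)
  then have "elem_int \<beta> t \<omega> (elem_restrict s A e) = indicator A \<omega> *\<^sub>R (elem_int \<beta> t \<omega> e - elem_int \<beta> s \<omega> e)"
    by (simp only: e elem_int.simps elem_restrict.simps scaleR_diff_left[symmetric] scaleR_scaleR mult.commute)
  then show ?case using Cons by (simp add: list_int_Cons algebra_simps)
qed simp

lemma list_val_restrict:
  assumes "0 \<le> s" 
  shows "list_val (map (elem_restrict s A) P) j r \<omega> = (indicator A \<omega> * indicator {s<..} r) *\<^sub>R list_val P j r \<omega>"
proof (induction P)
  case (Cons e P)
  obtain k p q \<xi> where e: "e = (k, p, q, \<xi>)" by (cases e)
  have "elem_val j r \<omega> (elem_restrict s A e) = (indicator A \<omega> * indicator {s<..} r) *\<^sub>R elem_val j r \<omega> e"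
    by (auto simp: e indicator_def)
  then show ?case using Cons by (simp add: list_val_Cons algebra_simps)
qed simp

context brownian_basis
begin

lemma elem_ok_restrict:
  fixes e :: "('w, 'h::{real_normed_vector, second_countable_topology}) elem"
  assumes "elem_ok F e" "0 \<le> s" "A \<in> sets (F (ennreal s))" shows "elem_ok F (elem_restrict s A e)"
proof (cases e)
  case (fields k p q \<xi>)
  have A: "A \<in> sets (F (ennreal (max s p)))"
    using assms sets_F_mono[of "ennreal s" "ennreal (max s p)"] by (auto simp: ennreal_leI)
  have "\<xi> \<in> borel_measurable (F (ennreal (max s p)))"
    using assms by (auto simp: fields intro: measurable_F_mono ennreal_leI)
  then have "(\<lambda>\<omega>. indicator A \<omega> *\<^sub>R \<xi> \<omega>) \<in> borel_measurable (F (ennreal (max s p)))"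
    using A by (intro borel_measurable_scaleR borel_measurable_indicator) auto
  moreover have "bounded ((\<lambda>\<omega>. indicator A \<omega> *\<^sub>R \<xi> \<omega>) ` space M)"
  proof -
    obtain K where "\<And>\<omega>. \<omega> \<in> space M \<Longrightarrow> norm (\<xi> \<omega>) \<le> K" using assms by (auto simp: fields bounded_iff)
    then show ?thesis unfolding bounded_iff
      by (intro exI[of _ "\<bar>K\<bar>"]) (force simp: indicator_def)
  qed
  ultimately show ?thesis using assms by (auto simp: fields)
qed

lemma list_int_measurable:
  fixes P :: "('w, 'h::{real_normed_vector, second_countable_topology}) elem list"
  assumes "\<And>e. e \<in> set P \<Longrightarrow> elem_ok F e" "0 \<le> t"
  shows "list_int \<beta> t P \<in> borel_measurable M"
proof -
  have "(\<lambda>\<omega>. list_int \<beta> t P \<omega>) \<in> borel_measurable M"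
    using assms(1)
  proof (induction P)
    case (Cons e P)
    have "(\<lambda>\<omega>. elem_int \<beta> t \<omega> e) \<in> borel_measurable M"
    proof (cases e)
      case (fields k p q \<xi>)
      then show ?thesis using Cons.prems[of e] assms(2)
        by (auto intro!: borel_measurable_scaleR borel_measurable_diff brownian_measurable
            dest: measurable_F_M)
    qed
    then show ?case using Cons by (auto simp: list_int_Cons)
  qed (simp add: list_int_def[abs_def])
  then show ?thesis by simp
qed

lemma list_int_mean_sq_finite:
  fixes P :: "('w, 'h::{real_inner, banach, second_countable_topology}) elem list"
  assumes "\<And>e. e \<in> set P \<Longrightarrow> elem_ok F e" "0 \<le> t"
  shows "mean_sq M (list_int \<beta> t P) < \<top>"
  using assms(1)
proof (induction P)
  case Nil
  then show ?case by (simp add: mean_sq_def list_int_def)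
next
  case (Cons e P)
  have e: "list_int \<beta> t [e] \<in> borel_measurable M" and P: "list_int \<beta> t P \<in> borel_measurable M"
    by (rule list_int_measurable; use Cons.prems assms(2) in simp)+
  have "integrable M (\<lambda>\<omega>. elem_int \<beta> t \<omega> e \<bullet> elem_int \<beta> t \<omega> e)"
    using Cons.prems[of e] assms(2) elem_val_covariance(3)[of e e t "Suc (fst e)"] by simp
  then have "mean_sq M (list_int \<beta> t [e]) < \<top>"
    using e by (simp add: mean_sq_finite_integrable list_int_Cons power2_norm_eq_inner)
  moreover have "mean_sq M (list_int \<beta> t P) < \<top>" using Cons by auto
  moreover have "list_int \<beta> t (e # P) = (\<lambda>\<omega>. list_int \<beta> t [e] \<omega> + list_int \<beta> t P \<omega>)"
    by (simp add: list_int_Cons fun_eq_iff)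
  ultimately show ?case
    using mean_sq_add_le[OF e P] by (auto simp: ennreal_mult_less_top less_top intro: le_less_trans)
qed

text \<open>Martingale property of elementary integrals. For a single tuple the increment comes from
  one Brownian increment over a subinterval of \<open>[s, t]\<close>, and \<open>Y\<close> times the
  coefficient is known at the left end point of that subinterval.\<close>

lemma list_int_increment_orthogonal:
  fixes P :: "('w, 'h::{real_inner, banach, second_countable_topology}) elem list"
  assumes "\<And>e. e \<in> set P \<Longrightarrow> elem_ok F e" and st: "0 \<le> s" "s \<le> t"
    and Y: "Y \<in> borel_measurable (F (ennreal s))" "mean_sq M Y < \<top>"
  shows "integrable M (\<lambda>\<omega>. Y \<omega> \<bullet> (list_int \<beta> t P \<omega> - list_int \<beta> s P \<omega>)) \<and>
    expectation (\<lambda>\<omega>. Y \<omega> \<bullet> (list_int \<beta> t P \<omega> - list_int \<beta> s P \<omega>)) = 0"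
  using assms(1)
proof (induction P)
  case (Cons e P)
  obtain k p q \<xi> where e: "e = (k, p, q, \<xi>)" by (cases e)
  have ok: "0 \<le> p" "p \<le> q" "\<xi> \<in> borel_measurable (F (ennreal p))" "bounded (\<xi> ` space M)"
    using Cons.prems[of e] by (auto simp: e)
  define p' q' where "p' = min t (max s p)" and "q' = min t (max s q)"
  have pq': "s \<le> p'" "p' \<le> q'" using ok st by (auto simp: p'_def q'_def)
  have *: "Y \<omega> \<bullet> (list_int \<beta> t [e] \<omega> - list_int \<beta> s [e] \<omega>) = (Y \<omega> \<bullet> \<xi> \<omega>) * (\<beta> k q' \<omega> - \<beta> k p' \<omega>)" for \<omega>
  proof -
    \<comment> \<open>Restriction with the full event merely truncates the time interval at
      \<open>s\<close>.\<close>
    have "list_int \<beta> t [e] \<omega> - list_int \<beta> s [e] \<omega> = list_int \<beta> t (map (elem_restrict s UNIV) [e]) \<omega>"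
      using list_int_restrict[OF st, of "[e]" F \<beta> UNIV \<omega>] Cons.prems[of e] by simp
    then show ?thesis by (simp add: e list_int_Cons p'_def q'_def)
  qed
  have 1: "integrable M (\<lambda>\<omega>. Y \<omega> \<bullet> (list_int \<beta> t [e] \<omega> - list_int \<beta> s [e] \<omega>)) \<and>
    expectation (\<lambda>\<omega>. Y \<omega> \<bullet> (list_int \<beta> t [e] \<omega> - list_int \<beta> s [e] \<omega>)) = 0"
  proof (cases "p \<le> t")
    case False
    then have "p' = q'" using ok st by (auto simp: p'_def q'_def)
    then show ?thesis unfolding * by simp
  next
    case True
    then have p': "p' = max s p" using st by (auto simp: p'_def)
    have m: "(\<lambda>\<omega>. Y \<omega> \<bullet> \<xi> \<omega>) \<in> borel_measurable (F (ennreal p'))"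
      using ok Y by (intro borel_measurable_inner) (auto simp: p' intro: measurable_F_mono ennreal_leI)
    have "\<xi> \<in> borel_measurable M" "Y \<in> borel_measurable M" using ok Y by (auto dest: measurable_F_M)
    moreover have "mean_sq M \<xi> < \<top>"
    proof -
      obtain K where "\<And>\<omega>. \<omega> \<in> space M \<Longrightarrow> norm (\<xi> \<omega>) \<le> K" using ok by (auto simp: bounded_iff)
      then have "mean_sq M \<xi> \<le> (\<integral>\<^sup>+\<omega>. ennreal (K\<^sup>2) \<partial>M)"
        unfolding mean_sq_def by (intro nn_integral_mono ennreal_leI power_mono) auto
      then show ?thesis by (auto simp: emeasure_space_1 intro: le_less_trans)
    qed
    ultimately have i: "integrable M (\<lambda>\<omega>. Y \<omega> \<bullet> \<xi> \<omega>)" using Y(2) by (intro mean_sq_inner_integrable)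
    show ?thesis unfolding * using expectation_past_times_increment(1,2)[OF _ pq'(2) m i, of k] pq' st by auto
  qed
  have eq: "Y \<omega> \<bullet> (list_int \<beta> t (e # P) \<omega> - list_int \<beta> s (e # P) \<omega>) =
    Y \<omega> \<bullet> (list_int \<beta> t [e] \<omega> - list_int \<beta> s [e] \<omega>) + Y \<omega> \<bullet> (list_int \<beta> t P \<omega> - list_int \<beta> s P \<omega>)" for \<omega>
    by (simp add: list_int_Cons inner_diff_right inner_add_right)
  have "integrable M (\<lambda>\<omega>. Y \<omega> \<bullet> (list_int \<beta> t P \<omega> - list_int \<beta> s P \<omega>)) \<and>
    expectation (\<lambda>\<omega>. Y \<omega> \<bullet> (list_int \<beta> t P \<omega> - list_int \<beta> s P \<omega>)) = 0" using Cons by auto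
  then show ?case unfolding eq using 1 by simp
qed simp

end

section \<open>The square norm of finitely many processes on the product of probability space and
  time\<close>

definition proc_sq :: "'w measure \<Rightarrow> nat \<Rightarrow> real \<Rightarrow> (nat \<Rightarrow> real \<Rightarrow> 'w \<Rightarrow> 'h::real_normed_vector) \<Rightarrow> ennreal" where
  "proc_sq M n t G = (\<integral>\<^sup>+\<omega>. (\<integral>\<^sup>+s\<in>{0..t}. ennreal (\<Sum>j<n. (norm (G j s \<omega>))\<^sup>2) \<partial>lborel) \<partial>M)"

text \<open>Progressive measurability gives joint measurability on \<open>[0, t]\<close> only, hence
  the cut-off in front of the process.\<close>

definition proc_measurable :: "'w measure \<Rightarrow> nat \<Rightarrow> real \<Rightarrow> (nat \<Rightarrow> real \<Rightarrow> 'w \<Rightarrow> 'h::real_normed_vector) \<Rightarrow> bool" where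
  "proc_measurable M n t G \<longleftrightarrow> (\<forall>j<n. (\<lambda>(\<omega>, s). indicator {0..t} s *\<^sub>R G j s \<omega>) \<in> borel_measurable (M \<Otimes>\<^sub>M lborel))"

lemma proc_sq_eq: "proc_sq M n t G = (\<integral>\<^sup>+\<omega>. (\<integral>\<^sup>+s. (\<Sum>j<n. ennreal ((norm (indicator {0..t} s *\<^sub>R G j s \<omega>))\<^sup>2)) \<partial>lborel) \<partial>M)"
  unfolding proc_sq_def by (intro nn_integral_cong) (auto simp: indicator_def)

lemma proc_measurable_add:
  fixes G H :: "nat \<Rightarrow> real \<Rightarrow> 'w \<Rightarrow> 'h::{real_normed_vector, second_countable_topology}"
  assumes "proc_measurable M n t G" "proc_measurable M n t H"
  shows "proc_measurable M n t (\<lambda>j s \<omega>. G j s \<omega> + H j s \<omega>)"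
  unfolding proc_measurable_def
proof (intro allI impI)
  fix j assume "j < n"
  then have "(\<lambda>x. (case x of (\<omega>, s) \<Rightarrow> indicator {0..t} s *\<^sub>R G j s \<omega>) + (case x of (\<omega>, s) \<Rightarrow> indicator {0..t} s *\<^sub>R H j s \<omega>))
    \<in> borel_measurable (M \<Otimes>\<^sub>M lborel)"
    using assms by (intro borel_measurable_add) (auto simp: proc_measurable_def)
  then show "(\<lambda>(\<omega>, s). indicator {0..t} s *\<^sub>R (G j s \<omega> + H j s \<omega>)) \<in> borel_measurable (M \<Otimes>\<^sub>M lborel)"
    by (simp add: case_prod_beta scaleR_add_right)
qed

lemma proc_measurable_uminus:
  fixes G :: "nat \<Rightarrow> real \<Rightarrow> 'w \<Rightarrow> 'h::{real_normed_vector, second_countable_topology}"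
  assumes "proc_measurable M n t G"
  shows "proc_measurable M n t (\<lambda>j s \<omega>. - G j s \<omega>)"
  unfolding proc_measurable_def
proof (intro allI impI)
  fix j assume "j < n"
  then have "(\<lambda>x. - (case x of (\<omega>, s) \<Rightarrow> indicator {0..t} s *\<^sub>R G j s \<omega>)) \<in> borel_measurable (M \<Otimes>\<^sub>M lborel)"
    using assms by (intro borel_measurable_uminus) (auto simp: proc_measurable_def)
  then show "(\<lambda>(\<omega>, s). indicator {0..t} s *\<^sub>R (- G j s \<omega>)) \<in> borel_measurable (M \<Otimes>\<^sub>M lborel)"
    by (simp add: case_prod_beta)
qed

lemma proc_measurable_mono:
  fixes G :: "nat \<Rightarrow> real \<Rightarrow> 'w \<Rightarrow> 'h::{real_normed_vector, second_countable_topology}"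
  assumes "proc_measurable M n t G" "s \<le> t"
  shows "proc_measurable M n s G"
  unfolding proc_measurable_def
proof (intro allI impI)
  fix j assume "j < n"
  then have "(\<lambda>x. indicator {0..s} (snd x) *\<^sub>R (case x of (\<omega>, s) \<Rightarrow> indicator {0..t} s *\<^sub>R G j s \<omega>))
    \<in> borel_measurable (M \<Otimes>\<^sub>M lborel)"
    using assms by (intro borel_measurable_scaleR) (auto simp: proc_measurable_def)
  also have "(\<lambda>x. indicator {0..s} (snd x) *\<^sub>R (case x of (\<omega>, s) \<Rightarrow> indicator {0..t} s *\<^sub>R G j s \<omega>)) =
      (\<lambda>(\<omega>, r). indicator {0..s} r *\<^sub>R G j r \<omega>)"
    using assms(2) by (auto simp: fun_eq_iff indicator_def)
  finally show "(\<lambda>(\<omega>, r). indicator {0..s} r *\<^sub>R G j r \<omega>) \<in> borel_measurable (M \<Otimes>\<^sub>M lborel)" .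
qed

lemma proc_sq_integrand_measurable:
  fixes G :: "nat \<Rightarrow> real \<Rightarrow> 'w \<Rightarrow> 'h::{real_normed_vector, second_countable_topology}"
  assumes "proc_measurable M n t G"
  shows "(\<lambda>(\<omega>, s). \<Sum>j<n. ennreal ((norm (indicator {0..t} s *\<^sub>R G j s \<omega>))\<^sup>2)) \<in> borel_measurable (M \<Otimes>\<^sub>M lborel)"
proof -
  have "(\<lambda>x. \<Sum>j<n. ennreal ((norm (case x of (\<omega>, s) \<Rightarrow> indicator {0..t} s *\<^sub>R G j s \<omega>))\<^sup>2))
    \<in> borel_measurable (M \<Otimes>\<^sub>M lborel)"
    using assms unfolding proc_measurable_def
    by (intro borel_measurable_sum measurable_compose[OF _ measurable_ennreal] borel_measurable_power
        borel_measurable_norm) auto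
  then show ?thesis by (simp add: case_prod_beta)
qed

lemma proc_sq_add_le:
  fixes G H :: "nat \<Rightarrow> real \<Rightarrow> 'w \<Rightarrow> 'h::{real_normed_vector, second_countable_topology}"
  assumes "proc_measurable M n t G" "proc_measurable M n t H"
  shows "proc_sq M n t (\<lambda>j s \<omega>. G j s \<omega> + H j s \<omega>) \<le> 2 * proc_sq M n t G + 2 * proc_sq M n t H"
proof -
  let ?g = "\<lambda>G \<omega> s. \<Sum>j<n. ennreal ((norm (indicator {0..t} s *\<^sub>R G j s \<omega> :: 'h))\<^sup>2)"
  note m[measurable] = proc_sq_integrand_measurable[OF assms(1)] proc_sq_integrand_measurable[OF assms(2)]
  have m1 [measurable]: "(\<lambda>s. ?g G \<omega> s) \<in> borel_measurable lborel" "(\<lambda>s. ?g H \<omega> s) \<in> borel_measurable lborel"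
    if "\<omega> \<in> space M" for \<omega>
    using measurable_Pair2[OF m(1) that] measurable_Pair2[OF m(2) that] by auto
  have m2 [measurable]: "(\<lambda>\<omega>. \<integral>\<^sup>+s. ?g G \<omega> s \<partial>lborel) \<in> borel_measurable M" "(\<lambda>\<omega>. \<integral>\<^sup>+s. ?g H \<omega> s \<partial>lborel) \<in> borel_measurable M"
    using lborel.borel_measurable_nn_integral[OF m(1)] lborel.borel_measurable_nn_integral[OF m(2)] by auto
  have "?g (\<lambda>j s \<omega>. G j s \<omega> + H j s \<omega>) \<omega> s \<le> 2 * ?g G \<omega> s + 2 * ?g H \<omega> s" for s \<omega>
    unfolding sum_distrib_left sum.distrib[symmetric] scaleR_add_right
    by (intro sum_mono ennreal_norm_add_sq_le)
  then have "proc_sq M n t (\<lambda>j s \<omega>. G j s \<omega> + H j s \<omega>) \<le> (\<integral>\<^sup>+\<omega>. \<integral>\<^sup>+s. 2 * ?g G \<omega> s + 2 * ?g H \<omega> s \<partial>lborel \<partial>M)"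
    unfolding proc_sq_eq by (intro nn_integral_mono)
  also have "\<dots> = (\<integral>\<^sup>+\<omega>. 2 * (\<integral>\<^sup>+s. ?g G \<omega> s \<partial>lborel) + 2 * (\<integral>\<^sup>+s. ?g H \<omega> s \<partial>lborel) \<partial>M)"
    by (intro nn_integral_cong) (simp only: nn_integral_add nn_integral_cmult m1 borel_measurable_times_ennreal
        borel_measurable_const)
  also have "\<dots> = 2 * proc_sq M n t G + 2 * proc_sq M n t H"
    unfolding proc_sq_eq using m2 by (simp only: nn_integral_add nn_integral_cmult borel_measurable_times_ennreal borel_measurable_const)
  finally show ?thesis .
qed

lemma proc_sq_uminus [simp]: "proc_sq M n t (\<lambda>j s \<omega>. - G j s \<omega>) = proc_sq M n t G"
  by (simp add: proc_sq_def)

lemma proc_sq_mono: "s \<le> t \<Longrightarrow> proc_sq M n s G \<le> proc_sq M n t G"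
  unfolding proc_sq_def by (intro nn_integral_mono mult_left_mono) (auto simp: indicator_def)

context brownian_basis
begin

lemma list_val_measurable:
  fixes P :: "('w, 'h::{real_normed_vector, second_countable_topology}) elem list"
  assumes "\<And>e. e \<in> set P \<Longrightarrow> elem_ok F e"
  shows "proc_measurable M n t (list_val P)"
proof -
  have "(\<lambda>(\<omega>, s). list_val P j s \<omega>) \<in> borel_measurable (M \<Otimes>\<^sub>M lborel)" for j
    using assms
  proof (induction P)
    case (Cons e P)
    obtain k p q \<xi> where e: "e = (k, p, q, \<xi>)" by (cases e)
    then have [measurable]: "\<xi> \<in> borel_measurable M" using Cons.prems[of e] by (auto dest: measurable_F_M)
    have "(\<lambda>(\<omega>, s). elem_val j s \<omega> e) \<in> borel_measurable (M \<Otimes>\<^sub>M lborel)"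
      by (simp add: e)
    then have "(\<lambda>x. (case x of (\<omega>, s) \<Rightarrow> elem_val j s \<omega> e) + (case x of (\<omega>, s) \<Rightarrow> list_val P j s \<omega>)) \<in> borel_measurable (M \<Otimes>\<^sub>M lborel)"
      using Cons by (intro borel_measurable_add) auto
    then show ?case by (simp add: list_val_Cons case_prod_beta)
  qed simp
  then have "(\<lambda>x. indicator {0..t} (snd x) *\<^sub>R (case x of (\<omega>, s) \<Rightarrow> list_val P j s \<omega>)) \<in> borel_measurable (M \<Otimes>\<^sub>M lborel)" for j
    by (intro borel_measurable_scaleR) auto
  then show ?thesis by (simp add: proc_measurable_def case_prod_beta)
qed

lemma list_isometry':
  fixes P :: "('w, 'h::{real_inner, banach, second_countable_topology}) elem list"
  assumes ok: "\<And>e. e \<in> set P \<Longrightarrow> elem_ok F e \<and> fst e < n" and t: "0 \<le> t"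
  shows "mean_sq M (list_int \<beta> t P) = proc_sq M n t (list_val P)"
  unfolding mean_sq_def proc_sq_def by (rule list_isometry[OF assms])

text \<open>The first \<open>n\<close> Brownian motions are treated together: one sequence of lists
  approximates all components of the integrand and, at the same time, the sum of their integrals.
  Sums and negatives of integrals then reduce to concatenation and negation of lists, with no common
  refinement of partitions.\<close>

definition ito_limit :: "nat \<Rightarrow> (nat \<Rightarrow> real \<Rightarrow> 'w \<Rightarrow> 'h::real_normed_vector) \<Rightarrow> real \<Rightarrow> ('w \<Rightarrow> 'h) \<Rightarrow>
    (nat \<Rightarrow> ('w, 'h) elem list) \<Rightarrow> bool" where
  "ito_limit n G t I P \<longleftrightarrow> I \<in> borel_measurable M \<and> proc_measurable M n t G \<and>
     (\<forall>m. \<forall>e\<in>set (P m). elem_ok F e \<and> fst e < n) \<and>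
     (\<lambda>m. proc_sq M n t (\<lambda>j s \<omega>. G j s \<omega> - list_val (P m) j s \<omega>)) \<longlonglongrightarrow> 0 \<and>
     (\<lambda>m. mean_sq M (\<lambda>\<omega>. I \<omega> - list_int \<beta> t (P m) \<omega>)) \<longlonglongrightarrow> 0"

lemma ito_limit_add:
  fixes G H :: "nat \<Rightarrow> real \<Rightarrow> 'w \<Rightarrow> 'h::{real_inner, banach, second_countable_topology}"
  assumes "ito_limit n G t I P" "ito_limit n H t J Q" "0 \<le> t"
  shows "ito_limit n (\<lambda>j s \<omega>. G j s \<omega> + H j s \<omega>) t (\<lambda>\<omega>. I \<omega> + J \<omega>) (\<lambda>m. P m @ Q m)"
proof -
  have PQ: "\<And>m e. e \<in> set (P m) \<Longrightarrow> elem_ok F e" "\<And>m e. e \<in> set (Q m) \<Longrightarrow> elem_ok F e"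
    using assms by (auto simp: ito_limit_def)
  have pm: "proc_measurable M n t (\<lambda>j s \<omega>. G j s \<omega> - list_val (P m) j s \<omega>)"
    "proc_measurable M n t (\<lambda>j s \<omega>. H j s \<omega> - list_val (Q m) j s \<omega>)" for m
    using proc_measurable_add[OF _ proc_measurable_uminus[OF list_val_measurable], of n t G "P m"]
      proc_measurable_add[OF _ proc_measurable_uminus[OF list_val_measurable], of n t H "Q m"]
      PQ assms by (auto simp: ito_limit_def)
  have mm: "(\<lambda>\<omega>. I \<omega> - list_int \<beta> t (P m) \<omega>) \<in> borel_measurable M"
    "(\<lambda>\<omega>. J \<omega> - list_int \<beta> t (Q m) \<omega>) \<in> borel_measurable M" for m
    using assms PQ by (auto simp: ito_limit_def intro!: borel_measurable_diff list_int_measurable)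
  have "(\<lambda>m. proc_sq M n t (\<lambda>j s \<omega>. G j s \<omega> + H j s \<omega> - list_val (P m @ Q m) j s \<omega>)) \<longlonglongrightarrow> 0"
  proof (rule tendsto_zero_le_ennreal[OF tendsto_zero_double_sum_ennreal])
    show "proc_sq M n t (\<lambda>j s \<omega>. G j s \<omega> + H j s \<omega> - list_val (P m @ Q m) j s \<omega>) \<le>
      2 * proc_sq M n t (\<lambda>j s \<omega>. G j s \<omega> - list_val (P m) j s \<omega>) +
      2 * proc_sq M n t (\<lambda>j s \<omega>. H j s \<omega> - list_val (Q m) j s \<omega>)" for m
      using proc_sq_add_le[OF pm, of m m] by (simp add: algebra_simps)
  qed (use assms in \<open>auto simp: ito_limit_def\<close>)
  moreover have "(\<lambda>m. mean_sq M (\<lambda>\<omega>. I \<omega> + J \<omega> - list_int \<beta> t (P m @ Q m) \<omega>)) \<longlonglongrightarrow> 0"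
  proof (rule tendsto_zero_le_ennreal[OF tendsto_zero_double_sum_ennreal])
    show "mean_sq M (\<lambda>\<omega>. I \<omega> + J \<omega> - list_int \<beta> t (P m @ Q m) \<omega>) \<le>
      2 * mean_sq M (\<lambda>\<omega>. I \<omega> - list_int \<beta> t (P m) \<omega>) +
      2 * mean_sq M (\<lambda>\<omega>. J \<omega> - list_int \<beta> t (Q m) \<omega>)" for m
      using mean_sq_add_le[OF mm, of m m] by (simp add: algebra_simps)
  qed (use assms in \<open>auto simp: ito_limit_def\<close>)
  ultimately show ?thesis
    using assms by (auto simp: ito_limit_def intro: proc_measurable_add)
qed

lemma ito_limit_uminus:
  fixes G H :: "nat \<Rightarrow> real \<Rightarrow> 'w \<Rightarrow> 'h::{real_inner, banach, second_countable_topology}"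
  assumes "ito_limit n G t I P"
  shows "ito_limit n (\<lambda>j s \<omega>. - G j s \<omega>) t (\<lambda>\<omega>. - I \<omega>) (\<lambda>m. map elem_neg (P m))"
proof -
  have "proc_sq M n t (\<lambda>j s \<omega>. - G j s \<omega> - list_val (map elem_neg (P m)) j s \<omega>) =
    proc_sq M n t (\<lambda>j s \<omega>. G j s \<omega> - list_val (P m) j s \<omega>)" for m
    unfolding proc_sq_def by (simp add: norm_minus_commute)
  moreover have "mean_sq M (\<lambda>\<omega>. - I \<omega> - list_int \<beta> t (map elem_neg (P m)) \<omega>) =
    mean_sq M (\<lambda>\<omega>. I \<omega> - list_int \<beta> t (P m) \<omega>)" for m
    unfolding mean_sq_def by (simp add: norm_minus_commute)
  ultimately show ?thesis using assms
    by (auto simp: ito_limit_def proc_measurable_uminus elem_ok_neg)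
qed

end

section \<open>Mean-square limits\<close>

text \<open>Progressive measurability lives on the restricted time interval and the sigma-algebra at
  time \<open>t\<close>. Enlarging the latter to \<open>M\<close> and extending by zero gives a
  statement on the full product.\<close>

lemma progressive_indicator_measurable:
  fixes X :: "real \<Rightarrow> 'w \<Rightarrow> 'h::real_normed_vector"
  assumes X: "progressive F X" and t: "0 \<le> t" and sub: "sets (F (ennreal t)) \<subseteq> sets M" "space (F (ennreal t)) = space M"
  shows "(\<lambda>(\<omega>, s). indicator {0..t} s *\<^sub>R X s \<omega>) \<in> borel_measurable (M \<Otimes>\<^sub>M lborel)"
proof -
  let ?P = "\<lambda>x::'w \<times> real. snd x \<in> {0..t}"
  let ?R = "restrict_space (M \<Otimes>\<^sub>M lborel) {x. ?P x}"
  have Xt: "(\<lambda>(\<omega>, s). X s \<omega>) \<in> F (ennreal t) \<Otimes>\<^sub>M restrict_space borel {0..t} \<rightarrow>\<^sub>M borel"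
    using X t by (auto simp: progressive_def)
  have "(\<lambda>x. x) \<in> M \<rightarrow>\<^sub>M F (ennreal t)"
    using sub by (intro measurableI) (auto simp: Int_absorb2 dest: sets.sets_into_space)
  then have 1: "fst \<in> ?R \<rightarrow>\<^sub>M F (ennreal t)"
    using measurable_compose[of fst ?R M] by (auto intro: measurable_restrict_space1)
  have 2: "snd \<in> ?R \<rightarrow>\<^sub>M restrict_space borel {0..t}"
    by (intro measurable_restrict_space2 measurable_restrict_space1) (auto simp: space_restrict_space)
  have "(\<lambda>x. (fst x, snd x)) \<in> ?R \<rightarrow>\<^sub>M F (ennreal t) \<Otimes>\<^sub>M restrict_space borel {0..t}"
    using 1 2 by (rule measurable_Pair)
  from measurable_compose[OF this Xt]
  have 3: "(\<lambda>x. X (snd x) (fst x)) \<in> borel_measurable ?R" by (simp add: case_prod_beta)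
  have "(\<lambda>x. if ?P x then X (snd x) (fst x) else 0) \<in> borel_measurable (M \<Otimes>\<^sub>M lborel)"
  proof (subst measurable_If_restrict_space_iff)
    show "{x \<in> space (M \<Otimes>\<^sub>M lborel). ?P x} \<in> sets (M \<Otimes>\<^sub>M lborel)" by measurable
    show "(\<lambda>x. X (snd x) (fst x)) \<in> borel_measurable (restrict_space (M \<Otimes>\<^sub>M lborel) {x. ?P x}) \<and>
      (\<lambda>x. 0) \<in> borel_measurable (restrict_space (M \<Otimes>\<^sub>M lborel) {x. \<not> ?P x})" using 3 by simp
  qed
  also have "(\<lambda>x. if ?P x then X (snd x) (fst x) else 0) = (\<lambda>(\<omega>, s). indicator {0..t} s *\<^sub>R X s \<omega>)"
    by (auto simp: fun_eq_iff indicator_def)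
  finally show ?thesis .
qed

section \<open>Ito integrals as limits of elementary integrals\<close>

context brownian_basis
begin

lemma ito_limit_cong:
  assumes "ito_limit n G t I P" "\<And>j. j < n \<Longrightarrow> G j = H j" "I = J"
  shows "ito_limit n H t J P"
proof -
  have "proc_sq M n t (\<lambda>j s \<omega>. G j s \<omega> - list_val (P m) j s \<omega>) =
    proc_sq M n t (\<lambda>j s \<omega>. H j s \<omega> - list_val (P m) j s \<omega>)" for m
    unfolding proc_sq_def using assms(2) by simp
  then show ?thesis using assms by (simp add: ito_limit_def proc_measurable_def)
qed

lemma ito_limit_zero: "0 \<le> t \<Longrightarrow> ito_limit n (\<lambda>_ _ _. 0) t (\<lambda>_. 0) (\<lambda>_. [])"
  by (simp add: ito_limit_def proc_measurable_def proc_sq_def mean_sq_def)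

text \<open>The steps of an approximating simple process become tuples tagged with the index
  \<open>k\<close>.\<close>

lemma ito_limit_single:
  fixes X :: "real \<Rightarrow> 'w \<Rightarrow> 'h::{real_inner, banach, second_countable_topology}"
  assumes h: "has_ito_integral M F (\<beta> k) X t J" and t: "0 \<le> t" and k: "k < n"
  shows "\<exists>P. ito_limit n (\<lambda>j s \<omega>. if j = k then X s \<omega> else 0) t J P"
proof -
  obtain nm p \<xi> where d: "\<And>m. simple_data F (nm m) (p m) (\<xi> m)"
    and 1: "(\<lambda>m. \<integral>\<^sup>+\<omega>. (\<integral>\<^sup>+s\<in>{0..t}.
            ennreal ((norm (X s \<omega> - simple_process (nm m) (p m) (\<xi> m) s \<omega>))\<^sup>2) \<partial>lborel) \<partial>M) \<longlonglongrightarrow> 0"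
    and 2: "(\<lambda>m. \<integral>\<^sup>+\<omega>. ennreal ((norm (J \<omega> - simple_integral (\<beta> k) (nm m) (p m) (\<xi> m) t \<omega>))\<^sup>2) \<partial>M) \<longlonglongrightarrow> 0"
    and J: "J \<in> borel_measurable M" and X: "progressive F X"
    using h unfolding has_ito_integral_def by auto
  define P where "P m = map (\<lambda>i. (k, p m i, p m (Suc i), \<xi> m i)) [0..<nm m]" for m
  have p0: "0 \<le> p m i" if "i \<le> nm m" for m i
    using that d[of m] by (induction i) (auto simp: simple_data_def intro: order_trans)
  have ok: "elem_ok F e \<and> fst e < n" if "e \<in> set (P m)" for m e
    using that k d[of m] p0[of _ m] unfolding P_def by (auto simp: simple_data_def)
  have lv: "list_val (P m) j s \<omega> = (if j = k then simple_process (nm m) (p m) (\<xi> m) s \<omega> else 0)" for m j s \<omega>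
    by (simp add: list_val_def P_def simple_process_def o_def interv_sum_list_conv_sum_set_nat atLeast0LessThan)
  have li: "list_int \<beta> t (P m) \<omega> = simple_integral (\<beta> k) (nm m) (p m) (\<xi> m) t \<omega>" for m \<omega>
    by (simp add: list_int_def P_def simple_integral_def o_def interv_sum_list_conv_sum_set_nat atLeast0LessThan)
  have "(\<Sum>j<n. (norm ((if j = k then X s \<omega> else 0) - list_val (P m) j s \<omega>))\<^sup>2) =
    (norm (X s \<omega> - simple_process (nm m) (p m) (\<xi> m) s \<omega>))\<^sup>2" for m s \<omega>
  proof -
    have "(\<Sum>j<n. (norm ((if j = k then X s \<omega> else 0) - list_val (P m) j s \<omega>))\<^sup>2) =
      (\<Sum>j<n. if j = k then (norm (X s \<omega> - simple_process (nm m) (p m) (\<xi> m) s \<omega>))\<^sup>2 else 0)"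
      by (intro sum.cong) (auto simp: lv)
    then show ?thesis using k by simp
  qed
  then have "(\<lambda>m. proc_sq M n t (\<lambda>j s \<omega>. (if j = k then X s \<omega> else 0) - list_val (P m) j s \<omega>)) \<longlonglongrightarrow> 0"
    using 1 by (simp add: proc_sq_def)
  moreover have "(\<lambda>m. mean_sq M (\<lambda>\<omega>. J \<omega> - list_int \<beta> t (P m) \<omega>)) \<longlonglongrightarrow> 0"
    using 2 by (simp add: li mean_sq_def)
  moreover have "proc_measurable M n t (\<lambda>j s \<omega>. if j = k then X s \<omega> else 0)"
    unfolding proc_measurable_def
  proof (intro allI impI)
    fix j show "(\<lambda>(\<omega>, s). indicator {0..t} s *\<^sub>R (if j = k then X s \<omega> else 0)) \<in> borel_measurable (M \<Otimes>\<^sub>M lborel)"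
      using progressive_indicator_measurable[OF X t sets_F_subset space_F] by (cases "j = k") simp_all
  qed
  ultimately show ?thesis unfolding ito_limit_def using ok J by blast
qed

text \<open>Induction on the number of active components: each step appends the lists of one further
  Brownian motion.\<close>

lemma ito_limit_sum:
  fixes G :: "nat \<Rightarrow> real \<Rightarrow> 'w \<Rightarrow> 'h::{real_inner, banach, second_countable_topology}"
  assumes h: "\<And>k. has_ito_integral M F (\<beta> k) (G k) t (J k)" and t: "0 \<le> t"
  shows "\<exists>P. ito_limit n G t (\<lambda>\<omega>. \<Sum>k<n. J k \<omega>) P"
proof -
  have "\<exists>P. ito_limit n (\<lambda>j s \<omega>. if j < m then G j s \<omega> else 0) t (\<lambda>\<omega>. \<Sum>k<m. J k \<omega>) P" if "m \<le> n" for m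
    using that
  proof (induction m)
    case 0 then show ?case using ito_limit_zero[OF t] by auto
  next
    case (Suc m)
    then obtain P where "ito_limit n (\<lambda>j s \<omega>. if j < m then G j s \<omega> else 0) t (\<lambda>\<omega>. \<Sum>k<m. J k \<omega>) P" by auto
    moreover obtain Q where "ito_limit n (\<lambda>j s \<omega>. if j = m then G m s \<omega> else 0) t (J m) Q"
      using ito_limit_single[OF h t] Suc.prems by (metis Suc_le_lessD)
    ultimately have *: "ito_limit n (\<lambda>j s \<omega>. (if j < m then G j s \<omega> else 0) + (if j = m then G m s \<omega> else 0)) t
      (\<lambda>\<omega>. (\<Sum>k<m. J k \<omega>) + J m \<omega>) (\<lambda>i. P i @ Q i)" by (rule ito_limit_add[OF _ _ t])
    show ?case by (rule exI, rule ito_limit_cong[OF *]) (auto simp: fun_eq_iff less_Suc_eq)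
  qed
  from this[of n] obtain P where "ito_limit n (\<lambda>j s \<omega>. if j < n then G j s \<omega> else 0) t (\<lambda>\<omega>. \<Sum>k<n. J k \<omega>) P" by auto
  then have "ito_limit n G t (\<lambda>\<omega>. \<Sum>k<n. J k \<omega>) P" by (rule ito_limit_cong) (auto simp: fun_eq_iff)
  then show ?thesis by blast
qed

text \<open>Every increment truncated at time zero vanishes, and convergence of the integrands on
  \<open>[0, t]\<close> implies convergence on \<open>[0, 0]\<close>. The solution equation supplies
  integrals at positive times only; this adds time zero.\<close>

lemma ito_limit_at_zero:
  fixes G :: "nat \<Rightarrow> real \<Rightarrow> 'w \<Rightarrow> 'h::{real_inner, banach, second_countable_topology}"
  assumes "ito_limit n G t I P" "0 \<le> t"
  shows "ito_limit n G 0 (\<lambda>_. 0) P"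
proof -
  have ok: "elem_ok F e" if "e \<in> set (P m)" for m e using assms that by (auto simp: ito_limit_def)
  have "list_int \<beta> 0 Q \<omega> = 0" if "\<And>e. e \<in> set Q \<Longrightarrow> elem_ok F e" for Q :: "('w, 'h) elem list" and \<omega>
    using that
  proof (induction Q)
    case (Cons e Q)
    have "elem_int \<beta> 0 \<omega> e = 0" using Cons.prems[of e] by (cases e) simp
    then show ?case using Cons by (simp add: list_int_Cons)
  qed simp
  then have "list_int \<beta> 0 (P m) \<omega> = 0" for m \<omega> using ok by blast
  moreover have "(\<lambda>m. proc_sq M n 0 (\<lambda>j s \<omega>. G j s \<omega> - list_val (P m) j s \<omega>)) \<longlonglongrightarrow> 0"
    by (rule tendsto_zero_le_ennreal[where b="\<lambda>m. proc_sq M n t (\<lambda>j s \<omega>. G j s \<omega> - list_val (P m) j s \<omega>)"])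
      (use assms in \<open>auto simp: ito_limit_def intro: proc_sq_mono\<close>)
  ultimately show ?thesis
    using assms by (auto simp: ito_limit_def mean_sq_def intro: proc_measurable_mono)
qed

text \<open>The integrals up to \<open>s\<close> and up to \<open>t\<close> come with unrelated approximating sequences; by the
  isometry the sequence belonging to \<open>t\<close> also approximates the integral up to \<open>s\<close>.\<close>

lemma ito_limit_increment_approx:
  fixes G :: "nat \<Rightarrow> real \<Rightarrow> 'w \<Rightarrow> 'h::{real_inner, banach, second_countable_topology}"
  assumes S: "ito_limit n G s I Q" and T: "ito_limit n G t J P" and st: "0 \<le> s" "s \<le> t"
  shows "(\<lambda>m. mean_sq M (\<lambda>\<omega>. (J \<omega> - I \<omega>) - (list_int \<beta> t (P m) \<omega> - list_int \<beta> s (P m) \<omega>))) \<longlonglongrightarrow> 0"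
proof -
  have t: "0 \<le> t" using st by simp
  have P: "elem_ok F e" "fst e < n" if "e \<in> set (P m)" for m e using T that by (auto simp: ito_limit_def)
  have Q: "elem_ok F e" "fst e < n" if "e \<in> set (Q m)" for m e using S that by (auto simp: ito_limit_def)
  have IJ: "I \<in> borel_measurable M" "J \<in> borel_measurable M"
    using S T by (auto simp: ito_limit_def)
  have mP: "list_int \<beta> s (P m) \<in> borel_measurable M" "list_int \<beta> t (P m) \<in> borel_measurable M"
    and mQ: "list_int \<beta> s (Q m) \<in> borel_measurable M" for m
    using list_int_measurable P Q st t by blast+
  have pmG: "proc_measurable M n s G" using S by (simp add: ito_limit_def)
  have pm: "proc_measurable M n s (\<lambda>j r \<omega>. G j r \<omega> - list_val (P m) j r \<omega>)"
    "proc_measurable M n s (\<lambda>j r \<omega>. G j r \<omega> - list_val (Q m) j r \<omega>)" for m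
    using proc_measurable_add[OF pmG proc_measurable_uminus[OF list_val_measurable], of "P m"]
      proc_measurable_add[OF pmG proc_measurable_uminus[OF list_val_measurable], of "Q m"] P(1) Q(1) by auto
  have 1: "(\<lambda>m. mean_sq M (\<lambda>\<omega>. list_int \<beta> s (Q m) \<omega> - list_int \<beta> s (P m) \<omega>)) \<longlonglongrightarrow> 0"
  proof (rule tendsto_zero_le_ennreal[OF tendsto_zero_double_sum_ennreal])
    fix m
    \<comment> \<open>Concatenation with the negated list turns the difference of two elementary
      integrals into one elementary integral, to which the isometry applies.\<close>
    have "mean_sq M (\<lambda>\<omega>. list_int \<beta> s (Q m) \<omega> - list_int \<beta> s (P m) \<omega>) =
        mean_sq M (list_int \<beta> s (Q m @ map elem_neg (P m)))"
      by (simp add: mean_sq_def)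
    also have "\<dots> = proc_sq M n s (list_val (Q m @ map elem_neg (P m)))"
    proof (rule list_isometry')
      fix e assume "e \<in> set (Q m @ map elem_neg (P m))"
      then show "elem_ok F e \<and> fst e < n"
        unfolding set_append set_map by (elim UnE imageE) (simp_all add: P Q elem_ok_neg)
    qed (use st in auto)
    also have "\<dots> = proc_sq M n s (\<lambda>j r \<omega>. (G j r \<omega> - list_val (P m) j r \<omega>) + - (G j r \<omega> - list_val (Q m) j r \<omega>))"
      by (simp add: proc_sq_def)
    also have "\<dots> \<le> 2 * proc_sq M n s (\<lambda>j r \<omega>. G j r \<omega> - list_val (P m) j r \<omega>) +
      2 * proc_sq M n s (\<lambda>j r \<omega>. G j r \<omega> - list_val (Q m) j r \<omega>)"
      using proc_sq_add_le[OF pm(1) proc_measurable_uminus[OF pm(2)], of m m] by (simp only: proc_sq_uminus)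
    finally show "mean_sq M (\<lambda>\<omega>. list_int \<beta> s (Q m) \<omega> - list_int \<beta> s (P m) \<omega>) \<le> \<dots>" .
  next
    show "(\<lambda>m. proc_sq M n s (\<lambda>j r \<omega>. G j r \<omega> - list_val (P m) j r \<omega>)) \<longlonglongrightarrow> 0"
      by (rule tendsto_zero_le_ennreal[where b="\<lambda>m. proc_sq M n t (\<lambda>j s \<omega>. G j s \<omega> - list_val (P m) j s \<omega>)"])
        (use T st in \<open>auto simp: ito_limit_def intro: proc_sq_mono\<close>)
    show "(\<lambda>m. proc_sq M n s (\<lambda>j r \<omega>. G j r \<omega> - list_val (Q m) j r \<omega>)) \<longlonglongrightarrow> 0"
      using S by (simp add: ito_limit_def)
  qed
  have 2: "(\<lambda>m. mean_sq M (\<lambda>\<omega>. I \<omega> - list_int \<beta> s (P m) \<omega>)) \<longlonglongrightarrow> 0"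
  proof (rule tendsto_zero_le_ennreal[OF tendsto_zero_double_sum_ennreal[OF _ 1]])
    show "mean_sq M (\<lambda>\<omega>. I \<omega> - list_int \<beta> s (P m) \<omega>) \<le> 2 * mean_sq M (\<lambda>\<omega>. I \<omega> - list_int \<beta> s (Q m) \<omega>) +
      2 * mean_sq M (\<lambda>\<omega>. list_int \<beta> s (Q m) \<omega> - list_int \<beta> s (P m) \<omega>)" for m
      by (rule mean_sq_diff_le[OF IJ(1) mQ mP(1)])
  qed (use S in \<open>simp add: ito_limit_def\<close>)
  show ?thesis
  proof (rule tendsto_zero_le_ennreal[OF tendsto_zero_double_sum_ennreal[OF _ 2]])
    fix m
    have "mean_sq M (\<lambda>\<omega>. (J \<omega> - list_int \<beta> t (P m) \<omega>) + - (I \<omega> - list_int \<beta> s (P m) \<omega>)) \<le>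
      2 * mean_sq M (\<lambda>\<omega>. J \<omega> - list_int \<beta> t (P m) \<omega>) + 2 * mean_sq M (\<lambda>\<omega>. - (I \<omega> - list_int \<beta> s (P m) \<omega>))"
      using IJ mP by (intro mean_sq_add_le borel_measurable_uminus borel_measurable_diff) auto
    then show "mean_sq M (\<lambda>\<omega>. (J \<omega> - I \<omega>) - (list_int \<beta> t (P m) \<omega> - list_int \<beta> s (P m) \<omega>)) \<le>
      2 * mean_sq M (\<lambda>\<omega>. J \<omega> - list_int \<beta> t (P m) \<omega>) + 2 * mean_sq M (\<lambda>\<omega>. I \<omega> - list_int \<beta> s (P m) \<omega>)"
      using mean_sq_uminus[of M "\<lambda>\<omega>. I \<omega> - list_int \<beta> s (P m) \<omega>"] by (simp add: algebra_simps)
  qed (use T in \<open>simp add: ito_limit_def\<close>)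
qed

text \<open>The isometry is applied to the localised approximants. The factor 4 comes from two uses
  of the inequality for squares of sums: one replaces the increment by an approximant, the other
  replaces the approximating integrand by \<open>G\<close>.\<close>

lemma ito_limit_increment_bound:
  fixes G :: "nat \<Rightarrow> real \<Rightarrow> 'w \<Rightarrow> 'h::{real_inner, banach, second_countable_topology}"
  assumes S: "ito_limit n G s I Q" and T: "ito_limit n G t J P" and st: "0 \<le> s" "s \<le> t"
    and A: "A \<in> sets (F (ennreal s))"
  shows "mean_sq M (\<lambda>\<omega>. indicator A \<omega> *\<^sub>R (J \<omega> - I \<omega>)) \<le>
    4 * proc_sq M n t (\<lambda>j r \<omega>. (indicator A \<omega> * indicator {s<..} r) *\<^sub>R G j r \<omega>)"
proof -
  have t: "0 \<le> t" using st by simp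
  have P: "elem_ok F e" "fst e < n" if "e \<in> set (P m)" for m e using T that by (auto simp: ito_limit_def)
  have IJ: "I \<in> borel_measurable M" "J \<in> borel_measurable M"
    using S T by (auto simp: ito_limit_def)
  have AM [measurable]: "A \<in> sets M" using A sets_F_subset by auto
  have mP: "list_int \<beta> s (P m) \<in> borel_measurable M" "list_int \<beta> t (P m) \<in> borel_measurable M" for m
    using list_int_measurable P st t by blast+
  let ?D = "\<lambda>m \<omega>. list_int \<beta> t (P m) \<omega> - list_int \<beta> s (P m) \<omega>"
  let ?G = "\<lambda>j r \<omega>. (indicator A \<omega> * indicator {s<..} r) *\<^sub>R G j r \<omega>"
  let ?err = "\<lambda>m. 2 * mean_sq M (\<lambda>\<omega>. (J \<omega> - I \<omega>) - ?D m \<omega>) + 2 * (2 * proc_sq M n t (\<lambda>j r \<omega>. G j r \<omega> - list_val (P m) j r \<omega>))"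
  have pmG: "proc_measurable M n t G" using T by (simp add: ito_limit_def)
  have pmd: "proc_measurable M n t (\<lambda>j r \<omega>. (indicator A \<omega> * indicator {s<..} r) *\<^sub>R H j r \<omega>)"
    if "proc_measurable M n t H" for H :: "nat \<Rightarrow> real \<Rightarrow> 'w \<Rightarrow> 'h"
    unfolding proc_measurable_def
  proof (intro allI impI)
    fix j assume "j < n"
    then have "(\<lambda>x. (indicator A (fst x) * indicator {s<..} (snd x)) *\<^sub>R (case x of (\<omega>, r) \<Rightarrow> indicator {0..t} r *\<^sub>R H j r \<omega>))
        \<in> borel_measurable (M \<Otimes>\<^sub>M lborel)"
      using that by (intro borel_measurable_scaleR) (auto simp: proc_measurable_def)
    also have "(\<lambda>x. (indicator A (fst x) * indicator {s<..} (snd x)) *\<^sub>R (case x of (\<omega>, r) \<Rightarrow> indicator {0..t} r *\<^sub>R H j r \<omega>)) =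
      (\<lambda>(\<omega>, r). indicator {0..t} r *\<^sub>R (indicator A \<omega> * indicator {s<..} r) *\<^sub>R H j r \<omega>)"
      by (auto simp: fun_eq_iff mult.commute)
    finally show "(\<lambda>(\<omega>, r). indicator {0..t} r *\<^sub>R (indicator A \<omega> * indicator {s<..} r) *\<^sub>R H j r \<omega>)
       \<in> borel_measurable (M \<Otimes>\<^sub>M lborel)" .
  qed
  have bound: "mean_sq M (\<lambda>\<omega>. indicator A \<omega> *\<^sub>R (J \<omega> - I \<omega>)) \<le> ?err m + 4 * proc_sq M n t ?G" for m
  proof -
    have ok: "elem_ok F e \<and> fst e < n" if "e \<in> set (map (elem_restrict s A) (P m))" for e
      using that unfolding set_map by (elim imageE) (simp add: P elem_ok_restrict[OF _ st(1) A])
    have eq: "mean_sq M (\<lambda>\<omega>. indicator A \<omega> *\<^sub>R ?D m \<omega>) = mean_sq M (list_int \<beta> t (map (elem_restrict s A) (P m)))"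
      using list_int_restrict[OF st, of "P m" F \<beta> A] P(1) by (simp add: mean_sq_def)
    let ?E = "\<lambda>j r \<omega>. (indicator A \<omega> * indicator {s<..} r) *\<^sub>R (G j r \<omega> - list_val (P m) j r \<omega>)"
    have pmE: "proc_measurable M n t ?E"
      using proc_measurable_add[OF pmG proc_measurable_uminus[OF list_val_measurable], of "P m"] P(1)
      by (intro pmd) auto
    have "(\<lambda>j r \<omega>. ?G j r \<omega> + - ?E j r \<omega>) = list_val (map (elem_restrict s A) (P m))"
      by (simp add: fun_eq_iff list_val_restrict[OF st(1)] scaleR_diff_right)
    then have 1: "proc_sq M n t (list_val (map (elem_restrict s A) (P m))) \<le> 2 * proc_sq M n t ?G + 2 * proc_sq M n t ?E"
      using proc_sq_add_le[OF pmd[OF pmG] proc_measurable_uminus[OF pmE]] by (simp only: proc_sq_uminus)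
    have 2: "proc_sq M n t (\<lambda>j r \<omega>. (indicator A \<omega> * indicator {s<..} r) *\<^sub>R (G j r \<omega> - list_val (P m) j r \<omega>)) \<le>
      proc_sq M n t (\<lambda>j r \<omega>. G j r \<omega> - list_val (P m) j r \<omega>)"
      unfolding proc_sq_def by (intro nn_integral_mono mult_right_mono ennreal_leI sum_mono) (auto simp: indicator_def)
    have 3: "mean_sq M (\<lambda>\<omega>. indicator A \<omega> *\<^sub>R (J \<omega> - I \<omega>)) \<le>
      2 * mean_sq M (\<lambda>\<omega>. indicator A \<omega> *\<^sub>R (J \<omega> - I \<omega>) - indicator A \<omega> *\<^sub>R ?D m \<omega>) + 2 * mean_sq M (\<lambda>\<omega>. indicator A \<omega> *\<^sub>R ?D m \<omega>)"
      using IJ mP by (intro mean_sq_triangle borel_measurable_scaleR borel_measurable_diff) auto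
    have 4: "mean_sq M (\<lambda>\<omega>. indicator A \<omega> *\<^sub>R (J \<omega> - I \<omega>) - indicator A \<omega> *\<^sub>R ?D m \<omega>) \<le> mean_sq M (\<lambda>\<omega>. (J \<omega> - I \<omega>) - ?D m \<omega>)"
      unfolding mean_sq_def by (intro nn_integral_mono ennreal_leI) (auto simp: indicator_def)
    have 5: "mean_sq M (\<lambda>\<omega>. indicator A \<omega> *\<^sub>R ?D m \<omega>) \<le>
        2 * proc_sq M n t ?G + 2 * proc_sq M n t (\<lambda>j r \<omega>. G j r \<omega> - list_val (P m) j r \<omega>)"
    proof -
      have "mean_sq M (\<lambda>\<omega>. indicator A \<omega> *\<^sub>R ?D m \<omega>) = proc_sq M n t (list_val (map (elem_restrict s A) (P m)))"
        unfolding eq by (rule list_isometry'[OF ok t])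
      also note 1
      also have "2 * proc_sq M n t ?G + 2 * proc_sq M n t ?E \<le>
          2 * proc_sq M n t ?G + 2 * proc_sq M n t (\<lambda>j r \<omega>. G j r \<omega> - list_val (P m) j r \<omega>)"
        by (intro add_left_mono mult_left_mono 2) simp
      finally show ?thesis .
    qed
    have "mean_sq M (\<lambda>\<omega>. indicator A \<omega> *\<^sub>R (J \<omega> - I \<omega>)) \<le>
      2 * mean_sq M (\<lambda>\<omega>. (J \<omega> - I \<omega>) - ?D m \<omega>) + 2 * (2 * proc_sq M n t ?G + 2 * proc_sq M n t (\<lambda>j r \<omega>. G j r \<omega> - list_val (P m) j r \<omega>))"
      by (rule order_trans[OF 3 add_mono[OF mult_left_mono[OF 4] mult_left_mono[OF 5]]]) simp_all
    then show ?thesis by (simp add: distrib_left add_ac flip: mult.assoc)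
  qed
  have "?err \<longlonglongrightarrow> 0"
  proof (rule tendsto_zero_double_sum_ennreal[OF ito_limit_increment_approx[OF S T st]])
    have "(\<lambda>m. proc_sq M n t (\<lambda>j r \<omega>. G j r \<omega> - list_val (P m) j r \<omega>)) \<longlonglongrightarrow> 0" using T by (simp add: ito_limit_def)
    from ennreal_tendsto_cmult[OF _ this, of 2]
    show "(\<lambda>m. 2 * proc_sq M n t (\<lambda>j r \<omega>. G j r \<omega> - list_val (P m) j r \<omega>)) \<longlonglongrightarrow> 0" by simp
  qed
  then have "(\<lambda>m. ?err m + 4 * proc_sq M n t ?G) \<longlonglongrightarrow> 0 + 4 * proc_sq M n t ?G"
    by (intro tendsto_add tendsto_const)
  then show ?thesis using bound by (intro LIMSEQ_le_const[of _ "4 * proc_sq M n t ?G"]) auto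
qed

text \<open>Elementary increments are orthogonal to \<open>Y\<close> and converge in mean square to
  the increment in question. Finiteness follows by comparison with one approximant at mean-square
  distance less than 1.\<close>

lemma ito_limit_increment_orthogonal:
  fixes G :: "nat \<Rightarrow> real \<Rightarrow> 'w \<Rightarrow> 'h::{real_inner, banach, second_countable_topology}"
  assumes S: "ito_limit n G s I Q" and T: "ito_limit n G t J P" and st: "0 \<le> s" "s \<le> t"
    and Y: "Y \<in> borel_measurable (F (ennreal s))" "mean_sq M Y < \<top>"
  shows "mean_sq M (\<lambda>\<omega>. J \<omega> - I \<omega>) < \<top>" "expectation (\<lambda>\<omega>. Y \<omega> \<bullet> (J \<omega> - I \<omega>)) = 0"
proof -
  have t: "0 \<le> t" using st by simp
  let ?D = "\<lambda>m \<omega>. list_int \<beta> t (P m) \<omega> - list_int \<beta> s (P m) \<omega>"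
  have P: "elem_ok F e" "fst e < n" if "e \<in> set (P m)" for m e using T that by (auto simp: ito_limit_def)
  have mP: "list_int \<beta> s (P m) \<in> borel_measurable M" "list_int \<beta> t (P m) \<in> borel_measurable M" for m
    using list_int_measurable P st t by blast+
  have IJ: "I \<in> borel_measurable M" "J \<in> borel_measurable M"
    using S T by (auto simp: ito_limit_def)
  have finD: "mean_sq M (?D m) < \<top>" for m
  proof -
    have "mean_sq M (list_int \<beta> t (P m)) < \<top>" "mean_sq M (list_int \<beta> s (P m)) < \<top>"
      using list_int_mean_sq_finite P st t by blast+
    moreover have "mean_sq M (\<lambda>\<omega>. list_int \<beta> t (P m) \<omega> + - list_int \<beta> s (P m) \<omega>) \<le>
      2 * mean_sq M (list_int \<beta> t (P m)) + 2 * mean_sq M (\<lambda>\<omega>. - list_int \<beta> s (P m) \<omega>)"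
      using mP by (intro mean_sq_add_le) auto
    ultimately show ?thesis by (auto simp: ennreal_mult_less_top less_top intro: le_less_trans)
  qed
  note lim = ito_limit_increment_approx[OF S T st]
  have "\<forall>\<^sub>F m in sequentially. mean_sq M (\<lambda>\<omega>. (J \<omega> - I \<omega>) - ?D m \<omega>) < 1"
    using order_tendstoD(2)[OF lim, of 1] by simp
  then obtain m where m: "mean_sq M (\<lambda>\<omega>. (J \<omega> - I \<omega>) - ?D m \<omega>) < 1"
    by (auto simp: eventually_sequentially)
  have "mean_sq M (\<lambda>\<omega>. J \<omega> - I \<omega>) \<le> 2 * mean_sq M (\<lambda>\<omega>. (J \<omega> - I \<omega>) - ?D m \<omega>) + 2 * mean_sq M (?D m)"
    using IJ mP by (intro mean_sq_triangle borel_measurable_diff) auto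
  also have "\<dots> < \<top>" using less_trans[OF m ennreal_one_less_top] finD[of m]
    by (simp add: ennreal_mult_less_top)
  finally show fin: "mean_sq M (\<lambda>\<omega>. J \<omega> - I \<omega>) < \<top>" .
  show "expectation (\<lambda>\<omega>. Y \<omega> \<bullet> (J \<omega> - I \<omega>)) = 0"
    by (rule inner_integral_zero_limit[OF _ _ _ Y(2) fin finD _ lim])
      (use IJ mP Y(1) list_int_increment_orthogonal[OF P(1) st Y] in \<open>auto intro: measurable_F_M\<close>)
qed

text \<open>All Brownian motions: stage \<open>n\<close> collects the first \<open>n\<close> of
  them, and the stages converge in mean square. In this form differences of integrals are formed
  stage by stage.\<close>

definition ito_process :: "(nat \<Rightarrow> real \<Rightarrow> 'w \<Rightarrow> 'h::real_normed_vector) \<Rightarrow> real \<Rightarrow> ('w \<Rightarrow> 'h) \<Rightarrow> bool" where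
  "ito_process G t N \<longleftrightarrow> N \<in> borel_measurable M \<and>
     (\<exists>Nn P. (\<forall>n. ito_limit n G t (Nn n) (P n)) \<and> (\<lambda>n. mean_sq M (\<lambda>\<omega>. N \<omega> - Nn n \<omega>)) \<longlonglongrightarrow> 0)"

lemma ito_process_of_stochastic_integral:
  fixes G :: "nat \<Rightarrow> real \<Rightarrow> 'w \<Rightarrow> 'h::{real_inner, banach, second_countable_topology}"
  assumes "has_stochastic_integral M F \<beta> G t I" "0 \<le> t"
  shows "ito_process G t I"
proof -
  obtain J where J: "\<And>k. has_ito_integral M F (\<beta> k) (G k) t (J k)" and I: "I \<in> borel_measurable M"
    and lim: "(\<lambda>n. mean_sq M (\<lambda>\<omega>. I \<omega> - (\<Sum>k<n. J k \<omega>))) \<longlonglongrightarrow> 0"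
    using assms(1) by (auto simp: has_stochastic_integral_def mean_sq_def)
  obtain P where "\<And>n. ito_limit n G t (\<lambda>\<omega>. \<Sum>k<n. J k \<omega>) (P n)"
    using ito_limit_sum[OF J assms(2)] by metis
  then show ?thesis unfolding ito_process_def
    using I lim by (intro conjI exI[of _ "\<lambda>n \<omega>. \<Sum>k<n. J k \<omega>"] exI[of _ P]) auto
qed

lemma ito_process_diff:
  fixes G H :: "nat \<Rightarrow> real \<Rightarrow> 'w \<Rightarrow> 'h::{real_inner, banach, second_countable_topology}"
  assumes "ito_process G t I" "ito_process H t J" "0 \<le> t"
  shows "ito_process (\<lambda>k s \<omega>. G k s \<omega> - H k s \<omega>) t (\<lambda>\<omega>. I \<omega> - J \<omega>)"
proof -
  obtain In P where I: "\<And>n. ito_limit n G t (In n) (P n)" "(\<lambda>n. mean_sq M (\<lambda>\<omega>. I \<omega> - In n \<omega>)) \<longlonglongrightarrow> 0"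
    using assms(1) by (auto simp: ito_process_def)
  obtain Jn Q where J: "\<And>n. ito_limit n H t (Jn n) (Q n)" "(\<lambda>n. mean_sq M (\<lambda>\<omega>. J \<omega> - Jn n \<omega>)) \<longlonglongrightarrow> 0"
    using assms(2) by (auto simp: ito_process_def)
  have m: "I \<in> borel_measurable M" "J \<in> borel_measurable M" "In n \<in> borel_measurable M" "Jn n \<in> borel_measurable M" for n
    using assms I(1)[of n] J(1)[of n] by (auto simp: ito_process_def ito_limit_def)
  have "ito_limit n (\<lambda>k s \<omega>. G k s \<omega> - H k s \<omega>) t (\<lambda>\<omega>. In n \<omega> - Jn n \<omega>) (\<lambda>m. P n m @ map elem_neg (Q n m))" for n
    using ito_limit_add[OF I(1)[of n] ito_limit_uminus[OF J(1)[of n]] assms(3)] by simp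
  moreover have "(\<lambda>n. mean_sq M (\<lambda>\<omega>. I \<omega> - J \<omega> - (In n \<omega> - Jn n \<omega>))) \<longlonglongrightarrow> 0"
  proof (rule tendsto_zero_le_ennreal[OF tendsto_zero_double_sum_ennreal[OF I(2) J(2)]])
    fix n
    have "mean_sq M (\<lambda>\<omega>. (I \<omega> - In n \<omega>) + - (J \<omega> - Jn n \<omega>)) \<le>
      2 * mean_sq M (\<lambda>\<omega>. I \<omega> - In n \<omega>) + 2 * mean_sq M (\<lambda>\<omega>. - (J \<omega> - Jn n \<omega>))"
      using m by (intro mean_sq_add_le) auto
    then show "mean_sq M (\<lambda>\<omega>. I \<omega> - J \<omega> - (In n \<omega> - Jn n \<omega>)) \<le>
      2 * mean_sq M (\<lambda>\<omega>. I \<omega> - In n \<omega>) + 2 * mean_sq M (\<lambda>\<omega>. J \<omega> - Jn n \<omega>)"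
      unfolding mean_sq_uminus by (simp add: algebra_simps)
  qed
  ultimately show ?thesis unfolding ito_process_def
    using m by (intro conjI exI[of _ "\<lambda>n \<omega>. In n \<omega> - Jn n \<omega>"] exI[of _ "\<lambda>n m. P n m @ map elem_neg (Q n m)"]) auto
qed

lemma ito_process_at_zero:
  fixes G :: "nat \<Rightarrow> real \<Rightarrow> 'w \<Rightarrow> 'h::{real_inner, banach, second_countable_topology}"
  assumes "ito_process G t I" "0 \<le> t"
  shows "ito_process G 0 (\<lambda>_. 0)"
proof -
  obtain In P where I: "\<And>n. ito_limit n G t (In n) (P n)"
    using assms(1) by (auto simp: ito_process_def)
  show ?thesis unfolding ito_process_def
    using ito_limit_at_zero[OF I assms(2)]
    by (intro conjI exI[of _ "\<lambda>n \<omega>. 0"] exI[of _ P]) (auto simp: mean_sq_def)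
qed

text \<open>Passage to infinitely many Brownian motions in the localised isometry and in the
  martingale property. One more use of the inequality for squares of sums turns the factor 4 into 8.
  The bound \<open>b\<close> controls all partial sums over the motions at once, so it survives the
  limit in \<open>n\<close>.\<close>

lemma ito_process_increment:
  fixes G :: "nat \<Rightarrow> real \<Rightarrow> 'w \<Rightarrow> 'h::{real_inner, banach, second_countable_topology}"
  assumes S: "ito_process G s I" and T: "ito_process G t J" and st: "0 \<le> s" "s \<le> t"
    and A: "A \<in> sets (F (ennreal s))"
    and bnd: "\<And>n r \<omega>. s < r \<Longrightarrow> r \<le> t \<Longrightarrow> \<omega> \<in> space M \<Longrightarrow> ennreal (\<Sum>j<n. (norm (G j r \<omega>))\<^sup>2) \<le> b r \<omega>"
  shows "mean_sq M (\<lambda>\<omega>. indicator A \<omega> *\<^sub>R (J \<omega> - I \<omega>)) \<le> 8 * (\<integral>\<^sup>+\<omega>\<in>A. (\<integral>\<^sup>+r\<in>{s<..t}. b r \<omega> \<partial>lborel) \<partial>M)"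
    and "Y \<in> borel_measurable (F (ennreal s)) \<Longrightarrow> mean_sq M Y < \<top> \<Longrightarrow>
      mean_sq M (\<lambda>\<omega>. J \<omega> - I \<omega>) < \<top> \<and> expectation (\<lambda>\<omega>. Y \<omega> \<bullet> (J \<omega> - I \<omega>)) = 0"
proof -
  obtain In P where I: "\<And>n. ito_limit n G s (In n) (P n)" "(\<lambda>n. mean_sq M (\<lambda>\<omega>. I \<omega> - In n \<omega>)) \<longlonglongrightarrow> 0"
    using S by (auto simp: ito_process_def)
  obtain Jn Q where J: "\<And>n. ito_limit n G t (Jn n) (Q n)" "(\<lambda>n. mean_sq M (\<lambda>\<omega>. J \<omega> - Jn n \<omega>)) \<longlonglongrightarrow> 0"
    using T by (auto simp: ito_process_def)
  have m: "I \<in> borel_measurable M" "J \<in> borel_measurable M" "In n \<in> borel_measurable M" "Jn n \<in> borel_measurable M" for n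
    using S T I(1)[of n] J(1)[of n] by (auto simp: ito_process_def ito_limit_def)
  have AM: "A \<in> sets M" using A sets_F_subset by auto
  have lim: "(\<lambda>n. mean_sq M (\<lambda>\<omega>. (J \<omega> - I \<omega>) - (Jn n \<omega> - In n \<omega>))) \<longlonglongrightarrow> 0"
  proof (rule tendsto_zero_le_ennreal[OF tendsto_zero_double_sum_ennreal[OF J(2) I(2)]])
    fix n
    have "mean_sq M (\<lambda>\<omega>. (J \<omega> - Jn n \<omega>) + - (I \<omega> - In n \<omega>)) \<le>
      2 * mean_sq M (\<lambda>\<omega>. J \<omega> - Jn n \<omega>) + 2 * mean_sq M (\<lambda>\<omega>. - (I \<omega> - In n \<omega>))"
      using m by (intro mean_sq_add_le) auto
    then show "mean_sq M (\<lambda>\<omega>. (J \<omega> - I \<omega>) - (Jn n \<omega> - In n \<omega>)) \<le>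
      2 * mean_sq M (\<lambda>\<omega>. J \<omega> - Jn n \<omega>) + 2 * mean_sq M (\<lambda>\<omega>. I \<omega> - In n \<omega>)"
      unfolding mean_sq_uminus by (simp add: algebra_simps)
  qed
  let ?B = "\<integral>\<^sup>+\<omega>\<in>A. (\<integral>\<^sup>+r\<in>{s<..t}. b r \<omega> \<partial>lborel) \<partial>M"
  have pB: "proc_sq M n t (\<lambda>j r \<omega>. (indicator A \<omega> * indicator {s<..} r) *\<^sub>R G j r \<omega>) \<le> ?B" for n
  proof -
    have "ennreal (\<Sum>j<n. (norm ((indicator A \<omega> * indicator {s<..} r) *\<^sub>R G j r \<omega>))\<^sup>2) * indicator {0..t} r
      \<le> (b r \<omega> * indicator {s<..t} r) * indicator A \<omega>" if "\<omega> \<in> space M" for r \<omega>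
      using bnd[of r \<omega> n] that st by (auto simp: indicator_def)
    then have "proc_sq M n t (\<lambda>j r \<omega>. (indicator A \<omega> * indicator {s<..} r) *\<^sub>R G j r \<omega>) \<le>
      (\<integral>\<^sup>+\<omega>. (\<integral>\<^sup>+r. (b r \<omega> * indicator {s<..t} r) * indicator A \<omega> \<partial>lborel) \<partial>M)"
      unfolding proc_sq_def by (intro nn_integral_mono)
    also have "\<dots> = ?B" by (intro nn_integral_cong) (auto simp: indicator_def)
    finally show ?thesis .
  qed
  have bound: "mean_sq M (\<lambda>\<omega>. indicator A \<omega> *\<^sub>R (J \<omega> - I \<omega>)) \<le> 2 * mean_sq M (\<lambda>\<omega>. (J \<omega> - I \<omega>) - (Jn n \<omega> - In n \<omega>)) + 8 * ?B" for n
  proof -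
    have 3: "mean_sq M (\<lambda>\<omega>. indicator A \<omega> *\<^sub>R (J \<omega> - I \<omega>)) \<le>
      2 * mean_sq M (\<lambda>\<omega>. indicator A \<omega> *\<^sub>R (J \<omega> - I \<omega>) - indicator A \<omega> *\<^sub>R (Jn n \<omega> - In n \<omega>)) +
      2 * mean_sq M (\<lambda>\<omega>. indicator A \<omega> *\<^sub>R (Jn n \<omega> - In n \<omega>))"
      using m AM by (intro mean_sq_triangle borel_measurable_scaleR borel_measurable_diff) auto
    have 4: "mean_sq M (\<lambda>\<omega>. indicator A \<omega> *\<^sub>R (J \<omega> - I \<omega>) - indicator A \<omega> *\<^sub>R (Jn n \<omega> - In n \<omega>)) \<le>
      mean_sq M (\<lambda>\<omega>. (J \<omega> - I \<omega>) - (Jn n \<omega> - In n \<omega>))"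
      unfolding mean_sq_def by (intro nn_integral_mono ennreal_leI) (auto simp: indicator_def)
    have 5: "mean_sq M (\<lambda>\<omega>. indicator A \<omega> *\<^sub>R (Jn n \<omega> - In n \<omega>)) \<le> 4 * ?B"
      by (rule order_trans[OF ito_limit_increment_bound[OF I(1) J(1) st A] mult_left_mono[OF pB]]) simp
    have "mean_sq M (\<lambda>\<omega>. indicator A \<omega> *\<^sub>R (J \<omega> - I \<omega>)) \<le> 2 * mean_sq M (\<lambda>\<omega>. (J \<omega> - I \<omega>) - (Jn n \<omega> - In n \<omega>)) + 2 * (4 * ?B)"
      by (rule order_trans[OF 3 add_mono[OF mult_left_mono[OF 4] mult_left_mono[OF 5]]]) simp_all
    then show ?thesis by (simp flip: mult.assoc)
  qed
  have "(\<lambda>n. 2 * mean_sq M (\<lambda>\<omega>. (J \<omega> - I \<omega>) - (Jn n \<omega> - In n \<omega>)) + 8 * ?B) \<longlonglongrightarrow> 2 * 0 + 8 * ?B"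
    by (intro tendsto_add tendsto_const ennreal_tendsto_cmult lim) simp
  then show "mean_sq M (\<lambda>\<omega>. indicator A \<omega> *\<^sub>R (J \<omega> - I \<omega>)) \<le> 8 * ?B"
    using bound by (intro LIMSEQ_le_const[of _ "8 * ?B"]) auto
  assume Y: "Y \<in> borel_measurable (F (ennreal s))" "mean_sq M Y < \<top>"
  note orth = ito_limit_increment_orthogonal[OF I(1) J(1) st Y]
  have "\<forall>\<^sub>F n in sequentially. mean_sq M (\<lambda>\<omega>. (J \<omega> - I \<omega>) - (Jn n \<omega> - In n \<omega>)) < 1"
    using order_tendstoD(2)[OF lim, of 1] by simp
  then obtain n where n: "mean_sq M (\<lambda>\<omega>. (J \<omega> - I \<omega>) - (Jn n \<omega> - In n \<omega>)) < 1"
    by (auto simp: eventually_sequentially)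
  have "mean_sq M (\<lambda>\<omega>. J \<omega> - I \<omega>) \<le> 2 * mean_sq M (\<lambda>\<omega>. (J \<omega> - I \<omega>) - (Jn n \<omega> - In n \<omega>)) + 2 * mean_sq M (\<lambda>\<omega>. Jn n \<omega> - In n \<omega>)"
    using m by (intro mean_sq_triangle borel_measurable_diff) auto
  also have "\<dots> < \<top>" using less_trans[OF n ennreal_one_less_top] orth(1)[of n]
    by (simp add: ennreal_mult_less_top)
  finally have fin: "mean_sq M (\<lambda>\<omega>. J \<omega> - I \<omega>) < \<top>" .
  moreover have "expectation (\<lambda>\<omega>. Y \<omega> \<bullet> (J \<omega> - I \<omega>)) = 0"
    by (rule inner_integral_zero_limit[OF _ _ _ Y(2) fin orth(1) orth(2) lim])
      (use m Y(1) in \<open>auto intro: measurable_F_M\<close>)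
  ultimately show "mean_sq M (\<lambda>\<omega>. J \<omega> - I \<omega>) < \<top> \<and> expectation (\<lambda>\<omega>. Y \<omega> \<bullet> (J \<omega> - I \<omega>)) = 0" ..
qed

end

section \<open>The eigenbasis and the drift\<close>

locale hilbert_eigenbasis =
  fixes D :: "'h::{real_inner, banach, second_countable_topology} set"
    and A :: "'h \<Rightarrow> 'h" and e :: "nat \<Rightarrow> 'h" and lam :: "nat \<Rightarrow> real"
  assumes admissible: "admissible_operator D A" and eigenbasis: "eigenbasis D A e lam"
begin

abbreviation "V \<equiv> V_space e lam"
abbreviation "Vn \<equiv> V_norm e lam"

lemma inner_e: "e i \<bullet> e j = (if i = j then 1 else 0)"
  and e_in_D: "e k \<in> D" and A_e: "A (e k) = lam k *\<^sub>R e k" and lam_pos: "0 < lam k"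
  and dense_span: "closure (span (range e)) = UNIV" and lam_mono: "j \<le> k \<Longrightarrow> lam j \<le> lam k"
  using eigenbasis by (auto simp: eigenbasis_def incseq_def)

section \<open>Fourier series with respect to the eigenbasis\<close>

lemma norm_sum_sq:
  assumes "finite K" shows "(norm (\<Sum>k\<in>K. c k *\<^sub>R e k))\<^sup>2 = (\<Sum>k\<in>K. (c k)\<^sup>2)"
  using assms
proof (induction K)
  case (insert j K)
  let ?S = "\<Sum>k\<in>K. c k *\<^sub>R e k"
  have "?S \<bullet> e j = 0" using insert by (auto simp: inner_sum_left inner_e intro!: sum.neutral)
  then have "(norm (c j *\<^sub>R e j + ?S))\<^sup>2 = (c j)\<^sup>2 + (norm ?S)\<^sup>2"
    unfolding power2_norm_eq_inner
    by (simp add: inner_add_left inner_add_right inner_e inner_commute[of "e j"] power2_eq_square)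
  then show ?case by (simp only: sum.insert[OF insert.hyps] insert.IH)
qed simp

text \<open>Riesz-Fischer: by Pythagoras the blocks of the vector series have the same squared norms
  as the blocks of the series of squares, so completeness gives convergence.\<close>

lemma summable_coefficients:
  assumes "summable (\<lambda>k. (c k)\<^sup>2)"
  shows "summable (\<lambda>k. c k *\<^sub>R e k)" "(\<Sum>k. c k *\<^sub>R e k) \<bullet> e j = c j"
    "(norm (\<Sum>k. c k *\<^sub>R e k))\<^sup>2 = (\<Sum>k. (c k)\<^sup>2)"
proof -
  show s: "summable (\<lambda>k. c k *\<^sub>R e k)"
    unfolding summable_Cauchy
  proof (intro allI impI)
    fix \<epsilon> :: real assume "0 < \<epsilon>"
    then obtain N where N: "\<And>m n. m \<ge> N \<Longrightarrow> norm (\<Sum>k=m..<n. (c k)\<^sup>2) < \<epsilon>\<^sup>2"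
      using assms unfolding summable_Cauchy by (meson zero_less_power)
    have "norm (\<Sum>k=m..<n. c k *\<^sub>R e k) < \<epsilon>" if "m \<ge> N" for m n
    proof -
      have "(norm (\<Sum>k=m..<n. c k *\<^sub>R e k))\<^sup>2 < \<epsilon>\<^sup>2"
        using N[OF that, of n] by (simp add: norm_sum_sq sum_nonneg)
      then show ?thesis using \<open>0 < \<epsilon>\<close> by (meson less_imp_le power_less_imp_less_base)
    qed
    then show "\<exists>N. \<forall>m\<ge>N. \<forall>n. norm (\<Sum>k=m..<n. c k *\<^sub>R e k) < \<epsilon>" by blast
  qed
  have "(\<lambda>k. (c k *\<^sub>R e k) \<bullet> e j) sums ((\<Sum>k. c k *\<^sub>R e k) \<bullet> e j)"
    by (rule bounded_linear.sums[OF bounded_linear_inner_left summable_sums[OF s]])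
  moreover have "(\<lambda>k. (c k *\<^sub>R e k) \<bullet> e j) = (\<lambda>k. if k = j then c k else 0)"
    by (auto simp: inner_e)
  ultimately show "(\<Sum>k. c k *\<^sub>R e k) \<bullet> e j = c j"
    using sums_single[of j c] by (simp add: sums_unique2)
  have "(\<lambda>n. (norm (\<Sum>k<n. c k *\<^sub>R e k))\<^sup>2) \<longlonglongrightarrow> (norm (\<Sum>k. c k *\<^sub>R e k))\<^sup>2"
    by (intro tendsto_power tendsto_norm summable_LIMSEQ s)
  moreover have "(\<lambda>n. \<Sum>k<n. (c k)\<^sup>2) \<longlonglongrightarrow> (\<Sum>k. (c k)\<^sup>2)"
    by (rule summable_LIMSEQ[OF assms])
  ultimately show "(norm (\<Sum>k. c k *\<^sub>R e k))\<^sup>2 = (\<Sum>k. (c k)\<^sup>2)"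
    by (simp add: norm_sum_sq LIMSEQ_unique)
qed

lemma bessel: "(\<Sum>k<n. (v \<bullet> e k)\<^sup>2) \<le> (norm v)\<^sup>2"
proof -
  let ?s = "\<Sum>k<n. (v \<bullet> e k) *\<^sub>R e k"
  have 1: "v \<bullet> ?s = (\<Sum>k<n. (v \<bullet> e k)\<^sup>2)" by (simp add: inner_sum_right power2_eq_square)
  have "0 \<le> (norm (v - ?s))\<^sup>2" by simp
  also have "\<dots> = (norm v)\<^sup>2 - 2 * (v \<bullet> ?s) + (norm ?s)\<^sup>2"
    by (simp only: power2_norm_eq_inner inner_diff_left inner_diff_right inner_commute[of ?s v])
  finally show ?thesis unfolding 1 by (simp add: norm_sum_sq)
qed

lemma summable_fourier: "summable (\<lambda>k. (v \<bullet> e k)\<^sup>2)"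
  by (rule summableI_nonneg_bounded[where x="(norm v)\<^sup>2"]) (auto simp: bessel)

text \<open>The vectors orthogonal to \<open>w\<close> form a closed set that contains a dense span,
  hence \<open>w\<close> itself.\<close>

lemma eq_zero_if_orthogonal:
  assumes "\<And>k. w \<bullet> e k = 0" shows "w = 0"
proof -
  have "w \<bullet> x = 0" if "x \<in> span (range e)" for x
    using that by (induction rule: span_induct_alt) (auto simp: inner_add_right assms)
  then have "closure (span (range e)) \<subseteq> {x. w \<bullet> x = 0}"
    by (intro closure_minimal closed_Collect_eq continuous_intros) auto
  then have "w \<bullet> w = 0" unfolding dense_span by blast
  then show ?thesis by simp
qed

lemma fourier_sums: "(\<lambda>k. (v \<bullet> e k) *\<^sub>R e k) sums v"
proof -
  note s = summable_coefficients[OF summable_fourier[of v]]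
  have "v - (\<Sum>k. (v \<bullet> e k) *\<^sub>R e k) = 0"
    by (rule eq_zero_if_orthogonal) (simp add: inner_diff_left s(2))
  then show ?thesis using summable_sums[OF s(1)] by simp
qed

lemma parseval: "(\<lambda>k. (u \<bullet> e k) * (v \<bullet> e k)) sums (u \<bullet> v)"
  using bounded_linear.sums[OF bounded_linear_inner_right[of u] fourier_sums[of v]]
  by (simp add: mult.commute)

section \<open>The space V, its balls and its continuous paths\<close>

lemma V_iff: "v \<in> V \<longleftrightarrow> summable (\<lambda>k. lam k * (v \<bullet> e k)\<^sup>2)"
  using lam_pos by (simp add: pow_dom_def less_imp_le)

lemma half_pow_sq: "(lam k powr (1/2) * x)\<^sup>2 = lam k * x\<^sup>2"
  using lam_pos[of k] by (simp add: powr_half_sqrt power_mult_distrib)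

lemma Vn_sq: "v \<in> V \<Longrightarrow> (Vn v)\<^sup>2 = (\<Sum>k. lam k * (v \<bullet> e k)\<^sup>2)"
  using summable_coefficients(3)[of "\<lambda>k. lam k powr (1/2) * (v \<bullet> e k)"]
  by (simp add: V_iff half_pow_sq pow_norm_def pow_op_def)

lemma Vn_nonneg [simp]: "0 \<le> Vn v" by (simp add: pow_norm_def)

lemma V_diff: "u \<in> V \<Longrightarrow> v \<in> V \<Longrightarrow> u - v \<in> V"
proof -
  assume "u \<in> V" "v \<in> V"
  then have "summable (\<lambda>k. 2 * (lam k * (u \<bullet> e k)\<^sup>2) + 2 * (lam k * (v \<bullet> e k)\<^sup>2))"
    by (intro summable_add summable_mult) (auto simp: V_iff)
  moreover have "lam k * ((u - v) \<bullet> e k)\<^sup>2 \<le> 2 * (lam k * (u \<bullet> e k)\<^sup>2) + 2 * (lam k * (v \<bullet> e k)\<^sup>2)" for k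
  proof -
    have "((u - v) \<bullet> e k)\<^sup>2 \<le> 2 * (u \<bullet> e k)\<^sup>2 + 2 * (v \<bullet> e k)\<^sup>2"
      using norm_add_sq_le[of "u \<bullet> e k" "- (v \<bullet> e k)"] by (simp add: inner_diff_left)
    from mult_left_mono[OF this, of "lam k"] show ?thesis using lam_pos[of k] by (simp add: algebra_simps)
  qed
  ultimately show ?thesis unfolding V_iff
    by (intro summable_comparison_test'[where N=0, OF \<open>summable _\<close>]) (use lam_pos in \<open>auto simp: less_imp_le\<close>)
qed

lemma e_in_V: "e j \<in> V"
  unfolding V_iff by (rule summable_finite[of "{j}"]) (auto simp: inner_e)

lemma pow_op_diff:
  assumes "u \<in> V" "v \<in> V"
  shows "pow_op e lam (1/2) (u - v) = pow_op e lam (1/2) u - pow_op e lam (1/2) v"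
proof -
  have s: "summable (\<lambda>k. (lam k powr (1/2) * (w \<bullet> e k)) *\<^sub>R e k)" if "w \<in> V" for w
    using that by (intro summable_coefficients) (simp add: V_iff half_pow_sq)
  show ?thesis unfolding pow_op_def
    by (subst suminf_diff[OF s[OF assms(1)] s[OF assms(2)]]) (simp add: inner_diff_left algebra_simps)
qed

text \<open>Poincare inequality; \<open>lam 0\<close> is the smallest eigenvalue.\<close>

lemma norm_le_Vn: "v \<in> V \<Longrightarrow> lam 0 * (norm v)\<^sup>2 \<le> (Vn v)\<^sup>2"
proof -
  assume v: "v \<in> V"
  have "lam 0 * (norm v)\<^sup>2 = (\<Sum>k. lam 0 * (v \<bullet> e k)\<^sup>2)"
    unfolding power2_norm_eq_inner using parseval[of v v] summable_fourier[of v]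
    by (simp add: suminf_mult sums_iff power2_eq_square)
  also have "\<dots> \<le> (\<Sum>k. lam k * (v \<bullet> e k)\<^sup>2)"
    using v summable_fourier[of v] by (intro suminf_le mult_right_mono lam_mono summable_mult) (auto simp: V_iff)
  finally show ?thesis using Vn_sq[OF v] by simp
qed

lemma norm_le_Vn': "v \<in> V \<Longrightarrow> norm v \<le> Vn v / sqrt (lam 0)"
proof -
  assume "v \<in> V"
  then have "sqrt (lam 0 * (norm v)\<^sup>2) \<le> sqrt ((Vn v)\<^sup>2)" by (intro real_sqrt_le_mono norm_le_Vn)
  then show ?thesis using lam_pos[of 0] by (simp add: real_sqrt_mult field_simps)
qed

text \<open>The ball of radius \<open>n\<close> in V, written through partial sums. Each condition
  involves finitely many coordinates and is closed in H, whereas \<open>pow_norm\<close> has no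
  meaning outside V. The ball is thus Borel in H and stable under limits in H.\<close>

definition Vball :: "real \<Rightarrow> 'h \<Rightarrow> bool" where
  "Vball n v \<longleftrightarrow> (\<forall>K. (\<Sum>k<K. lam k * (v \<bullet> e k)\<^sup>2) \<le> n\<^sup>2)"

lemma Vball_iff: "0 \<le> n \<Longrightarrow> Vball n v \<longleftrightarrow> v \<in> V \<and> Vn v \<le> n"
proof
  assume n: "0 \<le> n" and b: "Vball n v"
  have v: "v \<in> V" unfolding V_iff
    by (rule summableI_nonneg_bounded[where x="n\<^sup>2"]) (use b lam_pos in \<open>auto simp: Vball_def less_imp_le\<close>)
  then have "(Vn v)\<^sup>2 \<le> n\<^sup>2"
    using b unfolding Vn_sq[OF v] Vball_def by (intro suminf_le_const) (auto simp: V_iff)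
  then show "v \<in> V \<and> Vn v \<le> n" using v n by (simp add: power2_le_iff_abs_le)
next
  assume n: "0 \<le> n" and v: "v \<in> V \<and> Vn v \<le> n"
  then have "(Vn v)\<^sup>2 \<le> n\<^sup>2" by (intro power_mono) auto
  moreover have "(\<Sum>k<K. lam k * (v \<bullet> e k)\<^sup>2) \<le> (Vn v)\<^sup>2" for K
    using v lam_pos by (simp add: Vn_sq V_iff sum_le_suminf less_imp_le)
  ultimately show "Vball n v" unfolding Vball_def by (meson order_trans)
qed

text \<open>This is the lower semicontinuity of the V-norm with respect to the weaker norm of
  H.\<close>

lemma closed_Vball: "closed {v. Vball n v}"
  unfolding Vball_def by (intro closed_Collect_all closed_Collect_le continuous_intros)

lemma metric_V: "Metric_space V (\<lambda>u v. Vn (u - v))"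
proof
  fix x y z
  show "0 \<le> Vn (x - y)" by simp
  \<comment> \<open>Symmetry is demanded for all points, also outside V. If the defining series
    diverges, it does so for both arguments, and both sums take the same default value.\<close>
  show "Vn (x - y) = Vn (y - x)" 
  proof -
    have eq: "(lam k powr (1/2) * ((x - y) \<bullet> e k)) *\<^sub>R e k = - ((lam k powr (1/2) * ((y - x) \<bullet> e k)) *\<^sub>R e k)" for k
      by (simp add: inner_diff_left algebra_simps)
    show ?thesis
    proof (cases "summable (\<lambda>k. (lam k powr (1/2) * ((y - x) \<bullet> e k)) *\<^sub>R e k)")
      case True
      then show ?thesis unfolding pow_norm_def pow_op_def eq by (simp only: suminf_minus norm_minus_cancel)
    next
      case False
      then have "\<not> summable (\<lambda>k. (lam k powr (1/2) * ((x - y) \<bullet> e k)) *\<^sub>R e k)"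
        unfolding eq by (simp only: summable_minus_iff not_False_eq_True)
      with False show ?thesis unfolding pow_norm_def pow_op_def
        by (simp only: suminf_def summable_def not_ex simp_thms)
    qed
  qed
  assume x: "x \<in> V" and y: "y \<in> V"
  show "Vn (x - y) = 0 \<longleftrightarrow> x = y"
    using norm_le_Vn'[OF V_diff[OF x y]] pow_op_diff[OF x y] by (auto simp: pow_norm_def)
  assume z: "z \<in> V"
  show "Vn (x - z) \<le> Vn (x - y) + Vn (y - z)"
    using norm_triangle_ineq[of "pow_op e lam (1/2) x - pow_op e lam (1/2) y" "pow_op e lam (1/2) y - pow_op e lam (1/2) z"]
    by (simp add: pow_norm_def pow_op_diff x y z)
qed

text \<open>Continuity for the abstract topology of \<open>Vn\<close> is first rewritten with
  epsilon and delta. The V-norm of a difference is the norm of a difference of images under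
  \<open>pow_op\<close>, and the Poincare inequality passes from there to the norm of H.\<close>

lemma continuous_V_path:
  fixes x :: "real \<Rightarrow> 'h"
  assumes "continuous_map (top_of_set {0..}) (norm_topology V Vn) x"
  shows "continuous_on {0..} x" "continuous_on {0..} (\<lambda>t. pow_op e lam (1/2) (x t))"
    "\<And>t. 0 \<le> t \<Longrightarrow> x t \<in> V"
proof -
  interpret m: Metric_space V "\<lambda>u v. Vn (u - v)" by (rule metric_V)
  have c: "continuous_map (top_of_set {0..}) m.mtopology x" using assms by (simp add: norm_topology_def)
  show xV: "x t \<in> V" if "0 \<le> t" for t
    using c that unfolding continuous_map_def by (auto simp: Pi_iff)
  have dl: "\<exists>\<delta>>0. \<forall>s\<ge>0. dist s t < \<delta> \<longrightarrow> Vn (x s - x t) < \<epsilon>" if "0 \<le> t" "0 < \<epsilon>" for t \<epsilon>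
  proof -
    have "t \<in> {0..}" using that by simp
    then have "\<exists>U. openin (top_of_set {0..}) U \<and> t \<in> U \<and> (\<forall>y\<in>U. x y \<in> m.mball (x t) \<epsilon>)"
      using c[unfolded m.continuous_map_to_metric topspace_euclidean_subtopology] that(2) by blast
    then obtain U where U: "openin (top_of_set {0..}) U" "t \<in> U" "\<And>s. s \<in> U \<Longrightarrow> x s \<in> m.mball (x t) \<epsilon>"
      by blast
    then obtain \<delta> where "\<delta> > 0" "\<And>s. s \<in> {0..} \<Longrightarrow> dist s t < \<delta> \<Longrightarrow> s \<in> U"
      using U(1) unfolding openin_euclidean_subtopology_iff by blast
    then show ?thesis using U(3) m.commute by (intro exI[of _ \<delta>]) (auto simp: m.in_mball)
  qed
  show "continuous_on {0..} (\<lambda>t. pow_op e lam (1/2) (x t))"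
    unfolding continuous_on_iff
  proof (intro ballI allI impI)
    fix t \<epsilon> :: real assume "t \<in> {0..}" "0 < \<epsilon>"
    then obtain \<delta> where "\<delta> > 0" "\<And>s. s \<ge> 0 \<Longrightarrow> dist s t < \<delta> \<Longrightarrow> Vn (x s - x t) < \<epsilon>"
      using dl[of t \<epsilon>] by auto
    then show "\<exists>d>0. \<forall>s\<in>{0..}. dist s t < d \<longrightarrow>
        dist (pow_op e lam (1/2) (x s)) (pow_op e lam (1/2) (x t)) < \<epsilon>"
      using xV \<open>t \<in> {0..}\<close> by (intro exI[of _ \<delta>]) (simp add: dist_norm[of "_ :: 'h"] pow_norm_def pow_op_diff)
  qed
  show "continuous_on {0..} x"
    unfolding continuous_on_iff
  proof (intro ballI allI impI)
    fix t \<epsilon> :: real assume "t \<in> {0..}" "0 < \<epsilon>"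
    then obtain \<delta> where d: "\<delta> > 0" "\<And>s. s \<ge> 0 \<Longrightarrow> dist s t < \<delta> \<Longrightarrow> Vn (x s - x t) < \<epsilon> * sqrt (lam 0)"
      using dl[of t "\<epsilon> * sqrt (lam 0)"] lam_pos[of 0] by auto
    have "dist (x s) (x t) < \<epsilon>" if "s \<ge> 0" "dist s t < \<delta>" for s
    proof -
      have "norm (x s - x t) \<le> Vn (x s - x t) / sqrt (lam 0)"
        using that \<open>t \<in> {0..}\<close> by (intro norm_le_Vn' V_diff xV) auto
      also have "\<dots> < \<epsilon>" using d(2)[OF that] lam_pos[of 0] by (simp add: pos_divide_less_eq)
      finally show ?thesis by (simp add: dist_norm)
    qed
    then show "\<exists>d>0. \<forall>x'\<in>{0..}. dist x' t < d \<longrightarrow> dist (x x') (x t) < \<epsilon>" using d(1) by auto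
  qed
qed

text \<open>By compactness of the time interval every continuous path in V stays in some ball, so
  the localisation levels exhaust all paths.\<close>

lemma V_path_bounded:
  fixes x :: "real \<Rightarrow> 'h"
  assumes "continuous_map (top_of_set {0..}) (norm_topology V Vn) x"
  shows "\<exists>n::nat. \<forall>t\<in>{0..T}. Vball (real n) (x t)"
proof -
  have "compact ((\<lambda>t. pow_op e lam (1/2) (x t)) ` {0..T})"
    by (intro compact_continuous_image continuous_on_subset[OF continuous_V_path(2)[OF assms]] compact_Icc) auto
  then obtain K where "\<And>t. t \<in> {0..T} \<Longrightarrow> Vn (x t) \<le> K"
    using compact_imp_bounded[of "(\<lambda>t. pow_op e lam (1/2) (x t)) ` {0..T}"]
    unfolding pow_norm_def bounded_iff by blast
  moreover obtain n :: nat where "K \<le> real n" using real_arch_simple by blast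
  ultimately have "\<forall>t\<in>{0..T}. Vball (real n) (x t)"
    using continuous_V_path(3)[OF assms] by (force simp: Vball_iff)
  then show ?thesis ..
qed

section \<open>The operator on its domain\<close>

lemma A_inner_e: "v \<in> D \<Longrightarrow> A v \<bullet> e k = lam k * (v \<bullet> e k)"
proof -
  assume "v \<in> D"
  moreover have "\<forall>u\<in>D. A u \<bullet> e k = u \<bullet> (lam k *\<^sub>R e k)"
    using admissible e_in_D[of k] A_e[of k] unfolding admissible_operator_def self_adjoint_on_def by blast
  ultimately show ?thesis by simp
qed

lemma D_subset_V: "v \<in> D \<Longrightarrow> v \<in> V" and Vn_sq_D: "v \<in> D \<Longrightarrow> (Vn v)\<^sup>2 = A v \<bullet> v"
proof -
  assume v: "v \<in> D"
  have s: "(\<lambda>k. lam k * (v \<bullet> e k)\<^sup>2) sums (A v \<bullet> v)"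
    using parseval[of "A v" v] by (simp add: A_inner_e[OF v] power2_eq_square mult.assoc)
  then show *: "v \<in> V" by (simp add: V_iff sums_iff)
  show "(Vn v)\<^sup>2 = A v \<bullet> v" using s by (simp add: Vn_sq[OF *] sums_iff)
qed

lemma D_diff: "u \<in> D \<Longrightarrow> v \<in> D \<Longrightarrow> u - v \<in> D" and A_diff: "u \<in> D \<Longrightarrow> v \<in> D \<Longrightarrow> A (u - v) = A u - A v"
proof -
  assume uv: "u \<in> D" "v \<in> D"
  have lin: "linear_operator_on D A" using admissible by (simp add: admissible_operator_def)
  then have n: "(-1) *\<^sub>R v \<in> D" "A ((-1) *\<^sub>R v) = (-1) *\<^sub>R A v"
    using uv by (auto simp only: linear_operator_on_def intro: subspace_scale)
  show "u - v \<in> D" using lin uv by (auto simp: linear_operator_on_def intro: subspace_diff)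
  have "A (u + (-1) *\<^sub>R v) = A u + A ((-1) *\<^sub>R v)"
    using lin uv(1) n(1) unfolding linear_operator_on_def by blast
  then show "A (u - v) = A u - A v" using n by simp
qed

text \<open>A Borel function on all of H that agrees with \<open>|A v|^2\<close> on the domain. The
  operator \<open>A\<close> is an arbitrary function outside \<open>D\<close>, and the solutions are
  known to lie in \<open>D\<close> at almost every time only, so \<open>|A v|^2\<close> itself is
  not a suitable integrand for Fubini's theorem.\<close>

definition Asq :: "'h \<Rightarrow> ennreal" where
  "Asq v = (\<Sum>k. ennreal ((lam k * (v \<bullet> e k))\<^sup>2))"

lemma Asq_D: "v \<in> D \<Longrightarrow> Asq v = ennreal ((norm (A v))\<^sup>2)"
proof -
  assume v: "v \<in> D"
  have "(\<lambda>k. (lam k * (v \<bullet> e k))\<^sup>2) sums ((norm (A v))\<^sup>2)"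
    unfolding power2_norm_eq_inner using parseval[of "A v" "A v"] by (simp add: A_inner_e[OF v] power2_eq_square)
  then show ?thesis unfolding Asq_def by (intro suminf_ennreal_eq) auto
qed

lemma Asq_measurable [measurable]: "Asq \<in> borel_measurable borel"
  unfolding Asq_def by measurable

section \<open>Estimates for the nonlinear terms and the drift\<close>

lemma dual_rep_inner:
  assumes "f = dual_embed e lam h" shows "dual_rep e lam f = h"
  unfolding dual_rep_def
proof (rule the_equality)
  show "dual_embed e lam h = f" using assms by simp
  fix h' assume "dual_embed e lam h' = f"
  then have "dual_embed e lam h' (e k) = dual_embed e lam h (e k)" for k using assms by simp
  then have "(h' - h) \<bullet> e k = 0" for k by (simp add: dual_embed_def e_in_V inner_diff_left)
  then show "h' = h" using eq_zero_if_orthogonal[of "h' - h"] by simp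
qed

text \<open>By (B2) the form vanishes when its last two arguments agree, so the difference equals
  \<open>B w u w\<close> with \<open>w = u - v\<close>, and it suffices that \<open>u\<close> lies
  in the ball. With \<open>x = |w|\<close> and \<open>y\<close> the V-norm of \<open>w\<close>, (B3)
  gives a multiple of \<open>y^(3/2) x^(1/2)\<close>, which two Young inequalities split into
  \<open>y^2 / 2 + y^2 / 4\<close> and a multiple of \<open>x^2\<close>.\<close>

lemma B_form_bound:
  assumes B: "cond_B d D A e lam B"
  shows "\<exists>C>0. \<forall>u\<in>V. \<forall>v\<in>V. Vn u \<le> n \<longrightarrow>
    2 * \<bar>B u u (u - v) - B v v (u - v)\<bar> \<le> (Vn (u - v))\<^sup>2 * (3/4) + C * (norm (u - v))\<^sup>2"
proof -
  obtain C where C: "0 < C" "\<And>u v w. u \<in> V \<Longrightarrow> v \<in> V \<Longrightarrow> w \<in> V \<Longrightarrow>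
      \<bar>B u v w\<bar> \<le> C * Vn u * Vn v * sqrt (norm w) * sqrt (Vn w)"
    using B by (auto simp: cond_B_def cond_B3_def)
  define c where "c = 2 * C * \<bar>n\<bar>"
  \<comment> \<open>The summand 1 keeps the constant positive when the radius, and with it
    \<open>c\<close>, is zero.\<close>
  have "2 * \<bar>B u u (u - v) - B v v (u - v)\<bar> \<le> (Vn (u - v))\<^sup>2 * (3/4) + (c^4 + 1) * (norm (u - v))\<^sup>2"
    if uv: "u \<in> V" "v \<in> V" "Vn u \<le> n" for u v
  proof -
    let ?w = "u - v"
    have w: "?w \<in> V" using uv by (intro V_diff)
    have add: "B (a + a') b z = B a b z + B a' b z" "B b (a + a') z = B b a z + B b a' z"
      if "a \<in> V" "a' \<in> V" "b \<in> V" "z \<in> V" for a a' b z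
      using B that unfolding cond_B_def cond_B1_def by blast+
    have "B v ?w ?w = - B v ?w ?w" using B uv w unfolding cond_B_def cond_B2_def by blast
    moreover have "B u u ?w = B ?w u ?w + B v u ?w" using add(1)[of ?w v u ?w] uv w by simp
    moreover have "B v u ?w = B v ?w ?w + B v v ?w" using add(2)[of ?w v v ?w] uv w by simp
    ultimately have eq: "B u u ?w - B v v ?w = B ?w u ?w" by simp
    define x y where "x = norm ?w" and "y = Vn ?w"
    have xy: "0 \<le> x" "0 \<le> y" by (auto simp: x_def y_def)
    have "2 * \<bar>B ?w u ?w\<bar> \<le> 2 * (C * y * Vn u * sqrt x * sqrt y)"
      using C(2)[OF w uv(1) w] by (simp add: x_def y_def)
    also have "\<dots> = (C * y * sqrt x * sqrt y) * (2 * Vn u)" by simp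
    also have "\<dots> \<le> (C * y * sqrt x * sqrt y) * (2 * \<bar>n\<bar>)"
      using uv(3) C(1) xy by (intro mult_left_mono) auto
    also have "\<dots> = y * (c * sqrt (x * y))" by (simp add: c_def real_sqrt_mult)
    also have "\<dots> \<le> (y\<^sup>2 + c\<^sup>2 * (x * y)) / 2"
      using sum_squares_bound[of y "c * sqrt (x * y)"] xy by (simp add: power_mult_distrib)
    also have "c\<^sup>2 * (x * y) \<le> (y\<^sup>2 + (c\<^sup>2 * x)\<^sup>2) / 2"
      using sum_squares_bound[of y "c\<^sup>2 * x"] by (simp add: mult_ac)
    also have "(c\<^sup>2 * x)\<^sup>2 = c^4 * x\<^sup>2" by (simp add: power_mult_distrib flip: power_mult)
    finally have "2 * \<bar>B ?w u ?w\<bar> \<le> y\<^sup>2 * (3/4) + c^4 * x\<^sup>2 / 4" by (simp add: field_simps)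
    also have "\<dots> \<le> y\<^sup>2 * (3/4) + (c^4 + 1) * x\<^sup>2"
    proof -
      have "0 \<le> c^4 * x\<^sup>2" "0 \<le> x\<^sup>2" by (auto intro: mult_nonneg_nonneg)
      then show ?thesis by (simp add: algebra_simps)
    qed
    finally show ?thesis by (simp add: eq x_def y_def)
  qed
  moreover have "0 < c^4 + 1" by (intro add_nonneg_pos) auto
  ultimately show ?thesis by blast
qed

lemma R_lipschitz_bound:
  assumes R: "cond_R D A e lam R"
  shows "\<exists>C>0. \<forall>u\<in>V. \<forall>v\<in>V. Vn u \<le> n \<longrightarrow> Vn v \<le> n \<longrightarrow> norm (R u - R v) \<le> C * Vn (u - v)"
proof -
  obtain C r where C: "0 < C" "1 \<le> r" "\<And>u v. u \<in> V \<Longrightarrow> v \<in> V \<Longrightarrow>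
      norm (R u - R v) \<le> C * (1 + Vn u powr (r - 1) + Vn v powr (r - 1)) * Vn (u - v)"
    using R by (auto simp: cond_R_def cond_R3_def)
  have "norm (R u - R v) \<le> C * (1 + \<bar>n\<bar> powr (r - 1) + \<bar>n\<bar> powr (r - 1)) * Vn (u - v)"
    if "u \<in> V" "v \<in> V" "Vn u \<le> n" "Vn v \<le> n" for u v
    using C that
    by (intro order_trans[OF C(3)[OF that(1,2)]] mult_right_mono mult_left_mono add_mono powr_mono2) auto
  moreover have "0 < C * (1 + \<bar>n\<bar> powr (r - 1) + \<bar>n\<bar> powr (r - 1))"
    using C(1) by (intro mult_pos_pos add_pos_nonneg) auto
  ultimately show ?thesis by blast
qed

lemma R_norm_bound:
  assumes R: "cond_R D A e lam R"
  shows "\<exists>C>0. \<forall>u\<in>V. Vn u \<le> n \<longrightarrow> norm (R u) \<le> C"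
proof -
  obtain C r where C: "0 < C" "1 \<le> r" "\<And>u. u \<in> V \<Longrightarrow> norm (R u) \<le> C * (1 + Vn u powr (r - 1)) * Vn u"
    using R by (auto simp: cond_R_def cond_R2_def)
  have pos: "0 < 1 + \<bar>n\<bar> powr (r - 1)" by (intro add_pos_nonneg) auto
  have "norm (R u) \<le> C * (1 + \<bar>n\<bar> powr (r - 1)) * (\<bar>n\<bar> + 1)" if "u \<in> V" "Vn u \<le> n" for u
    using C that
    by (intro order_trans[OF C(3)[OF that(1)]] mult_mono mult_left_mono add_mono powr_mono2) auto
  moreover have "0 < C * (1 + \<bar>n\<bar> powr (r - 1)) * (\<bar>n\<bar> + 1)"
    using C(1) pos by (intro mult_pos_pos) auto
  ultimately show ?thesis by blast
qed

lemma dual_rep_B: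
  assumes B: "cond_B d D A e lam B" and v: "v \<in> D" and w: "w \<in> V"
  shows "dual_rep e lam (B v v) \<bullet> w = B v v w"
proof -
  obtain h where "B v v = dual_embed e lam h"
    using B v D_subset_V[OF v] unfolding cond_B_def cond_B4_def by blast
  then show ?thesis using w dual_rep_inner[of "B v v" h] by (simp add: dual_embed_def)
qed

text \<open>The linear part contributes \<open>-2\<close> times the squared V-norm of the
  difference. Of this the form consumes 3/4 and the Lipschitz bound for R, after Young's inequality,
  consumes 1; the rest is discarded.\<close>

lemma drift_monotone:
  assumes B: "cond_B d D A e lam B" and R: "cond_R D A e lam R"
  shows "\<exists>C>0. \<forall>u\<in>D. \<forall>v\<in>D. Vn u \<le> n \<longrightarrow> Vn v \<le> n \<longrightarrow>
    - 2 * ((u - v) \<bullet> (drift A e lam B R u - drift A e lam B R v)) \<le> C * (norm (u - v))\<^sup>2"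
proof -
  obtain C1 where C1: "0 < C1" "\<And>u v. u \<in> V \<Longrightarrow> v \<in> V \<Longrightarrow> Vn u \<le> n \<Longrightarrow>
    2 * \<bar>B u u (u - v) - B v v (u - v)\<bar> \<le> (Vn (u - v))\<^sup>2 * (3/4) + C1 * (norm (u - v))\<^sup>2"
    using B_form_bound[OF B] by blast
  obtain C2 where C2: "0 < C2" "\<And>u v. u \<in> V \<Longrightarrow> v \<in> V \<Longrightarrow> Vn u \<le> n \<Longrightarrow> Vn v \<le> n \<Longrightarrow>
    norm (R u - R v) \<le> C2 * Vn (u - v)"
    using R_lipschitz_bound[OF R] by blast
  have "- 2 * ((u - v) \<bullet> (drift A e lam B R u - drift A e lam B R v)) \<le> (C1 + C2\<^sup>2) * (norm (u - v))\<^sup>2"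
    if D: "u \<in> D" "v \<in> D" and n: "Vn u \<le> n" "Vn v \<le> n" for u v
  proof -
    let ?w = "u - v"
    have w: "?w \<in> V" "?w \<in> D" using D by (auto intro: D_diff D_subset_V)
    have "?w \<bullet> (drift A e lam B R u - drift A e lam B R v) =
      (A u - A v) \<bullet> ?w + (dual_rep e lam (B u u) \<bullet> ?w - dual_rep e lam (B v v) \<bullet> ?w) + (R u - R v) \<bullet> ?w"
      by (subst inner_commute) (simp add: drift_def inner_diff_left inner_add_left)
    also have "\<dots> = (Vn ?w)\<^sup>2 + (B u u ?w - B v v ?w) + (R u - R v) \<bullet> ?w"
      using A_diff[OF D] Vn_sq_D[OF w(2)] by (simp add: dual_rep_B[OF B] D w)
    finally have eq: "?w \<bullet> (drift A e lam B R u - drift A e lam B R v) =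
      (Vn ?w)\<^sup>2 + (B u u ?w - B v v ?w) + (R u - R v) \<bullet> ?w" .
    have "2 * \<bar>(R u - R v) \<bullet> ?w\<bar> \<le> 2 * (norm (R u - R v) * norm ?w)"
      using Cauchy_Schwarz_ineq2[of "R u - R v" ?w] by simp
    also have "\<dots> \<le> 2 * (C2 * Vn ?w * norm ?w)"
      using C2(2)[OF D_subset_V[OF D(1)] D_subset_V[OF D(2)] n] by (intro mult_left_mono mult_right_mono) auto
    also have "\<dots> \<le> (Vn ?w)\<^sup>2 + C2\<^sup>2 * (norm ?w)\<^sup>2"
      using sum_squares_bound[of "Vn ?w" "C2 * norm ?w"] by (simp add: power_mult_distrib mult_ac)
    finally have 2: "2 * \<bar>(R u - R v) \<bullet> ?w\<bar> \<le> (Vn ?w)\<^sup>2 + C2\<^sup>2 * (norm ?w)\<^sup>2" .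
    note 1 = C1(2)[OF D_subset_V[OF D(1)] D_subset_V[OF D(2)] n(1)]
    have "0 \<le> (Vn ?w)\<^sup>2" by simp
    moreover have "- 2 * (y + b + r) \<le> p + q"
      if "2 * \<bar>b\<bar> \<le> y * (3/4) + p" "2 * \<bar>r\<bar> \<le> y + q" "0 \<le> y" for y b r p q :: real
      using that by (auto simp: abs_if split: if_splits)
    ultimately show ?thesis unfolding eq distrib_right using 1 2 by blast
  qed
  moreover have "0 < C1 + C2\<^sup>2" using C1(1) by (simp add: add_pos_nonneg)
  ultimately show ?thesis by blast
qed

text \<open>On a ball of V, (B4) bounds the form by a multiple of \<open>|A u|^(1/2)\<close>, and R
  is bounded. The growth is thus linear in \<open>|A u|\<close>, which makes the drift square
  integrable in time along the solutions.\<close>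

lemma drift_growth:
  assumes B: "cond_B d D A e lam B" and d: "d \<le> 3" and R: "cond_R D A e lam R"
  shows "\<exists>C>0. \<forall>u\<in>D. Vn u \<le> n \<longrightarrow> (norm (drift A e lam B R u))\<^sup>2 \<le> C * (1 + (norm (A u))\<^sup>2)"
proof -
  obtain C1 where C1: "0 < C1" "\<And>u v. u \<in> V \<Longrightarrow> v \<in> D \<Longrightarrow> \<exists>h. B u v = dual_embed e lam h \<and>
     norm h \<le> C1 * Vn u * sqrt (Vn v) * sqrt (norm (A v))"
    using B d unfolding cond_B_def cond_B4_def by blast
  obtain C2 where C2: "0 < C2" "\<And>u. u \<in> V \<Longrightarrow> Vn u \<le> n \<Longrightarrow> norm (R u) \<le> C2"
    using R_norm_bound[OF R] by blast
  \<comment> \<open>The summands are the coefficients of \<open>1 + |A u|\<close> in the bounds for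
    the linear part, the form and R.\<close>
  define c where "c = 1 + C1 * \<bar>n\<bar> * sqrt \<bar>n\<bar> + C2"
  have "(norm (drift A e lam B R u))\<^sup>2 \<le> (2 * c\<^sup>2) * (1 + (norm (A u))\<^sup>2)" if u: "u \<in> D" "Vn u \<le> n" for u
  proof -
    have V: "u \<in> V" using u by (auto intro: D_subset_V)
    obtain h where h: "B u u = dual_embed e lam h" "norm h \<le> C1 * Vn u * sqrt (Vn u) * sqrt (norm (A u))"
      using C1(2)[OF V u(1)] by blast
    have s: "sqrt a \<le> 1 + a" if "0 \<le> a" for a :: real
      using that by (intro real_le_lsqrt) (auto simp: power2_eq_square algebra_simps)
    have "C1 * Vn u * sqrt (Vn u) * sqrt (norm (A u)) \<le> C1 * \<bar>n\<bar> * sqrt \<bar>n\<bar> * (1 + norm (A u))"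
      using C1(1) u(2) s[of "norm (A u)"] by (intro mult_mono real_sqrt_le_mono) auto
    moreover have "norm (R u) \<le> C2 * (1 + norm (A u))"
      using C2(2)[OF V u(2)] C2(1) by (simp add: algebra_simps add_increasing2)
    moreover have "norm (A u) \<le> 1 + norm (A u)" by simp
    moreover have "norm (drift A e lam B R u) \<le> norm (A u) + norm h + norm (R u)"
      unfolding drift_def dual_rep_inner[OF h(1)] by (meson add_right_mono norm_triangle_ineq order_trans)
    ultimately have "norm (drift A e lam B R u) \<le> c * (1 + norm (A u))"
      using h(2) unfolding c_def by (simp only: distrib_right[of _ _ "1 + norm (A u)"] mult_1)
    then have "(norm (drift A e lam B R u))\<^sup>2 \<le> (c * (1 + norm (A u)))\<^sup>2" by (intro power_mono) auto
    also have "\<dots> \<le> c\<^sup>2 * (2 * (1 + (norm (A u))\<^sup>2))"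
      unfolding power_mult_distrib using norm_add_sq_le[of 1 "norm (A u)"] by (intro mult_left_mono) auto
    finally show ?thesis by (simp add: algebra_simps)
  qed
  moreover have "0 < c"
    unfolding c_def using C1(1) C2(1) by (intro add_pos_pos add_pos_nonneg mult_nonneg_nonneg) auto
  then have "0 < 2 * c\<^sup>2" by simp
  ultimately show ?thesis by blast
qed

end

section \<open>A discrete Gronwall argument\<close>

lemma nn_integral_Ioc_split:
  fixes f :: "real \<Rightarrow> ennreal"
  assumes [measurable]: "f \<in> borel_measurable borel" and "a \<le> b" "b \<le> c"
  shows "(\<integral>\<^sup>+r\<in>{a<..c}. f r \<partial>lborel) = (\<integral>\<^sup>+r\<in>{a<..b}. f r \<partial>lborel) + (\<integral>\<^sup>+r\<in>{b<..c}. f r \<partial>lborel)"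
proof -
  have "(\<integral>\<^sup>+r\<in>{a<..c}. f r \<partial>lborel) = (\<integral>\<^sup>+r. f r * indicator {a<..b} r + f r * indicator {b<..c} r \<partial>lborel)"
    using assms(2,3) by (intro nn_integral_cong) (auto simp: indicator_def)
  then show ?thesis by (simp add: nn_integral_add)
qed

lemma nn_integral_power_Ioc:
  assumes "0 \<le> (t::real)"
  shows "(\<integral>\<^sup>+r\<in>{0<..t}. ennreal (r ^ k) \<partial>lborel) = ennreal (t ^ Suc k / real (Suc k))"
proof -
  have "(\<integral>\<^sup>+r\<in>{0<..t}. ennreal (r ^ k) \<partial>lborel) = (\<integral>\<^sup>+r. ennreal (r ^ k) * indicator {0..t} r \<partial>lborel)"
    by (intro nn_integral_cong_AE) (use AE_lborel_singleton[of 0] in \<open>eventually_elim, auto simp: indicator_def\<close>)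
  also have "\<dots> = ennreal (t ^ Suc k / real (Suc k) - 0 ^ Suc k / real (Suc k))"
    by (rule nn_integral_FTC_Icc) (use assms in \<open>auto intro!: derivative_eq_intros simp: simp flip: power_Suc of_nat_Suc\<close>)
  finally show ?thesis by simp
qed

text \<open>Picard iteration: inserting the bound \<open>P\<close> repeatedly into the hypothesis
  gives \<open>P (C t)^k / k!\<close>, which tends to zero because \<open>P\<close> is
  finite.\<close>

lemma gronwall_zero:
  fixes f :: "real \<Rightarrow> ennreal" and C T :: real
  assumes [measurable]: "f \<in> borel_measurable borel"
    and C: "0 \<le> C" and P: "P < \<top>" "\<And>t. 0 \<le> t \<Longrightarrow> t \<le> T \<Longrightarrow> f t \<le> P"
    and le: "\<And>t. 0 < t \<Longrightarrow> t \<le> T \<Longrightarrow> f t \<le> ennreal C * (\<integral>\<^sup>+r\<in>{0<..t}. f r \<partial>lborel)"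
    and t: "0 < t" "t \<le> T"
  shows "f t = 0"
proof -
  have b: "f t \<le> P * ennreal ((C * t) ^ k / fact k)" if "0 < t" "t \<le> T" for t k
    using that
  proof (induction k arbitrary: t)
    case 0 then show ?case using P(2)[of t] by simp
  next
    case (Suc k)
    have "(\<integral>\<^sup>+r\<in>{0<..t}. f r \<partial>lborel) \<le> (\<integral>\<^sup>+r\<in>{0<..t}. (P * ennreal (C ^ k / fact k)) * ennreal (r ^ k) \<partial>lborel)"
    proof (intro nn_integral_mono)
      fix r
      show "f r * indicator {0<..t} r \<le> P * ennreal (C ^ k / fact k) * ennreal (r ^ k) * indicator {0<..t} r"
        using Suc.IH[of r] Suc.prems C
        by (auto simp: indicator_def mult.assoc power_mult_distrib simp flip: ennreal_mult'')
    qed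
    also have "\<dots> = (P * ennreal (C ^ k / fact k)) * ennreal (t ^ Suc k / real (Suc k))"
      using nn_integral_power_Ioc[of t k] Suc.prems
      by (simp add: nn_integral_cmult mult.assoc del: power_Suc of_nat_Suc)
    finally have "f t \<le> ennreal C * ((P * ennreal (C ^ k / fact k)) * ennreal (t ^ Suc k / real (Suc k)))"
      using le[OF Suc.prems] by (meson mult_left_mono order_trans zero_le)
    also have "\<dots> = P * ennreal (C * ((C ^ k / fact k) * (t ^ Suc k / real (Suc k))))"
    proof -
      have Y: "0 \<le> t ^ Suc k / real (Suc k)" "0 \<le> C ^ k / fact k * (t ^ Suc k / real (Suc k))"
        using C Suc.prems by (auto intro!: mult_nonneg_nonneg simp del: power_Suc of_nat_Suc)
      show ?thesis unfolding ennreal_mult''[OF Y(2)] ennreal_mult''[OF Y(1)] by (simp only: mult_ac)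
    qed
    also have "C * ((C ^ k / fact k) * (t ^ Suc k / real (Suc k))) = (C * t) ^ Suc k / fact (Suc k)"
      by (simp add: power_mult_distrib mult_ac)
    finally show ?case .
  qed
  have "(\<lambda>k. (C * t) ^ k / fact k) \<longlonglongrightarrow> 0"
    using summable_LIMSEQ_zero[OF summable_exp[of "C * t"]] by (simp add: field_simps)
  then have "(\<lambda>k. ennreal ((C * t) ^ k / fact k)) \<longlonglongrightarrow> ennreal 0"
    by (rule tendsto_ennrealI)
  then have "(\<lambda>k. P * ennreal ((C * t) ^ k / fact k)) \<longlonglongrightarrow> P * ennreal 0"
    by (rule ennreal_tendsto_cmult[OF P(1)])
  then have "f t \<le> P * ennreal 0"
    by (rule LIMSEQ_le_const) (use b[OF t] in blast)
  then show ?thesis by simp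
qed

text \<open>On a grid of mesh \<open>h = t / m\<close> the step inequalities add up: the terms
  \<open>c h p\<close> telescope and leave at most \<open>c h P\<close>, and the error density
  contributes \<open>sqrt h\<close> times its finite integral. As \<open>m\<close> grows, the
  integral inequality of Gronwall's lemma remains. In the application \<open>p t\<close> is the mean
  of \<open>S\<close> over the localisation event at time \<open>t\<close>.\<close>

lemma grid_gronwall_zero:
  fixes f p q :: "real \<Rightarrow> ennreal" and c C T :: real
  assumes [measurable]: "f \<in> borel_measurable borel" "q \<in> borel_measurable borel"
    and c: "0 \<le> c" and C: "0 \<le> C" and f0: "f 0 = 0"
    and fP: "\<And>t. 0 \<le> t \<Longrightarrow> t \<le> T \<Longrightarrow> f t \<le> P" and p0: "p 0 \<le> P" and P: "P < \<top>"
    and Q: "(\<integral>\<^sup>+r\<in>{0<..T}. q r \<partial>lborel) < \<top>"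
    and step: "\<And>s t. 0 \<le> s \<Longrightarrow> s < t \<Longrightarrow> t \<le> T \<Longrightarrow> t - s \<le> 1 \<Longrightarrow>
      f t + ennreal (c * (t - s)) * p t \<le> f s + ennreal (c * (t - s)) * p s +
        (\<integral>\<^sup>+r\<in>{s<..t}. (ennreal C * f r + ennreal (sqrt (t - s)) * q r) \<partial>lborel)"
    and t: "0 < t" "t \<le> T"
  shows "f t = 0"
proof (rule gronwall_zero[OF _ C P fP _ t])
  fix t assume t: "0 < t" "t \<le> T"
  let ?Q = "\<integral>\<^sup>+r\<in>{0<..t}. q r \<partial>lborel" and ?F = "\<integral>\<^sup>+r\<in>{0<..t}. f r \<partial>lborel"
  have Qt: "?Q < \<top>"
    by (rule le_less_trans[OF nn_integral_mono Q]) (use t in \<open>auto simp: indicator_def\<close>)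
  \<comment> \<open>The condition on \<open>m\<close> makes the mesh at most 1, as the step
    inequality demands.\<close>
  have bound: "f t \<le> ennreal C * ?F + (ennreal (c * (t / real m)) * P + ennreal (sqrt (t / real m)) * ?Q)"
    if m: "t \<le> real m" for m :: nat
  proof -
    define h where "h = t / real m"
    have m0: "0 < real m" using m t by linarith
    have h: "0 < h" "h \<le> 1" using m m0 t by (auto simp: h_def)
    let ?g = "\<lambda>r. ennreal C * f r + ennreal (sqrt h) * q r"
    \<comment> \<open>The term with \<open>p\<close> is kept on the left, because the next step
      consumes it on its right-hand side.\<close>
    have ind: "f (real i * h) + ennreal (c * h) * p (real i * h) \<le> ennreal (c * h) * P + (\<integral>\<^sup>+r\<in>{0<..real i * h}. ?g r \<partial>lborel)"
      if "i \<le> m" for i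
      using that
    proof (induction i)
      case 0
      then show ?case using p0 by (simp add: f0 mult_left_mono add_increasing2)
    next
      case (Suc i)
      have ih: "real (Suc i) * h = real i * h + h" by (simp add: algebra_simps)
      have "real (Suc i) * h \<le> real m * h" using Suc.prems h by (intro mult_right_mono) auto
      then have "real (Suc i) * h \<le> t" using m0 by (simp add: h_def)
      then have "f (real (Suc i) * h) + ennreal (c * h) * p (real (Suc i) * h) \<le>
        f (real i * h) + ennreal (c * h) * p (real i * h) + (\<integral>\<^sup>+r\<in>{real i * h<..real (Suc i) * h}. ?g r \<partial>lborel)"
        using step[of "real i * h" "real (Suc i) * h"] h t unfolding ih by simp
      also have "\<dots> \<le> (ennreal (c * h) * P + (\<integral>\<^sup>+r\<in>{0<..real i * h}. ?g r \<partial>lborel)) + (\<integral>\<^sup>+r\<in>{real i * h<..real (Suc i) * h}. ?g r \<partial>lborel)"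
        using Suc by (intro add_right_mono) auto
      also have "\<dots> = ennreal (c * h) * P + (\<integral>\<^sup>+r\<in>{0<..real (Suc i) * h}. ?g r \<partial>lborel)"
        using nn_integral_Ioc_split[of ?g 0 "real i * h" "real (Suc i) * h"] h
        by (simp add: ih add.assoc)
      finally show ?case .
    qed
    have mh: "real m * h = t" using m0 by (simp add: h_def)
    have "f t \<le> f t + ennreal (c * h) * p t" by simp
    also have "\<dots> \<le> ennreal (c * h) * P + (\<integral>\<^sup>+r\<in>{0<..t}. ?g r \<partial>lborel)"
      using ind[of m] unfolding mh by simp
    also have "(\<integral>\<^sup>+r\<in>{0<..t}. ?g r \<partial>lborel) =
        (\<integral>\<^sup>+r. ennreal C * (f r * indicator {0<..t} r) + ennreal (sqrt h) * (q r * indicator {0<..t} r) \<partial>lborel)"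
      by (intro nn_integral_cong) (auto simp: indicator_def)
    also have "\<dots> = ennreal C * ?F + ennreal (sqrt h) * ?Q"
      by (simp add: nn_integral_add nn_integral_cmult)
    finally show ?thesis by (simp add: h_def add_ac)
  qed
  have "(\<lambda>m. ennreal C * ?F + (ennreal (c * (t / real m)) * P + ennreal (sqrt (t / real m)) * ?Q)) \<longlonglongrightarrow>
     ennreal C * ?F + (0 * P + 0 * ?Q)"
  proof (intro tendsto_add tendsto_const tendsto_mult_ennreal)
    have 1: "(\<lambda>m. t / real m) \<longlonglongrightarrow> 0" by (rule lim_const_over_n)
    have "(\<lambda>m. c * (t / real m)) \<longlonglongrightarrow> 0" by (rule tendsto_mult_right_zero[OF 1])
    from tendsto_ennrealI[OF this] show "(\<lambda>m. ennreal (c * (t / real m))) \<longlonglongrightarrow> 0" by simp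
    have "(\<lambda>m. sqrt (t / real m)) \<longlonglongrightarrow> 0" using tendsto_real_sqrt[OF 1] by simp
    from tendsto_ennrealI[OF this] show "(\<lambda>m. ennreal (sqrt (t / real m))) \<longlonglongrightarrow> 0" by simp
  qed (use P Qt in auto)
  then have "f t \<le> ennreal C * ?F + (0 * P + 0 * ?Q)"
  proof (rule LIMSEQ_le_const)
    obtain N :: nat where N: "t \<le> real N" using real_arch_simple by blast
    show "\<exists>N. \<forall>m\<ge>N. f t \<le> ennreal C * ?F + (ennreal (c * (t / real m)) * P + ennreal (sqrt (t / real m)) * ?Q)"
    proof (intro exI[of _ N] allI impI bound)
      fix m assume "N \<le> m"
      then have "real N \<le> real m" by simp
      then show "t \<le> real m" using N by linarith
    qed
  qed
  then show "f t \<le> ennreal C * ?F" by simp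
qed auto

section \<open>From rational times to all times\<close>

lemma rational_approx_below:
  assumes "0 < (r::real)"
  shows "\<exists>q. (\<forall>i::nat. q i \<in> \<rat> \<and> 0 \<le> q i \<and> q i \<le> r) \<and> q \<longlonglongrightarrow> r"
proof -
  have "\<exists>x\<in>\<rat>. max 0 (r - 1 / real (Suc i)) < x \<and> x < r" for i
    using assms by (intro Rats_dense_in_real) auto
  then obtain q where q: "\<And>i. q i \<in> \<rat> \<and> max 0 (r - 1 / real (Suc i)) < q i \<and> q i < r" by metis
  have "q \<longlonglongrightarrow> r"
  proof (rule real_tendsto_sandwich)
    have "(\<lambda>i. r - 1 / real (Suc i)) \<longlonglongrightarrow> r - 0"
      by (intro tendsto_diff tendsto_const LIMSEQ_Suc lim_1_over_n)
    then show "(\<lambda>i. r - 1 / real (Suc i)) \<longlonglongrightarrow> r" by simp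
    show "(\<lambda>_::nat. r) \<longlonglongrightarrow> r" by simp
    show "\<forall>\<^sub>F i in sequentially. r - 1 / real (Suc i) \<le> q i" "\<forall>\<^sub>F i in sequentially. q i \<le> r"
      using q by (auto intro!: always_eventually less_imp_le dest: spec)
  qed
  moreover have "\<forall>i. q i \<in> \<rat> \<and> 0 \<le> q i \<and> q i \<le> r"
    using q by (auto simp: less_imp_le)
  ultimately show ?thesis by blast
qed

text \<open>Approximation from below keeps the rational times inside \<open>[0, r]\<close>, where
  the property is assumed; time zero is itself rational.\<close>

lemma closed_property_from_rationals:
  fixes x :: "real \<Rightarrow> 'h::metric_space"
  assumes c: "continuous_on {0..} x" and P: "closed {v. P v}"
    and rat: "\<And>q. q \<in> \<rat> \<Longrightarrow> 0 \<le> q \<Longrightarrow> q \<le> t \<Longrightarrow> P (x q)" and r: "0 \<le> r" "r \<le> t"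
  shows "P (x r)"
proof (cases "r = 0")
  case True then show ?thesis using rat[of 0] r by simp
next
  case False
  then obtain q where q: "\<And>i. q i \<in> \<rat>" "\<And>i. 0 \<le> q i" "\<And>i. q i \<le> r" "q \<longlonglongrightarrow> r"
    using rational_approx_below[of r] r by auto
  have "(\<lambda>i. x (q i)) \<longlonglongrightarrow> x r"
    using continuous_on_tendsto_compose[OF c q(4)] q(2) r by auto
  moreover have "x (q i) \<in> {v. P v}" for i using rat[of "q i"] q r by (auto intro: order_trans)
  ultimately have "x r \<in> {v. P v}" using P by (meson closed_sequentially)
  then show ?thesis by simp
qed

section \<open>Strong solutions\<close>

text \<open>The equation integrates with respect to the completed measure, the estimates use the
  Borel one; nonnegative integrals do not see the difference. The integrand \<open>f\<close> may
  change sign, only its upper bound enters.\<close>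

lemma set_integral_le_nn_integral:
  fixes f :: "real \<Rightarrow> real"
  assumes le: "AE r in lborel. r \<in> S \<longrightarrow> ennreal (f r) \<le> k r"
  shows "ennreal (LINT r:S|lebesgue. f r) \<le> (\<integral>\<^sup>+r\<in>S. k r \<partial>lborel)"
proof -
  let ?g = "\<lambda>r. indicator S r *\<^sub>R f r"
  have "ennreal (integral\<^sup>L lebesgue ?g) \<le> (\<integral>\<^sup>+r. ennreal (?g r) \<partial>lebesgue)"
  proof (cases "(\<integral>\<^sup>+r. ennreal (?g r) \<partial>lebesgue)")
    case (real c)
    then have "integral\<^sup>L lebesgue ?g \<le> c" by (intro integral_real_bounded) auto
    then show ?thesis using real by (simp add: ennreal_leI)
  qed simp
  also have "\<dots> = (\<integral>\<^sup>+r. ennreal (?g r) \<partial>lborel)" by (rule nn_integral_completion)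
  also have "\<dots> \<le> (\<integral>\<^sup>+r\<in>S. k r \<partial>lborel)"
    using le by (intro nn_integral_mono_AE) (auto elim!: eventually_mono simp: indicator_def)
  finally show ?thesis by (simp add: set_lebesgue_integral_def)
qed

text \<open>Cauchy-Schwarz in time by duality: the integral \<open>v\<close> is tested with itself,
  and Young's inequality with weight \<open>h = b - a\<close> produces \<open>|v|^2 / 2\<close>,
  which the left-hand side absorbs.\<close>

lemma set_integral_norm_sq_le:
  fixes f :: "real \<Rightarrow> 'h::{real_inner, banach, second_countable_topology}"
  assumes f: "set_integrable lebesgue {a<..b} f" and ab: "a < b"
    and [measurable]: "k \<in> borel_measurable borel"
    and le: "AE r in lborel. r \<in> {a<..b} \<longrightarrow> ennreal ((norm (f r))\<^sup>2) \<le> k r"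
  shows "ennreal ((norm (LINT r:{a<..b}|lebesgue. f r))\<^sup>2) \<le> ennreal (b - a) * (\<integral>\<^sup>+r\<in>{a<..b}. k r \<partial>lborel)"
proof -
  define h where "h = b - a"
  let ?K = "\<integral>\<^sup>+r\<in>{a<..b}. k r \<partial>lborel"
  define v where "v = (LINT r:{a<..b}|lebesgue. f r)"
  define n where "n = (norm v)\<^sup>2"
  have h: "0 < h" using ab by (simp add: h_def)
  have n0: "0 \<le> n" by (simp add: n_def)
  have "n = v \<bullet> (LINT r:{a<..b}|lebesgue. f r)" by (simp add: n_def power2_norm_eq_inner flip: v_def)
  also have "\<dots> = (LINT r:{a<..b}|lebesgue. v \<bullet> f r)"
    unfolding set_lebesgue_integral_def
    using integral_inner_right[of v lebesgue "\<lambda>r. indicator {a<..b} r *\<^sub>R f r"] f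
    by (simp add: set_integrable_def)
  finally have "ennreal n = ennreal (LINT r:{a<..b}|lebesgue. v \<bullet> f r)" by simp
  also have "\<dots> \<le> (\<integral>\<^sup>+r\<in>{a<..b}. (ennreal (n / (2 * h)) + ennreal (h / 2) * k r) \<partial>lborel)"
  proof (rule set_integral_le_nn_integral, use le in eventually_elim, intro impI)
    fix r assume r: "r \<in> {a<..b} \<longrightarrow> ennreal ((norm (f r))\<^sup>2) \<le> k r" "r \<in> {a<..b}"
    have "2 * h * (p * q) \<le> p\<^sup>2 + h\<^sup>2 * q\<^sup>2" for h p q :: real
      using zero_le_power2[of "p - h * q"] by (simp add: power2_eq_square algebra_simps)
    then have "2 * h * (norm v * norm (f r)) \<le> n + h\<^sup>2 * (norm (f r))\<^sup>2"
      unfolding n_def .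
    then have "norm v * norm (f r) \<le> (n + h\<^sup>2 * (norm (f r))\<^sup>2) / (2 * h)"
      using h by (simp add: pos_le_divide_eq mult.commute)
    also have "\<dots> = n / (2 * h) + h / 2 * (norm (f r))\<^sup>2"
      using h by (simp add: add_divide_distrib power2_eq_square)
    finally have "v \<bullet> f r \<le> n / (2 * h) + h / 2 * (norm (f r))\<^sup>2"
      using norm_cauchy_schwarz[of v "f r"] by linarith
    then have "ennreal (v \<bullet> f r) \<le> ennreal (n / (2 * h) + h / 2 * (norm (f r))\<^sup>2)" by (rule ennreal_leI)
    also have "\<dots> = ennreal (n / (2 * h)) + ennreal (h / 2) * ennreal ((norm (f r))\<^sup>2)"
      using h n0 ennreal_mult''[of "(norm (f r))\<^sup>2" "h / 2"] by (simp add: ennreal_plus)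
    also have "\<dots> \<le> ennreal (n / (2 * h)) + ennreal (h / 2) * k r"
      using r by (intro add_left_mono mult_left_mono) auto
    finally show "ennreal (v \<bullet> f r) \<le> ennreal (n / (2 * h)) + ennreal (h / 2) * k r" .
  qed
  also have "\<dots> = (\<integral>\<^sup>+r. ennreal (n / (2 * h)) * indicator {a<..b} r + ennreal (h / 2) * (k r * indicator {a<..b} r) \<partial>lborel)"
    by (intro nn_integral_cong) (auto simp: indicator_def)
  also have "\<dots> = ennreal (n / (2 * h)) * ennreal h + ennreal (h / 2) * ?K"
    using ab by (simp add: nn_integral_add nn_integral_cmult nn_integral_cmult_indicator h_def)
  also have "ennreal (n / (2 * h)) * ennreal h = ennreal (n / 2)"
    using h n0 by (simp flip: ennreal_mult)
  finally have *: "ennreal n \<le> ennreal (n / 2) + ennreal (h / 2) * ?K" .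
  \<comment> \<open>Absorbing half of the left-hand side requires subtraction, hence the separate
    case of an infinite integral.\<close>
  have "ennreal n \<le> ennreal h * ?K"
  proof (cases ?K)
    case (real c)
    have "ennreal n \<le> ennreal (n / 2 + h / 2 * c)"
      using * real h n0 ennreal_mult''[of c "h / 2"] by (simp add: ennreal_plus)
    then have "n \<le> n / 2 + h / 2 * c" using h real n0 by (subst (asm) ennreal_le_iff) auto
    then have "n \<le> h * c" by simp
    then have "ennreal n \<le> ennreal (h * c)" by (rule ennreal_leI)
    then show ?thesis using real h by (simp add: ennreal_mult)
  qed (use h in \<open>simp add: ennreal_mult_top\<close>)
  then show ?thesis by (simp add: n_def v_def h_def)
qed

lemma stopped_eq: "0 \<le> t \<Longrightarrow> ennreal t \<le> \<tau> \<omega> \<Longrightarrow> stopped \<tau> t \<omega> = t"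
  by (simp add: stopped_def min_absorb1)

lemma stopped_max_zero: "stopped \<tau> (max 0 t) \<omega> = stopped \<tau> t \<omega>"
  by (simp add: stopped_def max_def ennreal_neg)

section \<open>Predictable processes: joint measurability and adaptedness\<close>

context brownian_basis
begin

text \<open>Predictable sets live over \<open>[0, infinity)\<close>, while the processes are indexed
  by all real times. Clamping at zero does not change a stopped process, so predictability yields
  joint measurability over the whole line.\<close>

lemma to_predictable_measurable:
  "(\<lambda>(\<omega>, t). (\<omega>, max 0 t)) \<in> M \<Otimes>\<^sub>M borel \<rightarrow>\<^sub>M predictable_algebra M F"
  unfolding predictable_algebra_def
proof (rule measurable_measure_of)
  show "{E \<times> {s<..t} |E s t. 0 \<le> s \<and> s \<le> t \<and> E \<in> sets (F (ennreal s))} \<union> {E \<times> {0} |E. E \<in> sets (F 0)}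
    \<subseteq> Pow (space M \<times> {0..})"
    using sets.sets_into_space[of _ "F _"] by fastforce
  show "(\<lambda>(\<omega>, t). (\<omega>, max 0 (t::real))) \<in> space (M \<Otimes>\<^sub>M borel) \<rightarrow> space M \<times> {0..}"
    by (auto simp: space_pair_measure le_max_iff_disj)
  fix y assume "y \<in> {E \<times> {s<..t} |E s t. 0 \<le> s \<and> s \<le> t \<and> E \<in> sets (F (ennreal s))} \<union> {E \<times> {0::real} |E. E \<in> sets (F 0)}"
  then consider E s t where "y = E \<times> {s<..t}" "E \<in> sets (F (ennreal s))" | E where "y = E \<times> {0}" "E \<in> sets (F 0)"
    by blast
  then obtain E I where y: "y = E \<times> I" "E \<in> sets M" "I \<in> sets borel"
  proof cases
    case (1 E s t)
    then show thesis using that[OF 1(1) subsetD[OF sets_F_subset 1(2)]] by simp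
  next
    case (2 E)
    then show thesis using that[OF 2(1) subsetD[OF sets_F_subset 2(2)]] by simp
  qed
  have "(\<lambda>(\<omega>, t). (\<omega>, max 0 (t::real))) -` y \<inter> space (M \<Otimes>\<^sub>M borel) = E \<times> ((\<lambda>t. max 0 t) -` I \<inter> space borel)"
    using sets.sets_into_space[OF y(2)] by (auto simp: y(1) space_pair_measure)
  also have "\<dots> \<in> sets (M \<Otimes>\<^sub>M borel)"
    using y(2,3) by (intro pair_measureI measurable_sets[of "\<lambda>t. max 0 t" borel borel]) auto
  finally show "(\<lambda>(\<omega>, t). (\<omega>, max 0 (t::real))) -` y \<inter> space (M \<Otimes>\<^sub>M borel) \<in> sets (M \<Otimes>\<^sub>M borel)" .
qed

text \<open>The section of a generating rectangle at time \<open>u\<close> is empty or an event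
  known no later than \<open>u\<close>. Predictable processes are therefore adapted.\<close>

lemma section_predictable_measurable:
  assumes u: "0 \<le> u"
  shows "(\<lambda>\<omega>. (\<omega>, u)) \<in> F (ennreal u) \<rightarrow>\<^sub>M predictable_algebra M F"
  unfolding predictable_algebra_def
proof (rule measurable_measure_of)
  show "{E \<times> {s<..t} |E s t. 0 \<le> s \<and> s \<le> t \<and> E \<in> sets (F (ennreal s))} \<union> {E \<times> {0} |E. E \<in> sets (F 0)}
    \<subseteq> Pow (space M \<times> {0..})"
    using sets.sets_into_space[of _ "F _"] by fastforce
  show "(\<lambda>\<omega>. (\<omega>, u)) \<in> space (F (ennreal u)) \<rightarrow> space M \<times> {0..}"
    using u by auto
  fix y assume "y \<in> {E \<times> {s<..t} |E s t. 0 \<le> s \<and> s \<le> t \<and> E \<in> sets (F (ennreal s))} \<union> {E \<times> {0::real} |E. E \<in> sets (F 0)}"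
  then consider E s t where "y = E \<times> {s<..t}" "0 \<le> s" "E \<in> sets (F (ennreal s))" | E where "y = E \<times> {0}" "E \<in> sets (F 0)"
    by blast
  then show "(\<lambda>\<omega>. (\<omega>, u)) -` y \<inter> space (F (ennreal u)) \<in> sets (F (ennreal u))"
  proof cases
    case 1
    have "(\<lambda>\<omega>. (\<omega>, u)) -` y \<inter> space (F (ennreal u)) = (if s < u \<and> u \<le> t then E else {})"
      using sets.sets_into_space[OF 1(3)] by (auto simp: 1(1))
    moreover have "s < u \<Longrightarrow> E \<in> sets (F (ennreal u))"
      using 1(3) sets_F_mono[of "ennreal s" "ennreal u"] by (auto simp: ennreal_leI)
    ultimately show ?thesis by simp
  next
    case 2
    have "(\<lambda>\<omega>. (\<omega>, u)) -` y \<inter> space (F (ennreal u)) = (if u = 0 then E else {})"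
      using sets.sets_into_space[OF 2(2)] by (auto simp: 2(1))
    moreover have "E \<in> sets (F (ennreal u))"
      using 2(2) sets_F_mono[of 0 "ennreal u"] by auto
    ultimately show ?thesis using 2(2) by simp
  qed
qed

end

locale strong_solution = brownian_basis M F \<beta> + hilbert_eigenbasis D A e lam
  for M :: "'w measure" and F \<beta> and D :: "'h::{real_inner, banach, second_countable_topology} set" and A e lam +
  fixes d :: nat and B R g and \<Phi>0 :: "'w \<Rightarrow> 'h" and \<Phi> :: "real \<Rightarrow> 'w \<Rightarrow> 'h" and \<tau> :: "'w \<Rightarrow> ennreal"
  assumes d: "d \<le> 3" and condB: "cond_B d D A e lam B" and condR: "cond_R D A e lam R"
    and condG: "cond_G M F D A e lam g"
    and sol: "local_strong_solution M F \<beta> D A e lam B R g \<Phi>0 \<Phi> \<tau>"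
begin

abbreviation X :: "real \<Rightarrow> 'w \<Rightarrow> 'h" where "X t \<omega> \<equiv> \<Phi> (stopped \<tau> t \<omega>) \<omega>"

lemma stopping: "stopping_time F \<tau>"
  using sol by (simp add: local_strong_solution_def local_weak_solution_def)

lemma tau_measurable [measurable]: "\<tau> \<in> borel_measurable M"
  using measurable_stopping_time[OF stopping] sets_F_subset by auto

lemma X_predictable: "(\<lambda>(\<omega>, t). X t \<omega>) \<in> predictable_algebra M F \<rightarrow>\<^sub>M borel"
  using sol by (simp add: local_strong_solution_def)

lemma X_joint [measurable]: "(\<lambda>(\<omega>, t). X t \<omega>) \<in> borel_measurable (M \<Otimes>\<^sub>M borel)"
  using measurable_compose[OF to_predictable_measurable X_predictable]
  by (simp add: case_prod_beta stopped_max_zero)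

lemma X_adapted: "0 \<le> t \<Longrightarrow> X t \<in> borel_measurable (F (ennreal t))"
  using measurable_compose[OF section_predictable_measurable X_predictable, of t] by simp

lemma X_measurable [measurable]: "X t \<in> borel_measurable M"
  using measurable_compose[OF measurable_Pair2'[of t borel M] X_joint] by simp

lemma X_continuous: "AE \<omega> in M. continuous_map (top_of_set {0..}) (norm_topology V Vn) (\<lambda>t. X t \<omega>)"
  using sol by (simp add: local_strong_solution_def L2_cont_def)

lemma X_sup_finite: "0 \<le> T \<Longrightarrow> (\<integral>\<^sup>+\<omega>. (SUP t\<in>{0..T}. ennreal ((norm (X t \<omega>))\<^sup>2)) \<partial>M) < \<infinity>"
  using sol by (simp add: local_strong_solution_def local_weak_solution_def L2_weakly_cont_def)

text \<open>The supremum over all times need not be measurable. The one over rational times is, it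
  lies below the former, and by continuity of the path it still dominates the value at every
  time.\<close>

lemma X_sup_bound:
  assumes "0 \<le> T"
  shows "\<exists>S. S \<in> borel_measurable M \<and> (\<integral>\<^sup>+\<omega>. S \<omega> \<partial>M) < \<top> \<and>
    (AE \<omega> in M. \<forall>t\<in>{0..T}. ennreal ((norm (X t \<omega>))\<^sup>2) \<le> S \<omega>)"
proof -
  define S where "S \<omega> = (SUP q\<in>\<rat> \<inter> {0..T}. ennreal ((norm (X q \<omega>))\<^sup>2))" for \<omega>
  have [measurable]: "S \<in> borel_measurable M"
    unfolding S_def by (intro borel_measurable_SUP countable_Int1 countable_rat) measurable
  have "(\<integral>\<^sup>+\<omega>. S \<omega> \<partial>M) \<le> (\<integral>\<^sup>+\<omega>. (SUP t\<in>{0..T}. ennreal ((norm (X t \<omega>))\<^sup>2)) \<partial>M)"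
    unfolding S_def by (intro nn_integral_mono SUP_subset_mono) auto
  then have 1: "(\<integral>\<^sup>+\<omega>. S \<omega> \<partial>M) < \<top>" using X_sup_finite[OF assms] by (simp add: le_less_trans)
  have "AE \<omega> in M. \<forall>t\<in>{0..T}. ennreal ((norm (X t \<omega>))\<^sup>2) \<le> S \<omega>"
    using X_continuous
  proof eventually_elim
    case (elim \<omega>)
    show ?case
    proof
      fix t assume t: "t \<in> {0..T}"
      have cl: "closed {v. ennreal ((norm v)\<^sup>2) \<le> S \<omega>}" for \<omega>
        by (intro closed_Collect_le continuous_on_ennreal continuous_intros)
      show "ennreal ((norm (X t \<omega>))\<^sup>2) \<le> S \<omega>"
        by (rule closed_property_from_rationals[where x="\<lambda>t. X t \<omega>" and t=T, OF continuous_V_path(1)[OF elim] cl])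
          (use t in \<open>auto simp: S_def intro!: SUP_upper\<close>)
    qed
  qed
  then show ?thesis using 1 by (intro exI[of _ S]) auto
qed

lemma in_D_AE: "AE \<omega> in M. AE s in lborel. 0 \<le> s \<and> ennreal s \<le> \<tau> \<omega> \<longrightarrow> X s \<omega> \<in> D"
proof -
  have "AE \<omega> in M. AE s in lborel. 0 \<le> s \<and> ennreal s \<le> \<tau> \<omega> \<longrightarrow> \<Phi> s \<omega> \<in> D"
    using sol by (simp add: local_strong_solution_def L2_L2loc_def)
  then show ?thesis
    by eventually_elim (auto elim!: eventually_mono simp: stopped_eq)
qed

lemma Asq_joint [measurable]:
  "(\<lambda>(\<omega>, r). if ennreal r \<le> \<tau> \<omega> then Asq (X r \<omega>) else 0) \<in> borel_measurable (M \<Otimes>\<^sub>M borel)"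
proof -
  have "(\<lambda>x. if ennreal (snd x) \<le> \<tau> (fst x) then Asq (case x of (\<omega>, r) \<Rightarrow> X r \<omega>) else 0) \<in> borel_measurable (M \<Otimes>\<^sub>M borel)"
    by measurable
  then show ?thesis by (simp add: case_prod_beta)
qed

text \<open>A time \<open>r\<close> up to both \<open>T\<close> and \<open>\<tau>\<close> lies in
  the interval that ends at \<open>stopped \<tau> T \<omega>\<close>, where the solution property
  controls \<open>|A \<Phi>|^2\<close>. In contrast to that integrand, the one used here is known to
  be jointly measurable.\<close>

lemma Asq_finite:
  assumes T: "0 \<le> T"
  shows "(\<integral>\<^sup>+\<omega>. (\<integral>\<^sup>+r\<in>{0<..T}. (if ennreal r \<le> \<tau> \<omega> then Asq (X r \<omega>) else 0) \<partial>lborel) \<partial>M) < \<top>"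
proof -
  have "(\<integral>\<^sup>+\<omega>. (\<integral>\<^sup>+r\<in>{0<..T}. (if ennreal r \<le> \<tau> \<omega> then Asq (X r \<omega>) else 0) \<partial>lborel) \<partial>M) \<le>
    (\<integral>\<^sup>+\<omega>. (\<integral>\<^sup>+s\<in>{0..stopped \<tau> T \<omega>}. ennreal ((norm (A (\<Phi> s \<omega>)))\<^sup>2) \<partial>lborel) \<partial>M)"
  proof (rule nn_integral_mono_AE)
    show "AE \<omega> in M. (\<integral>\<^sup>+r\<in>{0<..T}. (if ennreal r \<le> \<tau> \<omega> then Asq (X r \<omega>) else 0) \<partial>lborel) \<le>
      (\<integral>\<^sup>+s\<in>{0..stopped \<tau> T \<omega>}. ennreal ((norm (A (\<Phi> s \<omega>)))\<^sup>2) \<partial>lborel)"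
      using in_D_AE
    proof eventually_elim
      case (elim \<omega>)
      show ?case
      proof (rule nn_integral_mono_AE, use elim in eventually_elim)
        fix r assume r: "0 \<le> r \<and> ennreal r \<le> \<tau> \<omega> \<longrightarrow> X r \<omega> \<in> D"
        show "(if ennreal r \<le> \<tau> \<omega> then Asq (X r \<omega>) else 0) * indicator {0<..T} r
          \<le> ennreal ((norm (A (\<Phi> r \<omega>)))\<^sup>2) * indicator {0..stopped \<tau> T \<omega>} r"
        proof (cases "ennreal r \<le> \<tau> \<omega> \<and> r \<in> {0<..T}")
          case True
          have "r = enn2real (ennreal r)" using True by simp
          also have "\<dots> \<le> enn2real (min (ennreal T) (\<tau> \<omega>))"
            using True by (intro enn2real_mono) (auto simp: ennreal_leI less_top min_less_iff_disj)
          finally have "r \<le> stopped \<tau> T \<omega>" by (simp add: stopped_def)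
          then show ?thesis using True r by (simp add: Asq_D stopped_eq)
        qed auto
      qed
    qed
  qed
  also have "\<dots> < \<top>"
    using sol T by (simp add: local_strong_solution_def L2_L2loc_def)
  finally show ?thesis .
qed

lemma solution_equation:
  assumes "0 < t"
  shows "\<exists>I. ito_process (noise_integrand g \<Phi> \<tau>) t I \<and>
    (AE \<omega> in M. set_integrable lebesgue {0..stopped \<tau> t \<omega>} (\<lambda>s. drift A e lam B R (\<Phi> s \<omega>)) \<and>
       X t \<omega> = \<Phi>0 \<omega> + I \<omega> - (LINT s:{0..stopped \<tau> t \<omega>}|lebesgue. drift A e lam B R (\<Phi> s \<omega>)))"
proof -
  obtain I where I: "has_stochastic_integral M F \<beta> (noise_integrand g \<Phi> \<tau>) t I"
    "AE \<omega> in M. set_integrable lebesgue {0..stopped \<tau> t \<omega>} (\<lambda>s. drift A e lam B R (\<Phi> s \<omega>)) \<and>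
           X t \<omega> + (LINT s:{0..stopped \<tau> t \<omega>}|lebesgue. drift A e lam B R (\<Phi> s \<omega>)) = \<Phi>0 \<omega> + I \<omega>"
    using sol assms by (auto simp: local_strong_solution_def)
  have "ito_process (noise_integrand g \<Phi> \<tau>) t I"
    using ito_process_of_stochastic_integral[OF I(1)] assms by simp
  moreover have "AE \<omega> in M. set_integrable lebesgue {0..stopped \<tau> t \<omega>} (\<lambda>s. drift A e lam B R (\<Phi> s \<omega>)) \<and>
       X t \<omega> = \<Phi>0 \<omega> + I \<omega> - (LINT s:{0..stopped \<tau> t \<omega>}|lebesgue. drift A e lam B R (\<Phi> s \<omega>))"
    using I(2) by eventually_elim (simp add: eq_diff_eq)
  ultimately show ?thesis by blast
qed

end

section \<open>Two solutions with the same data\<close>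

locale solution_pair = brownian_basis M F \<beta> + hilbert_eigenbasis D A e lam +
    s1: strong_solution M F \<beta> D A e lam d B R g \<Phi>0 \<Phi>1 \<tau> +
    s2: strong_solution M F \<beta> D A e lam d B R g \<Phi>0 \<Phi>2 \<tau>
  for M :: "'w measure" and F \<beta> and D :: "'h::{real_inner, banach, second_countable_topology} set" and A e lam
    and d B R g \<Phi>0 \<Phi>1 \<Phi>2 \<tau>
begin

abbreviation X1 :: "real \<Rightarrow> 'w \<Rightarrow> 'h" where "X1 t \<omega> \<equiv> \<Phi>1 (stopped \<tau> t \<omega>) \<omega>"
abbreviation X2 :: "real \<Rightarrow> 'w \<Rightarrow> 'h" where "X2 t \<omega> \<equiv> \<Phi>2 (stopped \<tau> t \<omega>) \<omega>"

definition W :: "real \<Rightarrow> 'w \<Rightarrow> 'h" where "W t \<omega> = X1 t \<omega> - X2 t \<omega>"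

text \<open>The equation is available for positive times only; setting the difference to zero at
  time zero saves an argument about the limit \<open>t \<rightarrow> 0\<close>.\<close>

definition x :: "real \<Rightarrow> 'w \<Rightarrow> 'h" where "x t \<omega> = (if t = 0 then 0 else W t \<omega>)"

text \<open>Only rational times are inspected: a countable condition is measurable and known at time
  \<open>t\<close>, and by continuity it controls all times up to \<open>t\<close>. Being monotone
  in \<open>t\<close>, it does the work of a stopping time.\<close>

definition good :: "real \<Rightarrow> real \<Rightarrow> 'w \<Rightarrow> bool" where
  "good n t \<omega> \<longleftrightarrow> ennreal t \<le> \<tau> \<omega> \<and> (\<forall>r\<in>\<rat>. 0 \<le> r \<longrightarrow> r \<le> t \<longrightarrow> Vball n (X1 r \<omega>) \<and> Vball n (X2 r \<omega>))"

definition G :: "real \<Rightarrow> real \<Rightarrow> 'w set" where "G n t = {\<omega> \<in> space M. good n t \<omega>}"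

definition noise :: "nat \<Rightarrow> real \<Rightarrow> 'w \<Rightarrow> 'h" where
  "noise k s \<omega> = noise_integrand g \<Phi>1 \<tau> k s \<omega> - noise_integrand g \<Phi>2 \<tau> k s \<omega>"

definition bd :: "'w \<Rightarrow> real \<Rightarrow> 'h" where
  "bd \<omega> s = drift A e lam B R (\<Phi>1 s \<omega>) - drift A e lam B R (\<Phi>2 s \<omega>)"

text \<open>Up to a constant, a majorant of the squared drift difference on the good events. The
  series \<open>Asq\<close> makes it jointly measurable, the cut-off at \<open>\<tau>\<close> makes
  it integrable over bounded times.\<close>

definition \<alpha> :: "real \<Rightarrow> 'w \<Rightarrow> ennreal" where
  "\<alpha> r \<omega> = 1 + (if ennreal r \<le> \<tau> \<omega> then Asq (X1 r \<omega>) else 0) + (if ennreal r \<le> \<tau> \<omega> then Asq (X2 r \<omega>) else 0)"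

section \<open>Measurability of the localisation and of the difference process\<close>

lemma good_mono: "good n t \<omega> \<Longrightarrow> s \<le> t \<Longrightarrow> good n s \<omega>"
  unfolding good_def by (meson ennreal_leI order_trans)

lemma G_mono: "s \<le> t \<Longrightarrow> G n t \<subseteq> G n s"
  by (auto simp: G_def intro: good_mono)

lemma Vball_sets: "{v. Vball n v} \<in> sets borel"
  using closed_Vball by (rule borel_closed)

text \<open>For a stopping time the event \<open>\<tau> < t\<close> is known at time
  \<open>t\<close>, hence so is its complement; the ball conditions concern times up to
  \<open>t\<close> and are countably many.\<close>

lemma G_adapted: "0 \<le> t \<Longrightarrow> G n t \<in> sets (F (ennreal t))"
proof -
  assume t: "0 \<le> t"
  interpret fil: filtration "space M" F
    using stochastic_basis by (simp add: stochastic_basis_def)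
  have 1: "Measurable.pred (F (ennreal t)) (\<lambda>\<omega>. \<tau> \<omega> < ennreal t)"
    by (rule fil.stopping_time_less_const[OF s1.stopping])
  have 2: "Measurable.pred (F (ennreal t)) (\<lambda>\<omega>. Vball n (Y \<omega>))" if "Y \<in> borel_measurable (F (ennreal t))" for Y :: "'w \<Rightarrow> 'h"
    using measurable_sets[OF that Vball_sets[of n]] by (simp add: pred_def vimage_def Int_def conj_commute)
  have "Measurable.pred (F (ennreal t)) (\<lambda>\<omega>. \<forall>r\<in>\<rat> \<inter> {0..t}. Vball n (X1 r \<omega>) \<and> Vball n (X2 r \<omega>))"
    by (rule measurable_pred_countable(1))
      (auto intro!: countable_Int1 countable_rat pred_intros_logic 2 measurable_F_mono[OF s1.X_adapted]
        measurable_F_mono[OF s2.X_adapted] ennreal_leI)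
  then have "Measurable.pred (F (ennreal t)) (\<lambda>\<omega>. \<not> \<tau> \<omega> < ennreal t \<and> (\<forall>r\<in>\<rat> \<inter> {0..t}. Vball n (X1 r \<omega>) \<and> Vball n (X2 r \<omega>)))"
    using 1 by (intro pred_intros_logic)
  also have "(\<lambda>\<omega>. \<not> \<tau> \<omega> < ennreal t \<and> (\<forall>r\<in>\<rat> \<inter> {0..t}. Vball n (X1 r \<omega>) \<and> Vball n (X2 r \<omega>))) = good n t"
    by (auto simp: good_def not_less)
  finally show ?thesis by (simp add: G_def pred_def)
qed

lemma G_sets [measurable]: "G n t \<in> sets M"
proof (cases "0 \<le> t")
  case True then show ?thesis using G_adapted sets_F_subset by blast
next
  case False
  then have "G n t = space M" by (auto simp: G_def good_def ennreal_neg)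
  then show ?thesis by simp
qed

lemma good_joint [measurable]: "Measurable.pred (M \<Otimes>\<^sub>M borel) (\<lambda>z. good n (snd z) (fst z))"
proof -
  have 2: "Measurable.pred (M \<Otimes>\<^sub>M borel) (\<lambda>z. Vball n (Y (fst z)))" if "Y \<in> borel_measurable M" for Y :: "'w \<Rightarrow> 'h"
    using measurable_sets[OF measurable_compose[OF measurable_fst that] Vball_sets[of n], of borel]
    by (simp add: pred_def vimage_def Int_def conj_commute)
  have [measurable]: "Measurable.pred (M \<Otimes>\<^sub>M borel) (\<lambda>z. Vball n (X1 r (fst z)))"
    "Measurable.pred (M \<Otimes>\<^sub>M borel) (\<lambda>z. Vball n (X2 r (fst z)))" for r
    by (rule 2, rule s1.X_measurable, rule 2, rule s2.X_measurable)
  have "Measurable.pred (M \<Otimes>\<^sub>M borel) (\<lambda>z. \<forall>r\<in>\<rat>. 0 \<le> r \<longrightarrow> r \<le> snd z \<longrightarrow> Vball n (X1 r (fst z)) \<and> Vball n (X2 r (fst z)))"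
    by (rule measurable_pred_countable(1)[OF countable_rat]) measurable
  moreover have "Measurable.pred (M \<Otimes>\<^sub>M borel) (\<lambda>z. ennreal (snd z) \<le> \<tau> (fst z))"
    by measurable
  ultimately show ?thesis unfolding good_def by (rule pred_intros_logic(3)[rotated])
qed

lemma W_joint [measurable]: "(\<lambda>(\<omega>, t). W t \<omega>) \<in> borel_measurable (M \<Otimes>\<^sub>M borel)"
  using borel_measurable_diff[OF s1.X_joint s2.X_joint] by (simp add: W_def case_prod_beta)

lemma x_joint [measurable]: "(\<lambda>(\<omega>, t). x t \<omega>) \<in> borel_measurable (M \<Otimes>\<^sub>M borel)"
proof -
  have "(\<lambda>z. if snd z = 0 then 0 else (case z of (\<omega>, t) \<Rightarrow> W t \<omega>)) \<in> borel_measurable (M \<Otimes>\<^sub>M borel)"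
    by measurable
  then show ?thesis by (simp add: x_def case_prod_beta)
qed

lemma x_adapted: "0 \<le> t \<Longrightarrow> x t \<in> borel_measurable (F (ennreal t))"
  unfolding x_def W_def by (cases "t = 0") (auto intro!: borel_measurable_diff s1.X_adapted s2.X_adapted)

lemma alpha_joint [measurable]: "(\<lambda>(\<omega>, r). \<alpha> r \<omega>) \<in> borel_measurable (M \<Otimes>\<^sub>M borel)"
  using borel_measurable_add[OF borel_measurable_add[OF borel_measurable_const[of 1] s1.Asq_joint] s2.Asq_joint]
  by (simp add: \<alpha>_def case_prod_beta)

text \<open>The Lipschitz condition on H turns the intensity of the noise difference into a multiple
  of \<open>|W|^2\<close>, a quantity that Gronwall's lemma can absorb.\<close>

lemma noise_bound:
  "\<exists>L\<ge>0. \<forall>n r. \<forall>\<omega>\<in>space M. 0 \<le> r \<longrightarrow>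
    ennreal (\<Sum>j<n. (norm (noise j r \<omega>))\<^sup>2) \<le> (if ennreal r \<le> \<tau> \<omega> then ennreal (L * (norm (W r \<omega>))\<^sup>2) else 0)"
proof -
  have gl: "g \<in> Lip_class M F UNIV norm (l2_space UNIV norm) (l2_norm norm)"
    using s1.condG by (simp add: cond_G_def)
  then have "\<exists>L. \<forall>\<omega>\<in>space M. \<forall>t\<ge>0. \<forall>u v. l2_norm norm (g \<omega> t u - g \<omega> t v) \<le> L * norm (u - v)"
    unfolding Lip_class_def by blast
  then obtain L where L: "\<And>\<omega> t u v. \<omega> \<in> space M \<Longrightarrow> 0 \<le> t \<Longrightarrow> l2_norm norm (g \<omega> t u - g \<omega> t v) \<le> L * norm (u - v)"
    by blast
  \<comment> \<open>Square summability of \<open>g\<close> is encoded in the target space of its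
    measurability statement. It is needed because \<open>l2_norm\<close> of a divergent series is a
    default value.\<close>
  have l2: "summable (\<lambda>k. (norm (g \<omega> t u k))\<^sup>2)" if "\<omega> \<in> space M" "0 \<le> t" for \<omega> t u
  proof -
    have "(\<lambda>(\<omega>, t, u). g \<omega> t u) \<in> F (ennreal t) \<Otimes>\<^sub>M (restrict_space borel {0..t} \<Otimes>\<^sub>M norm_borel UNIV norm) \<rightarrow>\<^sub>M
        norm_borel (l2_space UNIV norm) (l2_norm norm)"
      using gl that by (simp add: Lip_class_def)
    from measurable_space[OF this, of "(\<omega>, t, u)"] that have "g \<omega> t u \<in> l2_space UNIV norm"
      by (simp add: space_pair_measure norm_borel_def space_measure_of_conv)
    then show ?thesis by (simp add: l2_space_def)
  qed
  have bound: "(\<Sum>j<n. (norm (g \<omega> t u j - g \<omega> t v j))\<^sup>2) \<le> L\<^sup>2 * (norm (u - v))\<^sup>2"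
    if "\<omega> \<in> space M" "0 \<le> t" for \<omega> t u v n
  proof -
    have s: "summable (\<lambda>k. (norm (g \<omega> t u k - g \<omega> t v k))\<^sup>2)"
    proof (rule summable_comparison_test'[where N=0])
      show "summable (\<lambda>k. 2 * (norm (g \<omega> t u k))\<^sup>2 + 2 * (norm (g \<omega> t v k))\<^sup>2)"
        by (intro summable_add summable_mult l2 that)
      show "norm ((norm (g \<omega> t u k - g \<omega> t v k))\<^sup>2) \<le> 2 * (norm (g \<omega> t u k))\<^sup>2 + 2 * (norm (g \<omega> t v k))\<^sup>2" for k
        using norm_add_sq_le[of "g \<omega> t u k" "- g \<omega> t v k"] by simp
    qed
    have "(\<Sum>j<n. (norm (g \<omega> t u j - g \<omega> t v j))\<^sup>2) \<le> (\<Sum>j. (norm (g \<omega> t u j - g \<omega> t v j))\<^sup>2)"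
      by (rule sum_le_suminf[OF s]) auto
    also have "\<dots> = (l2_norm norm (g \<omega> t u - g \<omega> t v))\<^sup>2"
      using suminf_nonneg[OF s] by (simp add: l2_norm_def)
    also have "\<dots> \<le> (L * norm (u - v))\<^sup>2"
      using suminf_nonneg[OF s] by (intro power_mono L that) (auto simp: l2_norm_def)
    finally show ?thesis by (simp add: power_mult_distrib)
  qed
  show ?thesis
  proof (intro exI[of _ "L\<^sup>2"] conjI allI ballI impI)
    fix n r \<omega> assume \<omega>: "\<omega> \<in> space M" and r: "0 \<le> (r::real)"
    show "ennreal (\<Sum>j<n. (norm (noise j r \<omega>))\<^sup>2) \<le> (if ennreal r \<le> \<tau> \<omega> then ennreal (L\<^sup>2 * (norm (W r \<omega>))\<^sup>2) else 0)"
    proof (cases "ennreal r \<le> \<tau> \<omega>")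
      case True
      have "(\<Sum>j<n. (norm (g \<omega> r (\<Phi>1 r \<omega>) j - g \<omega> r (\<Phi>2 r \<omega>) j))\<^sup>2) \<le> L\<^sup>2 * (norm (\<Phi>1 r \<omega> - \<Phi>2 r \<omega>))\<^sup>2"
        by (rule bound[OF \<omega> r])
      then show ?thesis using True
        by (simp add: noise_def noise_integrand_def W_def stopped_eq[of r \<tau> \<omega>] r ennreal_leI)
    next
      case False
      then show ?thesis by (simp add: noise_def noise_integrand_def)
    qed
  qed simp
qed

text \<open>The initial data cancel in the difference of the two equations, and subtracting the
  results at two times gives the increments. The null sets depend on \<open>s\<close> and
  \<open>t\<close>, which suffices because the estimates take means at fixed times.\<close>

lemma increments:
  "\<exists>N. (\<forall>t\<ge>0. ito_process noise t (N t)) \<and>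
    (\<forall>s t. 0 \<le> s \<longrightarrow> s < t \<longrightarrow> (AE \<omega> in M. ennreal t \<le> \<tau> \<omega> \<longrightarrow>
      set_integrable lebesgue {s<..t} (bd \<omega>) \<and>
      x t \<omega> - x s \<omega> = N t \<omega> - N s \<omega> - (LINT r:{s<..t}|lebesgue. bd \<omega> r)))"
proof -
  let ?I = "\<lambda>t \<omega>. (LINT r:{0..t}|lebesgue. bd \<omega> r)"
  have "\<exists>N. ito_process noise t N \<and> (AE \<omega> in M. ennreal t \<le> \<tau> \<omega> \<longrightarrow>
      set_integrable lebesgue {0..t} (bd \<omega>) \<and> W t \<omega> = N \<omega> - ?I t \<omega>)" if t: "0 < t" for t
  proof -
    obtain I1 where I1: "ito_process (noise_integrand g \<Phi>1 \<tau>) t I1"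
      "AE \<omega> in M. set_integrable lebesgue {0..stopped \<tau> t \<omega>} (\<lambda>s. drift A e lam B R (\<Phi>1 s \<omega>)) \<and>
       X1 t \<omega> = \<Phi>0 \<omega> + I1 \<omega> - (LINT s:{0..stopped \<tau> t \<omega>}|lebesgue. drift A e lam B R (\<Phi>1 s \<omega>))"
      using s1.solution_equation[OF t] by blast
    obtain I2 where I2: "ito_process (noise_integrand g \<Phi>2 \<tau>) t I2"
      "AE \<omega> in M. set_integrable lebesgue {0..stopped \<tau> t \<omega>} (\<lambda>s. drift A e lam B R (\<Phi>2 s \<omega>)) \<and>
       X2 t \<omega> = \<Phi>0 \<omega> + I2 \<omega> - (LINT s:{0..stopped \<tau> t \<omega>}|lebesgue. drift A e lam B R (\<Phi>2 s \<omega>))"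
      using s2.solution_equation[OF t] by blast
    have "ito_process noise t (\<lambda>\<omega>. I1 \<omega> - I2 \<omega>)"
      unfolding noise_def using ito_process_diff[OF I1(1) I2(1)] t by simp
    moreover have "AE \<omega> in M. ennreal t \<le> \<tau> \<omega> \<longrightarrow>
      set_integrable lebesgue {0..t} (bd \<omega>) \<and> W t \<omega> = (I1 \<omega> - I2 \<omega>) - ?I t \<omega>"
      using I1(2) I2(2)
    proof eventually_elim
      case (elim \<omega>)
      show ?case
      proof
        assume a: "ennreal t \<le> \<tau> \<omega>"
        then have st: "stopped \<tau> t \<omega> = t" using t by (intro stopped_eq) auto
        from elim show "set_integrable lebesgue {0..t} (bd \<omega>) \<and> W t \<omega> = (I1 \<omega> - I2 \<omega>) - ?I t \<omega>"
          unfolding st bd_def[abs_def] by (simp add: W_def st set_integral_diff)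
      qed
    qed
    ultimately show ?thesis by blast
  qed
  then have "\<forall>t\<in>{0<..}. \<exists>N. ito_process noise t N \<and> (AE \<omega> in M. ennreal t \<le> \<tau> \<omega> \<longrightarrow>
      set_integrable lebesgue {0..t} (bd \<omega>) \<and> W t \<omega> = N \<omega> - ?I t \<omega>)"
    by (intro ballI) (simp only: greaterThan_iff)
  from bchoice[OF this] obtain N0 where N0': "\<forall>t\<in>{0<..}. ito_process noise t (N0 t) \<and> (AE \<omega> in M. ennreal t \<le> \<tau> \<omega> \<longrightarrow>
      set_integrable lebesgue {0..t} (bd \<omega>) \<and> W t \<omega> = N0 t \<omega> - ?I t \<omega>)"
    by (elim exE)
  have N0: "\<And>t. 0 < t \<Longrightarrow> ito_process noise t (N0 t)"
    "\<And>t. 0 < t \<Longrightarrow> AE \<omega> in M. ennreal t \<le> \<tau> \<omega> \<longrightarrow>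
      set_integrable lebesgue {0..t} (bd \<omega>) \<and> W t \<omega> = N0 t \<omega> - ?I t \<omega>"
    using N0' by simp_all
  \<comment> \<open>The value zero at time zero matches the convention in the definition of
    \<open>x\<close>.\<close>
  define N where "N t = (if t = 0 then (\<lambda>_. 0) else N0 t)" for t
  have "ito_process noise t (N t)" if "0 \<le> t" for t
    using N0(1)[of t] ito_process_at_zero[OF N0(1)[of 1]] that by (cases "t = 0") (auto simp: N_def)
  moreover have "AE \<omega> in M. ennreal t \<le> \<tau> \<omega> \<longrightarrow>
      set_integrable lebesgue {s<..t} (bd \<omega>) \<and>
      x t \<omega> - x s \<omega> = N t \<omega> - N s \<omega> - (LINT r:{s<..t}|lebesgue. bd \<omega> r)" if st: "0 \<le> s" "s < t" for s t
  proof -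
    have t: "0 < t" using st by simp
    have split: "?I t \<omega> = ?I s \<omega> + (LINT r:{s<..t}|lebesgue. bd \<omega> r)" "set_integrable lebesgue {s<..t} (bd \<omega>)"
      if "set_integrable lebesgue {0..t} (bd \<omega>)" for \<omega>
    proof -
      have i: "set_integrable lebesgue {0..s} (bd \<omega>)" "set_integrable lebesgue {s<..t} (bd \<omega>)"
        using that st by (auto intro: set_integrable_subset)
      have un: "{0..s} \<union> {s<..t} = {0..t}" and disj: "{0..s} \<inter> {s<..t} = {}" using st by auto
      then show "?I t \<omega> = ?I s \<omega> + (LINT r:{s<..t}|lebesgue. bd \<omega> r)"
        using set_integral_Un[OF disj i] by (simp only: un)
      show "set_integrable lebesgue {s<..t} (bd \<omega>)" by (rule i)
    qed
    show ?thesis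
    proof (cases "s = 0")
      case True
      \<comment> \<open>For \<open>s = 0\<close> the increment is the equation at \<open>t\<close>
        alone, since the single point 0 carries no integral.\<close>
      have "AE r in lebesgue. r \<noteq> (0::real)" by (intro AE_completion AE_lborel_singleton)
      then have "AE r in lebesgue. indicator {0..0} r *\<^sub>R bd \<omega> r = 0" for \<omega>
        by eventually_elim auto
      then have z: "?I 0 \<omega> = 0" for \<omega>
        unfolding set_lebesgue_integral_def by (rule integral_eq_zero_AE)
      show ?thesis using N0(2)[OF t]
      proof eventually_elim
        case (elim \<omega>)
        then show ?case using split[of \<omega>] z[of \<omega>] t unfolding True by (auto simp: x_def N_def)
      qed
    next
      case False
      then have s: "0 < s" using st by simp
      show ?thesis using N0(2)[OF t] N0(2)[OF s]
      proof eventually_elim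
        case (elim \<omega>)
        show ?case
        proof
          assume a: "ennreal t \<le> \<tau> \<omega>"
          then have "ennreal s \<le> \<tau> \<omega>" using st by (meson ennreal_leI less_imp_le order_trans)
          then show "set_integrable lebesgue {s<..t} (bd \<omega>) \<and>
              x t \<omega> - x s \<omega> = N t \<omega> - N s \<omega> - (LINT r:{s<..t}|lebesgue. bd \<omega> r)"
            using elim a split[of \<omega>] t s by (auto simp: x_def N_def)
        qed
      qed
    qed
  qed
  ultimately show ?thesis by blast
qed

text \<open>The constants come from the deterministic drift estimates on the ball of radius
  \<open>n\<close>, and one null set serves all \<open>t\<close>. They can therefore be fixed before
  any grid is chosen.\<close>

lemma good_drift_bounds:
  assumes n: "0 \<le> n"
  shows "\<exists>C>0. \<exists>K>0. AE \<omega> in M. \<forall>t. good n t \<omega> \<longrightarrow> (AE r in lborel. r \<in> {0<..t} \<longrightarrow>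
    - 2 * (W r \<omega> \<bullet> bd \<omega> r) \<le> C * (norm (W r \<omega>))\<^sup>2 \<and> ennreal ((norm (bd \<omega> r))\<^sup>2) \<le> ennreal K * \<alpha> r \<omega>)"
proof -
  obtain C where C: "0 < C" "\<And>u v. u \<in> D \<Longrightarrow> v \<in> D \<Longrightarrow> Vn u \<le> n \<Longrightarrow> Vn v \<le> n \<Longrightarrow>
    - 2 * ((u - v) \<bullet> (drift A e lam B R u - drift A e lam B R v)) \<le> C * (norm (u - v))\<^sup>2"
    using drift_monotone[OF s1.condB s1.condR, of n] by blast
  obtain K where K: "0 < K" "\<And>u. u \<in> D \<Longrightarrow> Vn u \<le> n \<Longrightarrow> (norm (drift A e lam B R u))\<^sup>2 \<le> K * (1 + (norm (A u))\<^sup>2)"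
    using drift_growth[OF s1.condB s1.d s1.condR, of n] by blast
  have "AE \<omega> in M. \<forall>t. good n t \<omega> \<longrightarrow> (AE r in lborel. r \<in> {0<..t} \<longrightarrow>
    - 2 * (W r \<omega> \<bullet> bd \<omega> r) \<le> C * (norm (W r \<omega>))\<^sup>2 \<and> ennreal ((norm (bd \<omega> r))\<^sup>2) \<le> ennreal (4 * K) * \<alpha> r \<omega>)"
    using s1.X_continuous s2.X_continuous s1.in_D_AE s2.in_D_AE
  proof eventually_elim
    case (elim \<omega>)
    show ?case
    proof (intro allI impI)
      fix t assume g: "good n t \<omega>"
      show "AE r in lborel. r \<in> {0<..t} \<longrightarrow> - 2 * (W r \<omega> \<bullet> bd \<omega> r) \<le> C * (norm (W r \<omega>))\<^sup>2 \<and>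
          ennreal ((norm (bd \<omega> r))\<^sup>2) \<le> ennreal (4 * K) * \<alpha> r \<omega>"
        using elim(3,4)
      proof (eventually_elim, intro impI)
        fix r assume D12: "0 \<le> r \<and> ennreal r \<le> \<tau> \<omega> \<longrightarrow> X1 r \<omega> \<in> D" "0 \<le> r \<and> ennreal r \<le> \<tau> \<omega> \<longrightarrow> X2 r \<omega> \<in> D"
          and r: "r \<in> {0<..t}"
        have tau: "ennreal r \<le> \<tau> \<omega>" using good_mono[OF g, of r] r by (simp add: good_def)
        then have D: "X1 r \<omega> \<in> D" "X2 r \<omega> \<in> D" using D12 r by auto
        \<comment> \<open>The balls are closed in H and the paths are continuous there, so the
          condition at rational times extends to \<open>r\<close>.\<close>
        have Vb1: "Vball n (X1 r \<omega>)"
          by (rule closed_property_from_rationals[where x="\<lambda>t. X1 t \<omega>" and t=t, OF continuous_V_path(1)[OF elim(1)] closed_Vball])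
            (use g r in \<open>auto simp: good_def\<close>)
        have Vb2: "Vball n (X2 r \<omega>)"
          by (rule closed_property_from_rationals[where x="\<lambda>t. X2 t \<omega>" and t=t, OF continuous_V_path(1)[OF elim(2)] closed_Vball])
            (use g r in \<open>auto simp: good_def\<close>)
        have Vn: "Vn (X1 r \<omega>) \<le> n" "Vn (X2 r \<omega>) \<le> n" using Vb1 Vb2 n by (simp_all add: Vball_iff)
        have st: "stopped \<tau> r \<omega> = r" using r tau by (intro stopped_eq) auto
        have bd: "bd \<omega> r = drift A e lam B R (X1 r \<omega>) - drift A e lam B R (X2 r \<omega>)" by (simp add: bd_def st)
        have 1: "- 2 * (W r \<omega> \<bullet> bd \<omega> r) \<le> C * (norm (W r \<omega>))\<^sup>2"
          unfolding bd W_def by (rule C(2)[OF D Vn])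
        have "(norm (bd \<omega> r))\<^sup>2 \<le> 2 * (norm (drift A e lam B R (X1 r \<omega>)))\<^sup>2 + 2 * (norm (drift A e lam B R (X2 r \<omega>)))\<^sup>2"
          unfolding bd using norm_add_sq_le[of "drift A e lam B R (X1 r \<omega>)" "- drift A e lam B R (X2 r \<omega>)"] by simp
        also have "\<dots> \<le> 2 * (K * (1 + (norm (A (X1 r \<omega>)))\<^sup>2)) + 2 * (K * (1 + (norm (A (X2 r \<omega>)))\<^sup>2))"
          using K(2)[OF D(1) Vn(1)] K(2)[OF D(2) Vn(2)] by simp
        also have "\<dots> \<le> 4 * K * (1 + (norm (A (X1 r \<omega>)))\<^sup>2 + (norm (A (X2 r \<omega>)))\<^sup>2)"
          using K(1) by (simp add: algebra_simps)
        finally have "ennreal ((norm (bd \<omega> r))\<^sup>2) \<le> ennreal (4 * K * (1 + (norm (A (X1 r \<omega>)))\<^sup>2 + (norm (A (X2 r \<omega>)))\<^sup>2))"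
          by (rule ennreal_leI)
        also have "\<dots> = ennreal (4 * K) * ennreal (1 + (norm (A (X1 r \<omega>)))\<^sup>2 + (norm (A (X2 r \<omega>)))\<^sup>2)"
          by (intro ennreal_mult'') simp
        also have "ennreal (1 + (norm (A (X1 r \<omega>)))\<^sup>2 + (norm (A (X2 r \<omega>)))\<^sup>2) = \<alpha> r \<omega>"
          using tau by (simp add: \<alpha>_def Asq_D[OF D(1)] Asq_D[OF D(2)] ennreal_plus)
        finally show "- 2 * (W r \<omega> \<bullet> bd \<omega> r) \<le> C * (norm (W r \<omega>))\<^sup>2 \<and> ennreal ((norm (bd \<omega> r))\<^sup>2) \<le> ennreal (4 * K) * \<alpha> r \<omega>"
          using 1 by blast
      qed
    qed
  qed
  moreover have "0 < 4 * K" using K(1) by simp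
  ultimately show ?thesis using C(1) by blast
qed

end

section \<open>The energy estimate\<close>

lemma ennreal_numeral_mult:
  "0 \<le> a \<Longrightarrow> 0 \<le> b \<Longrightarrow> ennreal (numeral k * a * b) = numeral k * ennreal a * ennreal b"
  "0 \<le> a \<Longrightarrow> ennreal (numeral k * a) = numeral k * ennreal a"
  by (simp_all add: ennreal_mult)

lemma ennreal_add_le: "0 \<le> a \<Longrightarrow> ennreal (a + b) \<le> ennreal a + ennreal b"
  by (cases "0 \<le> b") (auto simp: ennreal_plus ennreal_neg intro: ennreal_leI)

lemma mult_indicator_mono:
  fixes f g :: "'a \<Rightarrow> ennreal"
  assumes "r \<in> I \<Longrightarrow> f r \<le> g r" shows "f r * indicator I r \<le> g r * indicator I r"
  using assms by (cases "r \<in> I") auto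

section \<open>Fubini, integrable majorants and the localised energy\<close>

context solution_pair
begin

lemma section_measurable:
  fixes h :: "real \<Rightarrow> 'w \<Rightarrow> ennreal"
  assumes m: "(\<lambda>(\<omega>, r). h r \<omega>) \<in> borel_measurable (M \<Otimes>\<^sub>M borel)"
  shows "h r \<in> borel_measurable M" "\<omega> \<in> space M \<Longrightarrow> (\<lambda>r. h r \<omega>) \<in> borel_measurable borel"
    "(\<lambda>r. \<integral>\<^sup>+\<omega>. h r \<omega> \<partial>M) \<in> borel_measurable borel"
    "(\<lambda>\<omega>. \<integral>\<^sup>+r\<in>{s<..t}. h r \<omega> \<partial>lborel) \<in> borel_measurable M"
proof -
  show "h r \<in> borel_measurable M"
    using measurable_compose[OF measurable_Pair2'[of r borel M] m] by simp
  show "\<omega> \<in> space M \<Longrightarrow> (\<lambda>r. h r \<omega>) \<in> borel_measurable borel"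
    using measurable_compose[OF measurable_Pair1'[of \<omega> M borel] m] by simp
  have "(\<lambda>(r, \<omega>). h r \<omega>) \<in> borel_measurable (borel \<Otimes>\<^sub>M M)"
    using measurable_compose[OF measurable_pair_swap' m] by (simp add: case_prod_beta)
  then show "(\<lambda>r. \<integral>\<^sup>+\<omega>. h r \<omega> \<partial>M) \<in> borel_measurable borel"
    by (rule borel_measurable_nn_integral)
  have "(\<lambda>z. (case z of (\<omega>, r) \<Rightarrow> h r \<omega>) * indicator {s<..t} (snd z)) \<in> borel_measurable (M \<Otimes>\<^sub>M lborel)"
    using m by measurable
  then show "(\<lambda>\<omega>. \<integral>\<^sup>+r\<in>{s<..t}. h r \<omega> \<partial>lborel) \<in> borel_measurable M"
    by (intro lborel.borel_measurable_nn_integral) (simp add: case_prod_beta)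
qed

lemma time_fubini:
  fixes h :: "real \<Rightarrow> 'w \<Rightarrow> ennreal"
  assumes m: "(\<lambda>(\<omega>, r). h r \<omega>) \<in> borel_measurable (M \<Otimes>\<^sub>M borel)"
  shows "(\<integral>\<^sup>+\<omega>. (\<integral>\<^sup>+r\<in>{s<..t}. h r \<omega> \<partial>lborel) \<partial>M) = (\<integral>\<^sup>+r\<in>{s<..t}. (\<integral>\<^sup>+\<omega>. h r \<omega> \<partial>M) \<partial>lborel)"
proof -
  interpret P: pair_sigma_finite M lborel ..
  have "(\<lambda>z. (case z of (\<omega>, r) \<Rightarrow> h r \<omega>) * indicator {s<..t} (snd z)) \<in> borel_measurable (M \<Otimes>\<^sub>M lborel)"
    using m by measurable
  from P.Fubini[OF this]
  have "(\<integral>\<^sup>+\<omega>. (\<integral>\<^sup>+r\<in>{s<..t}. h r \<omega> \<partial>lborel) \<partial>M) = (\<integral>\<^sup>+r. (\<integral>\<^sup>+\<omega>. h r \<omega> * indicator {s<..t} r \<partial>M) \<partial>lborel)"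
    by simp
  also have "\<dots> = (\<integral>\<^sup>+r\<in>{s<..t}. (\<integral>\<^sup>+\<omega>. h r \<omega> \<partial>M) \<partial>lborel)"
    by (intro nn_integral_cong nn_integral_multc section_measurable(1)[OF m])
  finally show ?thesis .
qed

lemma sup_bound:
  assumes "0 \<le> T"
  shows "\<exists>S. S \<in> borel_measurable M \<and> (\<integral>\<^sup>+\<omega>. S \<omega> \<partial>M) < \<top> \<and>
    (AE \<omega> in M. \<forall>t\<in>{0..T}. ennreal ((norm (W t \<omega>))\<^sup>2) \<le> S \<omega>)"
proof -
  obtain S1 where S1 [measurable]: "S1 \<in> borel_measurable M" and "(\<integral>\<^sup>+\<omega>. S1 \<omega> \<partial>M) < \<top>"
    and b1: "AE \<omega> in M. \<forall>t\<in>{0..T}. ennreal ((norm (X1 t \<omega>))\<^sup>2) \<le> S1 \<omega>" using s1.X_sup_bound[OF assms] by blast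
  moreover obtain S2 where S2 [measurable]: "S2 \<in> borel_measurable M" and "(\<integral>\<^sup>+\<omega>. S2 \<omega> \<partial>M) < \<top>"
    and b2: "AE \<omega> in M. \<forall>t\<in>{0..T}. ennreal ((norm (X2 t \<omega>))\<^sup>2) \<le> S2 \<omega>" using s2.X_sup_bound[OF assms] by blast
  ultimately have "(\<integral>\<^sup>+\<omega>. (2 * S1 \<omega> + 2 * S2 \<omega>) \<partial>M) < \<top>"
    by (simp add: nn_integral_add nn_integral_cmult ennreal_mult_less_top)
  moreover have "AE \<omega> in M. \<forall>t\<in>{0..T}. ennreal ((norm (W t \<omega>))\<^sup>2) \<le> 2 * S1 \<omega> + 2 * S2 \<omega>"
    using b1 b2
  proof eventually_elim
    case (elim \<omega>)
    show ?case
    proof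
      fix t assume t: "t \<in> {0..T}"
      have "ennreal ((norm (W t \<omega>))\<^sup>2) \<le> 2 * ennreal ((norm (X1 t \<omega>))\<^sup>2) + 2 * ennreal ((norm (X2 t \<omega>))\<^sup>2)"
        using ennreal_norm_add_sq_le[of "X1 t \<omega>" "- X2 t \<omega>"] by (simp add: W_def)
      also have "\<dots> \<le> 2 * S1 \<omega> + 2 * S2 \<omega>" using elim t by (intro add_mono mult_left_mono) auto
      finally show "ennreal ((norm (W t \<omega>))\<^sup>2) \<le> 2 * S1 \<omega> + 2 * S2 \<omega>" .
    qed
  qed
  ultimately show ?thesis by (intro exI[of _ "\<lambda>\<omega>. 2 * S1 \<omega> + 2 * S2 \<omega>"]) auto
qed

lemma alpha_finite:
  assumes "0 \<le> T"
  shows "(\<integral>\<^sup>+r\<in>{0<..T}. (\<integral>\<^sup>+\<omega>. \<alpha> r \<omega> \<partial>M) \<partial>lborel) < \<top>"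
proof -
  let ?a1 = "\<lambda>r \<omega>. if ennreal r \<le> \<tau> \<omega> then Asq (X1 r \<omega>) else 0"
  let ?a2 = "\<lambda>r \<omega>. if ennreal r \<le> \<tau> \<omega> then Asq (X2 r \<omega>) else 0"
  note m1 = section_measurable[OF s1.Asq_joint] and m2 = section_measurable[OF s2.Asq_joint]
  have "(\<integral>\<^sup>+\<omega>. \<alpha> r \<omega> \<partial>M) = 1 + (\<integral>\<^sup>+\<omega>. ?a1 r \<omega> \<partial>M) + (\<integral>\<^sup>+\<omega>. ?a2 r \<omega> \<partial>M)" for r
    unfolding \<alpha>_def using m1(1)[of r] m2(1)[of r] by (simp add: nn_integral_add emeasure_space_1)
  then have "(\<integral>\<^sup>+r\<in>{0<..T}. (\<integral>\<^sup>+\<omega>. \<alpha> r \<omega> \<partial>M) \<partial>lborel) =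
    (\<integral>\<^sup>+r. (indicator {0<..T} r + (\<integral>\<^sup>+\<omega>. ?a1 r \<omega> \<partial>M) * indicator {0<..T} r + (\<integral>\<^sup>+\<omega>. ?a2 r \<omega> \<partial>M) * indicator {0<..T} r) \<partial>lborel)"
    by (intro nn_integral_cong) (auto simp: indicator_def)
  also have "\<dots> = ennreal T + (\<integral>\<^sup>+r\<in>{0<..T}. (\<integral>\<^sup>+\<omega>. ?a1 r \<omega> \<partial>M) \<partial>lborel) + (\<integral>\<^sup>+r\<in>{0<..T}. (\<integral>\<^sup>+\<omega>. ?a2 r \<omega> \<partial>M) \<partial>lborel)"
    using assms m1(3) m2(3) by (simp add: nn_integral_add)
  also have "\<dots> < \<top>"
    using s1.Asq_finite[OF assms] s2.Asq_finite[OF assms]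
    unfolding time_fubini[OF s1.Asq_joint] time_fubini[OF s2.Asq_joint] by simp
  finally show ?thesis .
qed

definition en :: "real \<Rightarrow> real \<Rightarrow> 'w \<Rightarrow> ennreal" where
  "en n r \<omega> = (if good n r \<omega> then ennreal ((norm (x r \<omega>))\<^sup>2) else 0)"

definition energy :: "real \<Rightarrow> real \<Rightarrow> ennreal" where
  "energy n r = (\<integral>\<^sup>+\<omega>. en n r \<omega> \<partial>M)"

lemma en_joint [measurable]: "(\<lambda>(\<omega>, r). en n r \<omega>) \<in> borel_measurable (M \<Otimes>\<^sub>M borel)"
proof -
  have "(\<lambda>z. if good n (snd z) (fst z) then ennreal ((norm (case z of (\<omega>, r) \<Rightarrow> x r \<omega>))\<^sup>2) else 0) \<in> borel_measurable (M \<Otimes>\<^sub>M borel)"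
    by measurable
  then show ?thesis by (simp add: en_def case_prod_beta)
qed

lemma energy_measurable [measurable]: "energy n \<in> borel_measurable borel"
  using section_measurable(3)[OF en_joint] by (simp add: energy_def[abs_def])

lemma energy_eq_mean_sq: "energy n r = mean_sq M (\<lambda>\<omega>. indicator (G n r) \<omega> *\<^sub>R x r \<omega>)"
  unfolding energy_def mean_sq_def by (intro nn_integral_cong) (auto simp: en_def G_def)

lemma energy_zero: "energy n 0 = 0"
  by (simp add: energy_def en_def x_def cong: if_cong)

lemma mean_sq_orthogonal_sum:
  fixes Y Z :: "'w \<Rightarrow> 'h"
  assumes [measurable]: "Y \<in> borel_measurable M" "Z \<in> borel_measurable M"
    and fin: "mean_sq M Y < \<top>" "mean_sq M Z < \<top>" and orth: "expectation (\<lambda>\<omega>. Y \<omega> \<bullet> Z \<omega>) = 0"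
  shows "mean_sq M (\<lambda>\<omega>. Y \<omega> + Z \<omega>) = mean_sq M Y + mean_sq M Z"
proof -
  have i: "integrable M (\<lambda>\<omega>. (norm (Y \<omega>))\<^sup>2)" "integrable M (\<lambda>\<omega>. (norm (Z \<omega>))\<^sup>2)" "integrable M (\<lambda>\<omega>. Y \<omega> \<bullet> Z \<omega>)"
    using fin mean_sq_finite_integrable[of Y M] mean_sq_finite_integrable[of Z M] mean_sq_inner_integrable[of Y M Z] by auto
  have eq: "(norm (Y \<omega> + Z \<omega>))\<^sup>2 = (norm (Y \<omega>))\<^sup>2 + (norm (Z \<omega>))\<^sup>2 + 2 * (Y \<omega> \<bullet> Z \<omega>)" for \<omega>
    unfolding power2_norm_eq_inner by (simp add: inner_add_left inner_add_right inner_commute)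
  have "integrable M (\<lambda>\<omega>. (norm (Y \<omega> + Z \<omega>))\<^sup>2)" unfolding eq using i by simp
  then have "mean_sq M (\<lambda>\<omega>. Y \<omega> + Z \<omega>) = ennreal (expectation (\<lambda>\<omega>. (norm (Y \<omega> + Z \<omega>))\<^sup>2))"
    unfolding mean_sq_def by (rule nn_integral_eq_integral) simp
  also have "expectation (\<lambda>\<omega>. (norm (Y \<omega> + Z \<omega>))\<^sup>2) = expectation (\<lambda>\<omega>. (norm (Y \<omega>))\<^sup>2) + expectation (\<lambda>\<omega>. (norm (Z \<omega>))\<^sup>2)"
    unfolding eq using i orth by simp
  also have "ennreal \<dots> = ennreal (expectation (\<lambda>\<omega>. (norm (Y \<omega>))\<^sup>2)) + ennreal (expectation (\<lambda>\<omega>. (norm (Z \<omega>))\<^sup>2))"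
    by (intro ennreal_plus) simp_all
  also have "\<dots> = mean_sq M Y + mean_sq M Z"
    unfolding mean_sq_def using nn_integral_eq_integral[OF i(1)] nn_integral_eq_integral[OF i(2)] by simp
  finally show ?thesis .
qed

end

text \<open>Radius, time horizon and constants are frozen here so that every estimate is uniform
  over the grid; \<open>N\<close> is one fixed choice of the integrals of the noise
  difference.\<close>

locale energy_estimate = solution_pair M F \<beta> D A e lam d B R g \<Phi>0 \<Phi>1 \<Phi>2 \<tau>
  for M :: "'w measure" and F \<beta> and D :: "'h::{real_inner, banach, second_countable_topology} set" and A e lam
    and d B R g \<Phi>0 \<Phi>1 \<Phi>2 \<tau> +
  fixes n T L C K :: real and S :: "'w \<Rightarrow> ennreal" and N :: "real \<Rightarrow> 'w \<Rightarrow> 'h"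
  assumes n: "0 \<le> n" and L: "0 \<le> L" and C: "0 < C" and K: "0 < K"
    and S_meas [measurable]: "S \<in> borel_measurable M" and S_fin: "(\<integral>\<^sup>+\<omega>. S \<omega> \<partial>M) < \<top>"
    and S_bound: "AE \<omega> in M. \<forall>t\<in>{0..T}. ennreal ((norm (W t \<omega>))\<^sup>2) \<le> S \<omega>"
    and noise_le: "\<And>m r \<omega>. \<omega> \<in> space M \<Longrightarrow> 0 \<le> r \<Longrightarrow>
      ennreal (\<Sum>j<m. (norm (noise j r \<omega>))\<^sup>2) \<le> (if ennreal r \<le> \<tau> \<omega> then ennreal (L * (norm (W r \<omega>))\<^sup>2) else 0)"
    and N_process: "\<And>t. 0 \<le> t \<Longrightarrow> ito_process noise t (N t)"
    and N_increment: "\<And>s t. 0 \<le> s \<Longrightarrow> s < t \<Longrightarrow> AE \<omega> in M. ennreal t \<le> \<tau> \<omega> \<longrightarrow>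
      set_integrable lebesgue {s<..t} (bd \<omega>) \<and>
      x t \<omega> - x s \<omega> = N t \<omega> - N s \<omega> - (LINT r:{s<..t}|lebesgue. bd \<omega> r)"
    and drift_bounds: "AE \<omega> in M. \<forall>t. good n t \<omega> \<longrightarrow> (AE r in lborel. r \<in> {0<..t} \<longrightarrow>
      - 2 * (W r \<omega> \<bullet> bd \<omega> r) \<le> C * (norm (W r \<omega>))\<^sup>2 \<and> ennreal ((norm (bd \<omega> r))\<^sup>2) \<le> ennreal K * \<alpha> r \<omega>)"
begin

abbreviation "ES \<equiv> \<integral>\<^sup>+\<omega>. S \<omega> \<partial>M"
abbreviation "E\<alpha> r \<equiv> \<integral>\<^sup>+\<omega>. \<alpha> r \<omega> \<partial>M"

lemma N_measurable: "0 \<le> t \<Longrightarrow> N t \<in> borel_measurable M"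
  using N_process by (simp add: ito_process_def)

lemma x_sq_le: "AE \<omega> in M. \<forall>t\<in>{0..T}. ennreal ((norm (x t \<omega>))\<^sup>2) \<le> S \<omega>"
  using S_bound by eventually_elim (auto simp: x_def)

lemma energy_le: "0 \<le> t \<Longrightarrow> t \<le> T \<Longrightarrow> energy n t \<le> ES"
  unfolding energy_def by (intro nn_integral_mono_AE) (use x_sq_le in eventually_elim, auto simp: en_def)

text \<open>The localised isometry leads to the time integral of \<open>L |W(r)|^2\<close> over
  \<open>G n s\<close>. Where \<open>r\<close> is still good, the integrand is a multiple of the
  energy density; otherwise the path belongs to \<open>G n s - G n t\<close> and \<open>S\<close>
  bounds it. The cruder second estimate uses \<open>S\<close> everywhere; it serves for finiteness
  and for the oscillation.\<close>

lemma noise_increment_le: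
  assumes st: "0 \<le> s" "s < t" "t \<le> T"
  shows "mean_sq M (\<lambda>\<omega>. indicator (G n s) \<omega> *\<^sub>R (N t \<omega> - N s \<omega>)) \<le>
      ennreal (8 * L) * (\<integral>\<^sup>+r\<in>{s<..t}. energy n r \<partial>lborel) +
      ennreal (8 * L * (t - s)) * (\<integral>\<^sup>+\<omega>. S \<omega> * indicator (G n s - G n t) \<omega> \<partial>M)"
    and "mean_sq M (\<lambda>\<omega>. indicator (G n s) \<omega> *\<^sub>R (N t \<omega> - N s \<omega>)) \<le> ennreal (8 * L * (t - s)) * ES"
proof -
  let ?b = "\<lambda>r \<omega>. if ennreal r \<le> \<tau> \<omega> then ennreal (L * (norm (W r \<omega>))\<^sup>2) else 0"
  let ?h = "t - s"
  have hh: "0 \<le> ?h" using st by simp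
  have "mean_sq M (\<lambda>\<omega>. indicator (G n s) \<omega> *\<^sub>R (N t \<omega> - N s \<omega>)) \<le> 8 * (\<integral>\<^sup>+\<omega>\<in>G n s. (\<integral>\<^sup>+r\<in>{s<..t}. ?b r \<omega> \<partial>lborel) \<partial>M)"
    by (rule ito_process_increment(1)[OF N_process N_process _ _ G_adapted]) (use st noise_le in auto)
  note base = this
  have bLS: "AE \<omega> in M. \<forall>r\<in>{s<..t}. ?b r \<omega> \<le> ennreal L * S \<omega>"
    using S_bound
  proof eventually_elim
    case (elim \<omega>)
    show ?case
    proof
      fix r assume "r \<in> {s<..t}"
      then have "ennreal ((norm (W r \<omega>))\<^sup>2) \<le> S \<omega>" using elim st by auto
      then have "ennreal L * ennreal ((norm (W r \<omega>))\<^sup>2) \<le> ennreal L * S \<omega>" by (rule mult_left_mono) simp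
      then show "?b r \<omega> \<le> ennreal L * S \<omega>" using L by (simp add: ennreal_mult)
    qed
  qed
  have const: "(\<integral>\<^sup>+r\<in>{s<..t}. c \<partial>lborel) = c * ennreal ?h" for c :: ennreal
    using st by (simp add: nn_integral_cmult_indicator)
  have "(\<integral>\<^sup>+\<omega>\<in>G n s. (\<integral>\<^sup>+r\<in>{s<..t}. ?b r \<omega> \<partial>lborel) \<partial>M) \<le> (\<integral>\<^sup>+\<omega>. ennreal L * ennreal ?h * S \<omega> \<partial>M)"
  proof (rule nn_integral_mono_AE, use bLS in eventually_elim)
    fix \<omega> assume b: "\<forall>r\<in>{s<..t}. ?b r \<omega> \<le> ennreal L * S \<omega>"
    have "(\<integral>\<^sup>+r\<in>{s<..t}. ?b r \<omega> \<partial>lborel) \<le> (\<integral>\<^sup>+r\<in>{s<..t}. ennreal L * S \<omega> \<partial>lborel)"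
      by (intro nn_integral_mono mult_indicator_mono bspec[OF b])
    also have "\<dots> = ennreal L * ennreal ?h * S \<omega>" unfolding const by (simp only: mult_ac)
    finally show "(\<integral>\<^sup>+r\<in>{s<..t}. ?b r \<omega> \<partial>lborel) * indicator (G n s) \<omega> \<le> ennreal L * ennreal ?h * S \<omega>"
      by (auto simp: indicator_def)
  qed
  also have "\<dots> = ennreal L * ennreal ?h * ES" by (simp add: nn_integral_cmult)
  finally have "mean_sq M (\<lambda>\<omega>. indicator (G n s) \<omega> *\<^sub>R (N t \<omega> - N s \<omega>)) \<le> 8 * (ennreal L * ennreal ?h * ES)"
    using base by (meson mult_left_mono order_trans zero_le)
  then show "mean_sq M (\<lambda>\<omega>. indicator (G n s) \<omega> *\<^sub>R (N t \<omega> - N s \<omega>)) \<le> ennreal (8 * L * ?h) * ES"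
    unfolding ennreal_numeral_mult(1)[OF L hh] by (simp only: mult.assoc)
  let ?d = "\<lambda>\<omega>. S \<omega> * indicator (G n s - G n t) \<omega>"
  have "(\<integral>\<^sup>+\<omega>\<in>G n s. (\<integral>\<^sup>+r\<in>{s<..t}. ?b r \<omega> \<partial>lborel) \<partial>M) \<le>
    (\<integral>\<^sup>+\<omega>. ennreal L * (\<integral>\<^sup>+r\<in>{s<..t}. en n r \<omega> \<partial>lborel) + ennreal L * ennreal ?h * ?d \<omega> \<partial>M)"
  proof (rule nn_integral_mono_AE, use AE_space bLS in eventually_elim)
    fix \<omega> assume \<omega>: "\<omega> \<in> space M" and b: "\<forall>r\<in>{s<..t}. ?b r \<omega> \<le> ennreal L * S \<omega>"
    have m: "(\<lambda>r. en n r \<omega>) \<in> borel_measurable borel" by (rule section_measurable(2)[OF en_joint \<omega>])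
    show "(\<integral>\<^sup>+r\<in>{s<..t}. ?b r \<omega> \<partial>lborel) * indicator (G n s) \<omega> \<le>
      ennreal L * (\<integral>\<^sup>+r\<in>{s<..t}. en n r \<omega> \<partial>lborel) + ennreal L * ennreal ?h * ?d \<omega>"
    proof (cases "\<omega> \<in> G n s")
      case gs: True
      have bb: "?b r \<omega> \<le> ennreal L * en n r \<omega> + ennreal L * ?d \<omega>" if r: "r \<in> {s<..t}" for r
      proof (cases "good n r \<omega>")
        case True
        then have "?b r \<omega> = ennreal L * en n r \<omega>"
          using r st L by (auto simp: en_def good_def x_def ennreal_mult)
        then show ?thesis by simp
      next
        case False
        then have "\<omega> \<notin> G n t" using r good_mono[of n t \<omega> r] by (auto simp: G_def)
        then have d: "?d \<omega> = S \<omega>" using gs by simp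
        show ?thesis unfolding d by (rule add_increasing[OF zero_le bspec[OF b r]])
      qed
      have "(\<integral>\<^sup>+r\<in>{s<..t}. ?b r \<omega> \<partial>lborel) \<le>
        (\<integral>\<^sup>+r. ennreal L * (en n r \<omega> * indicator {s<..t} r) + ennreal L * ?d \<omega> * indicator {s<..t} r \<partial>lborel)"
      proof (intro nn_integral_mono)
        fix r
        have "?b r \<omega> * indicator {s<..t} r \<le> (ennreal L * en n r \<omega> + ennreal L * ?d \<omega>) * indicator {s<..t} r"
          by (rule mult_indicator_mono) (rule bb)
        also have "\<dots> = ennreal L * (en n r \<omega> * indicator {s<..t} r) + ennreal L * ?d \<omega> * indicator {s<..t} r"
          by (simp only: distrib_right mult.assoc)
        finally show "?b r \<omega> * indicator {s<..t} r \<le>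
          ennreal L * (en n r \<omega> * indicator {s<..t} r) + ennreal L * ?d \<omega> * indicator {s<..t} r" .
      qed
      also have "\<dots> = ennreal L * (\<integral>\<^sup>+r\<in>{s<..t}. en n r \<omega> \<partial>lborel) + ennreal L * ?d \<omega> * ennreal ?h"
        using m st by (simp add: nn_integral_add nn_integral_cmult nn_integral_cmult_indicator)
      finally show ?thesis using gs by (simp add: mult_ac)
    qed simp
  qed
  also have "\<dots> = ennreal L * (\<integral>\<^sup>+\<omega>. (\<integral>\<^sup>+r\<in>{s<..t}. en n r \<omega> \<partial>lborel) \<partial>M) + ennreal L * ennreal ?h * (\<integral>\<^sup>+\<omega>. ?d \<omega> \<partial>M)"
    using section_measurable(4)[OF en_joint] by (simp add: nn_integral_add nn_integral_cmult)
  also have "(\<integral>\<^sup>+\<omega>. (\<integral>\<^sup>+r\<in>{s<..t}. en n r \<omega> \<partial>lborel) \<partial>M) = (\<integral>\<^sup>+r\<in>{s<..t}. energy n r \<partial>lborel)"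
    unfolding energy_def by (rule time_fubini[OF en_joint])
  finally have "mean_sq M (\<lambda>\<omega>. indicator (G n s) \<omega> *\<^sub>R (N t \<omega> - N s \<omega>)) \<le>
    8 * (ennreal L * (\<integral>\<^sup>+r\<in>{s<..t}. energy n r \<partial>lborel) + ennreal L * ennreal ?h * (\<integral>\<^sup>+\<omega>. ?d \<omega> \<partial>M))"
    using base by (meson mult_left_mono order_trans zero_le)
  then show "mean_sq M (\<lambda>\<omega>. indicator (G n s) \<omega> *\<^sub>R (N t \<omega> - N s \<omega>)) \<le>
      ennreal (8 * L) * (\<integral>\<^sup>+r\<in>{s<..t}. energy n r \<partial>lborel) + ennreal (8 * L * ?h) * (\<integral>\<^sup>+\<omega>. ?d \<omega> \<partial>M)"
    unfolding ennreal_numeral_mult(1)[OF L hh] ennreal_numeral_mult(2)[OF L] by (simp only: distrib_left mult.assoc)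
qed

text \<open>Pythagoras in mean square: the localised \<open>x s\<close> is known at time
  \<open>s\<close>, hence orthogonal to the noise increment. The crude noise bound and
  \<open>ES\<close> supply the finiteness of both terms.\<close>

lemma martingale_step:
  assumes st: "0 \<le> s" "s < t" "t \<le> T"
  shows "mean_sq M (\<lambda>\<omega>. indicator (G n s) \<omega> *\<^sub>R (x s \<omega> + (N t \<omega> - N s \<omega>))) =
    energy n s + mean_sq M (\<lambda>\<omega>. indicator (G n s) \<omega> *\<^sub>R (N t \<omega> - N s \<omega>))"
proof -
  let ?Y = "\<lambda>\<omega>. indicator (G n s) \<omega> *\<^sub>R x s \<omega>" and ?Z = "\<lambda>\<omega>. indicator (G n s) \<omega> *\<^sub>R (N t \<omega> - N s \<omega>)"
  have Y: "?Y \<in> borel_measurable (F (ennreal s))"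
    using st by (intro borel_measurable_scaleR borel_measurable_indicator G_adapted x_adapted) auto
  have Yf: "mean_sq M ?Y < \<top>"
    using energy_le[of s] S_fin st unfolding energy_eq_mean_sq by (auto intro: le_less_trans)
  have "mean_sq M ?Z \<le> ennreal (8 * L * (t - s)) * ES" by (rule noise_increment_le(2)[OF st])
  also have "\<dots> < \<top>" using S_fin by (simp add: ennreal_mult_less_top)
  finally have Zf: "mean_sq M ?Z < \<top>" .
  have "expectation (\<lambda>\<omega>. ?Y \<omega> \<bullet> (N t \<omega> - N s \<omega>)) = 0"
    using ito_process_increment(2)[OF N_process N_process _ _ G_adapted noise_le Y Yf] st by auto
  also have "(\<lambda>\<omega>. ?Y \<omega> \<bullet> (N t \<omega> - N s \<omega>)) = (\<lambda>\<omega>. ?Y \<omega> \<bullet> ?Z \<omega>)"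
    by (auto simp: fun_eq_iff indicator_def)
  finally have "mean_sq M (\<lambda>\<omega>. ?Y \<omega> + ?Z \<omega>) = mean_sq M ?Y + mean_sq M ?Z"
    using Yf Zf st N_measurable by (intro mean_sq_orthogonal_sum) auto
  then show ?thesis by (simp add: energy_eq_mean_sq scaleR_add_right)
qed

text \<open>Noise and drift from \<open>r\<close> to \<open>t\<close> both have mean square of order
  \<open>t - s\<close>. For the noise, \<open>G n t\<close> is enlarged to \<open>G n r\<close>, an
  event known at the starting time, as the isometry requires; for the drift, Cauchy-Schwarz in time
  and the growth bound apply. The factors 16 and 2 arise from splitting the square of the
  sum.\<close>

lemma oscillation_le:
  assumes st: "0 \<le> s" "s < r" "r \<le> t" "t \<le> T"
  shows "(\<integral>\<^sup>+\<omega>. indicator (G n t) \<omega> * ennreal ((norm (W r \<omega> - W t \<omega>))\<^sup>2) \<partial>M) \<le>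
    ennreal (16 * L * (t - s)) * ES + ennreal (2 * K * (t - s)) * (\<integral>\<^sup>+u\<in>{s<..t}. E\<alpha> u \<partial>lborel)"
proof (cases "r = t")
  case False
  then have rt: "0 \<le> r" "r < t" "t \<le> T" using st by auto
  let ?a = "\<lambda>\<omega>. \<integral>\<^sup>+u\<in>{s<..t}. \<alpha> u \<omega> \<partial>lborel"
  let ?Z = "\<lambda>\<omega>. indicator (G n r) \<omega> *\<^sub>R (N t \<omega> - N r \<omega>)"
  have ma: "?a \<in> borel_measurable M" by (rule section_measurable(4)[OF alpha_joint])
  have mZ: "?Z \<in> borel_measurable M" using rt N_measurable by auto
  have "(\<integral>\<^sup>+\<omega>. indicator (G n t) \<omega> * ennreal ((norm (W r \<omega> - W t \<omega>))\<^sup>2) \<partial>M) \<le>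
    (\<integral>\<^sup>+\<omega>. 2 * ennreal ((norm (?Z \<omega>))\<^sup>2) + ennreal (2 * K * (t - s)) * ?a \<omega> \<partial>M)"
  proof (rule nn_integral_mono_AE, use AE_space N_increment[OF rt(1,2)] drift_bounds in eventually_elim)
    fix \<omega> assume \<omega>: "\<omega> \<in> space M"
      and inc: "ennreal t \<le> \<tau> \<omega> \<longrightarrow> set_integrable lebesgue {r<..t} (bd \<omega>) \<and>
        x t \<omega> - x r \<omega> = N t \<omega> - N r \<omega> - (LINT u:{r<..t}|lebesgue. bd \<omega> u)"
      and db: "\<forall>t. good n t \<omega> \<longrightarrow> (AE r in lborel. r \<in> {0<..t} \<longrightarrow>
        - 2 * (W r \<omega> \<bullet> bd \<omega> r) \<le> C * (norm (W r \<omega>))\<^sup>2 \<and> ennreal ((norm (bd \<omega> r))\<^sup>2) \<le> ennreal K * \<alpha> r \<omega>)"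
    show "indicator (G n t) \<omega> * ennreal ((norm (W r \<omega> - W t \<omega>))\<^sup>2) \<le>
      2 * ennreal ((norm (?Z \<omega>))\<^sup>2) + ennreal (2 * K * (t - s)) * ?a \<omega>"
    proof (cases "\<omega> \<in> G n t")
      case True
      then have g: "good n t \<omega>" "\<omega> \<in> G n r" using G_mono[of r t n] rt by (auto simp: G_def)
      then have tau: "ennreal t \<le> \<tau> \<omega>" by (simp add: good_def)
      let ?v = "LINT u:{r<..t}|lebesgue. bd \<omega> u"
      have m\<alpha>: "(\<lambda>r. \<alpha> r \<omega>) \<in> borel_measurable borel" by (rule section_measurable(2)[OF alpha_joint \<omega>])
      have int: "set_integrable lebesgue {r<..t} (bd \<omega>)" using inc tau by blast
      have AEdb: "AE r in lborel. r \<in> {0<..t} \<longrightarrow>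
        - 2 * (W r \<omega> \<bullet> bd \<omega> r) \<le> C * (norm (W r \<omega>))\<^sup>2 \<and> ennreal ((norm (bd \<omega> r))\<^sup>2) \<le> ennreal K * \<alpha> r \<omega>"
        using db g(1) by blast
      have "ennreal ((norm ?v)\<^sup>2) \<le> ennreal (t - r) * (\<integral>\<^sup>+u\<in>{r<..t}. ennreal K * \<alpha> u \<omega> \<partial>lborel)"
      proof (rule set_integral_norm_sq_le[OF int rt(2)])
        show "(\<lambda>u. ennreal K * \<alpha> u \<omega>) \<in> borel_measurable borel" using m\<alpha> by simp
        show "AE u in lborel. u \<in> {r<..t} \<longrightarrow> ennreal ((norm (bd \<omega> u))\<^sup>2) \<le> ennreal K * \<alpha> u \<omega>"
          using AEdb by eventually_elim (use rt in auto)
      qed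
      also have "\<dots> \<le> ennreal (t - s) * (\<integral>\<^sup>+u. ennreal K * (\<alpha> u \<omega> * indicator {s<..t} u) \<partial>lborel)"
      proof (rule mult_mono)
        show "ennreal (t - r) \<le> ennreal (t - s)" using st by (intro ennreal_leI) auto
        show "(\<integral>\<^sup>+u\<in>{r<..t}. ennreal K * \<alpha> u \<omega> \<partial>lborel) \<le> (\<integral>\<^sup>+u. ennreal K * (\<alpha> u \<omega> * indicator {s<..t} u) \<partial>lborel)"
          using st by (intro nn_integral_mono) (auto simp: indicator_def)
      qed auto
      also have "\<dots> = ennreal (K * (t - s)) * ?a \<omega>"
        using m\<alpha> K st by (simp add: nn_integral_cmult ennreal_mult mult_ac)
      finally have v: "ennreal ((norm ?v)\<^sup>2) \<le> ennreal (K * (t - s)) * ?a \<omega>" .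
      have "W r \<omega> - W t \<omega> = - (N t \<omega> - N r \<omega>) + ?v"
        using inc tau st rt by (simp add: x_def algebra_simps)
      then have "ennreal ((norm (W r \<omega> - W t \<omega>))\<^sup>2) \<le> 2 * ennreal ((norm (N t \<omega> - N r \<omega>))\<^sup>2) + 2 * ennreal ((norm ?v)\<^sup>2)"
        using ennreal_norm_add_sq_le[of "- (N t \<omega> - N r \<omega>)" ?v] by (simp only: norm_minus_cancel)
      also have "\<dots> \<le> 2 * ennreal ((norm (N t \<omega> - N r \<omega>))\<^sup>2) + 2 * (ennreal (K * (t - s)) * ?a \<omega>)"
        by (intro add_left_mono mult_left_mono v) simp
      also have "2 * (ennreal (K * (t - s)) * ?a \<omega>) = ennreal (2 * K * (t - s)) * ?a \<omega>"
        using ennreal_mult''[of "K * (t - s)" 2] K st by (simp add: mult.assoc)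
      finally show ?thesis using True g(2) by simp
    qed simp
  qed
  also have "\<dots> = 2 * mean_sq M ?Z + ennreal (2 * K * (t - s)) * (\<integral>\<^sup>+\<omega>. ?a \<omega> \<partial>M)"
  proof -
    have "(\<lambda>\<omega>. ennreal ((norm (?Z \<omega>))\<^sup>2)) \<in> borel_measurable M" using mZ by measurable
    then show ?thesis using ma
      by (simp only: nn_integral_add nn_integral_cmult mean_sq_def borel_measurable_times_ennreal borel_measurable_const)
  qed
  also have "\<dots> \<le> 2 * (ennreal (8 * L * (t - r)) * ES) + ennreal (2 * K * (t - s)) * (\<integral>\<^sup>+\<omega>. ?a \<omega> \<partial>M)"
    by (intro add_right_mono mult_left_mono noise_increment_le(2)[OF rt]) simp
  also have "2 * (ennreal (8 * L * (t - r)) * ES) = ennreal (16 * L * (t - r)) * ES"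
    using L rt by (simp add: ennreal_numeral_mult flip: mult.assoc)
  also have "\<dots> \<le> ennreal (16 * L * (t - s)) * ES"
    using L st by (intro mult_right_mono ennreal_leI mult_left_mono) auto
  also have "(\<integral>\<^sup>+\<omega>. ?a \<omega> \<partial>M) = (\<integral>\<^sup>+u\<in>{s<..t}. E\<alpha> u \<partial>lborel)"
    by (rule time_fubini[OF alpha_joint])
  finally show ?thesis by simp
qed simp

text \<open>With \<open>v\<close> the drift integral, \<open>x t + v = x s + (N t - N s)\<close>;
  expanding the square and dropping \<open>|v|^2\<close> leaves \<open>-2 <x t, v>\<close>. Under
  the integral, \<open>W t\<close> is split into \<open>W r\<close>, to which monotonicity applies,
  and an oscillation, which is separated from the drift by Young's inequality.\<close>

lemma pathwise_step:
  assumes st: "0 \<le> s" "s < t" "t \<le> T"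
  defines "\<delta> \<equiv> sqrt (t - s)"
  shows "AE \<omega> in M. \<omega> \<in> G n t \<longrightarrow> ennreal ((norm (x t \<omega>))\<^sup>2) \<le> ennreal ((norm (x s \<omega> + (N t \<omega> - N s \<omega>)))\<^sup>2) +
    (\<integral>\<^sup>+r\<in>{s<..t}. (ennreal C * en n r \<omega> + ennreal (1 / \<delta>) * ennreal ((norm (W r \<omega> - W t \<omega>))\<^sup>2) + ennreal (\<delta> * K) * \<alpha> r \<omega>) \<partial>lborel)"
  using N_increment[OF st(1,2)] drift_bounds
proof eventually_elim
  case (elim \<omega>)
  show ?case
  proof
    assume "\<omega> \<in> G n t"
    then have g: "good n t \<omega>" by (simp add: G_def)
    then have tau: "ennreal t \<le> \<tau> \<omega>" by (simp add: good_def)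
    have \<delta>: "0 < \<delta>" using st by (simp add: \<delta>_def)
    let ?v = "LINT u:{s<..t}|lebesgue. bd \<omega> u"
    have int: "set_integrable lebesgue {s<..t} (bd \<omega>)" and inc: "x s \<omega> + (N t \<omega> - N s \<omega>) = x t \<omega> + ?v"
      using elim(1) tau by (auto simp: algebra_simps)
    have AEdb: "AE r in lborel. r \<in> {0<..t} \<longrightarrow>
        - 2 * (W r \<omega> \<bullet> bd \<omega> r) \<le> C * (norm (W r \<omega>))\<^sup>2 \<and> ennreal ((norm (bd \<omega> r))\<^sup>2) \<le> ennreal K * \<alpha> r \<omega>"
      using elim(2) g by blast
    have xt: "x t \<omega> = W t \<omega>" using st by (simp add: x_def)
    have "(norm (x t \<omega> + ?v))\<^sup>2 = (norm (x t \<omega>))\<^sup>2 + 2 * (x t \<omega> \<bullet> ?v) + (norm ?v)\<^sup>2"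
      unfolding power2_norm_eq_inner by (simp add: inner_add_left inner_add_right inner_commute)
    then have "(norm (x t \<omega>))\<^sup>2 \<le> (norm (x t \<omega> + ?v))\<^sup>2 + (- 2 * (x t \<omega> \<bullet> ?v))"
      using zero_le_power2[of "norm ?v"] by linarith
    also have "- 2 * (x t \<omega> \<bullet> ?v) = (LINT r:{s<..t}|lebesgue. - 2 * (x t \<omega> \<bullet> bd \<omega> r))"
      unfolding set_lebesgue_integral_def
      using int integral_inner_right[of "- 2 *\<^sub>R x t \<omega>" lebesgue "\<lambda>r. indicator {s<..t} r *\<^sub>R bd \<omega> r"]
      by (simp add: set_integrable_def mult_ac)
    finally have "ennreal ((norm (x t \<omega>))\<^sup>2) \<le> ennreal ((norm (x t \<omega> + ?v))\<^sup>2) + ennreal (LINT r:{s<..t}|lebesgue. - 2 * (x t \<omega> \<bullet> bd \<omega> r))"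
      by (intro order_trans[OF ennreal_leI ennreal_add_le]) auto
    also have "ennreal (LINT r:{s<..t}|lebesgue. - 2 * (x t \<omega> \<bullet> bd \<omega> r)) \<le>
      (\<integral>\<^sup>+r\<in>{s<..t}. (ennreal C * en n r \<omega> + ennreal (1 / \<delta>) * ennreal ((norm (W r \<omega> - W t \<omega>))\<^sup>2) + ennreal (\<delta> * K) * \<alpha> r \<omega>) \<partial>lborel)"
    proof (rule set_integral_le_nn_integral, use AEdb in \<open>eventually_elim\<close>, intro impI)
      fix r assume "r \<in> {0<..t} \<longrightarrow> - 2 * (W r \<omega> \<bullet> bd \<omega> r) \<le> C * (norm (W r \<omega>))\<^sup>2 \<and> ennreal ((norm (bd \<omega> r))\<^sup>2) \<le> ennreal K * \<alpha> r \<omega>"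
        and r: "r \<in> {s<..t}"
      then have db: "- 2 * (W r \<omega> \<bullet> bd \<omega> r) \<le> C * (norm (W r \<omega>))\<^sup>2" "ennreal ((norm (bd \<omega> r))\<^sup>2) \<le> ennreal K * \<alpha> r \<omega>"
        using st by auto
      have en: "en n r \<omega> = ennreal ((norm (W r \<omega>))\<^sup>2)"
        using good_mono[OF g, of r] r st by (auto simp: en_def x_def)
      let ?d = "W r \<omega> - W t \<omega>"
      \<comment> \<open>The oscillation has mean square of order \<open>\<delta>^2\<close>; this
        weight balances it against the squared drift, so that both terms are of order
        \<open>\<delta>\<close>.\<close>
      have young: "2 * (a * b) \<le> a\<^sup>2 / \<delta> + \<delta> * b\<^sup>2" for a b :: real
      proof -
        have "0 \<le> (a - \<delta> * b)\<^sup>2 / \<delta>" using \<delta> by simp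
        also have "\<dots> = a\<^sup>2 / \<delta> + \<delta> * b\<^sup>2 - 2 * (a * b)" using \<delta> by (simp add: power2_eq_square field_simps)
        finally show ?thesis by simp
      qed
      have "- 2 * (x t \<omega> \<bullet> bd \<omega> r) = - 2 * (W r \<omega> \<bullet> bd \<omega> r) + 2 * (?d \<bullet> bd \<omega> r)"
        by (simp add: xt inner_diff_left)
      also have "\<dots> \<le> C * (norm (W r \<omega>))\<^sup>2 + ((norm ?d)\<^sup>2 / \<delta> + \<delta> * (norm (bd \<omega> r))\<^sup>2)"
        using db(1) norm_cauchy_schwarz[of ?d "bd \<omega> r"] young[of "norm ?d" "norm (bd \<omega> r)"] by linarith
      finally have "ennreal (- 2 * (x t \<omega> \<bullet> bd \<omega> r)) \<le> ennreal (C * (norm (W r \<omega>))\<^sup>2 + ((norm ?d)\<^sup>2 / \<delta> + \<delta> * (norm (bd \<omega> r))\<^sup>2))"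
        by (rule ennreal_leI)
      also have "\<dots> = ennreal C * en n r \<omega> + (ennreal (1 / \<delta>) * ennreal ((norm ?d)\<^sup>2) + ennreal \<delta> * ennreal ((norm (bd \<omega> r))\<^sup>2))"
        unfolding en using C \<delta> by (simp add: ennreal_plus flip: ennreal_mult'')
      also have "\<dots> \<le> ennreal C * en n r \<omega> + (ennreal (1 / \<delta>) * ennreal ((norm ?d)\<^sup>2) + ennreal \<delta> * (ennreal K * \<alpha> r \<omega>))"
        by (intro add_left_mono mult_left_mono db(2)) simp
      also have "\<dots> = ennreal C * en n r \<omega> + ennreal (1 / \<delta>) * ennreal ((norm ?d)\<^sup>2) + ennreal (\<delta> * K) * \<alpha> r \<omega>"
        using \<delta> K by (simp add: ennreal_mult mult.assoc add.assoc)
      finally show "ennreal (- 2 * (x t \<omega> \<bullet> bd \<omega> r)) \<le> ennreal C * en n r \<omega> + ennreal (1 / \<delta>) * ennreal ((norm ?d)\<^sup>2) + ennreal (\<delta> * K) * \<alpha> r \<omega>" .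
    qed
    finally show "ennreal ((norm (x t \<omega>))\<^sup>2) \<le> ennreal ((norm (x s \<omega> + (N t \<omega> - N s \<omega>)))\<^sup>2) +
      (\<integral>\<^sup>+r\<in>{s<..t}. (ennreal C * en n r \<omega> + ennreal (1 / \<delta>) * ennreal ((norm (W r \<omega> - W t \<omega>))\<^sup>2) + ennreal (\<delta> * K) * \<alpha> r \<omega>) \<partial>lborel)"
      unfolding inc by (simp add: add_left_mono)
  qed
qed


text \<open>The pathwise step is averaged, with the martingale step for its first term and Fubini
  for the time integral. The oscillation enters with \<open>1 / \<delta>\<close> over an interval of
  length \<open>h = \<delta>^2\<close>, which leaves a factor \<open>\<delta>\<close> in front of
  its bound.\<close>

lemma energy_step:
  assumes st: "0 \<le> s" "s < t" "t \<le> T" "t - s \<le> 1"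
  defines "p \<equiv> \<lambda>t. \<integral>\<^sup>+\<omega>. S \<omega> * indicator (G n t) \<omega> \<partial>M"
    and "q \<equiv> \<lambda>r. ennreal (16 * L) * ES + ennreal (3 * K) * E\<alpha> r"
  shows "energy n t + ennreal (8 * L * (t - s)) * p t \<le> energy n s + ennreal (8 * L * (t - s)) * p s +
    (\<integral>\<^sup>+r\<in>{s<..t}. (ennreal (C + 8 * L) * energy n r + ennreal (sqrt (t - s)) * q r) \<partial>lborel)"
proof -
  define h where "h = t - s"
  define \<delta> where "\<delta> = sqrt h"
  have h: "0 < h" "h \<le> 1" using st by (auto simp: h_def)
  have \<delta>: "0 < \<delta>" "1 / \<delta> * h = \<delta>" using h by (auto simp: \<delta>_def real_div_sqrt)
  let ?I = "\<integral>\<^sup>+r\<in>{s<..t}. energy n r \<partial>lborel"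
  let ?a = "\<integral>\<^sup>+r\<in>{s<..t}. E\<alpha> r \<partial>lborel"
  let ?pd = "\<integral>\<^sup>+\<omega>. S \<omega> * indicator (G n s - G n t) \<omega> \<partial>M"
  let ?Rb = "ennreal (16 * L * h) * ES + ennreal (2 * K * h) * ?a"
  let ?osc = "\<lambda>r \<omega>. indicator (G n t) \<omega> * ennreal ((norm (W r \<omega> - W t \<omega>))\<^sup>2)"
  let ?hh = "\<lambda>r \<omega>. ennreal C * en n r \<omega> + ennreal (1 / \<delta>) * ?osc r \<omega> + ennreal (\<delta> * K) * \<alpha> r \<omega>"
  let ?m = "\<lambda>\<omega>. ennreal ((norm (indicator (G n s) \<omega> *\<^sub>R (x s \<omega> + (N t \<omega> - N s \<omega>))))\<^sup>2)"
  have osc_joint: "(\<lambda>(\<omega>, r). ?osc r \<omega>) \<in> borel_measurable (M \<Otimes>\<^sub>M borel)"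
  proof -
    have "(\<lambda>z. indicator (G n t) (fst z) * ennreal ((norm ((case z of (\<omega>, r) \<Rightarrow> W r \<omega>) - W t (fst z)))\<^sup>2)) \<in> borel_measurable (M \<Otimes>\<^sub>M borel)"
      by measurable
    then show ?thesis by (simp add: case_prod_beta)
  qed
  have hh_joint: "(\<lambda>(\<omega>, r). ?hh r \<omega>) \<in> borel_measurable (M \<Otimes>\<^sub>M borel)"
  proof -
    have "(\<lambda>z. ennreal C * (case z of (\<omega>, r) \<Rightarrow> en n r \<omega>) + ennreal (1 / \<delta>) * (case z of (\<omega>, r) \<Rightarrow> ?osc r \<omega>) +
      ennreal (\<delta> * K) * (case z of (\<omega>, r) \<Rightarrow> \<alpha> r \<omega>)) \<in> borel_measurable (M \<Otimes>\<^sub>M borel)"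
      using osc_joint by (intro borel_measurable_add borel_measurable_times_ennreal borel_measurable_const en_joint alpha_joint)
    then show ?thesis by (simp add: case_prod_beta)
  qed
  note en_s = section_measurable[OF en_joint] and osc_s = section_measurable[OF osc_joint]
    and al_s = section_measurable[OF alpha_joint] and hh_s = section_measurable[OF hh_joint]
  have mm: "?m \<in> borel_measurable M"
  proof -
    have [measurable]: "N s \<in> borel_measurable M" "N t \<in> borel_measurable M"
      using st by (auto intro: N_measurable)
    show ?thesis by measurable
  qed
  have "energy n t \<le> (\<integral>\<^sup>+\<omega>. ?m \<omega> + (\<integral>\<^sup>+r\<in>{s<..t}. ?hh r \<omega> \<partial>lborel) \<partial>M)"
    unfolding energy_def
  proof (rule nn_integral_mono_AE, use AE_space pathwise_step[OF st(1-3)] in eventually_elim)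
    fix \<omega> assume \<omega>: "\<omega> \<in> space M" and step: "\<omega> \<in> G n t \<longrightarrow> ennreal ((norm (x t \<omega>))\<^sup>2) \<le> ennreal ((norm (x s \<omega> + (N t \<omega> - N s \<omega>)))\<^sup>2) +
      (\<integral>\<^sup>+r\<in>{s<..t}. (ennreal C * en n r \<omega> + ennreal (1 / sqrt (t - s)) * ennreal ((norm (W r \<omega> - W t \<omega>))\<^sup>2) + ennreal (sqrt (t - s) * K) * \<alpha> r \<omega>) \<partial>lborel)"
    show "en n t \<omega> \<le> ?m \<omega> + (\<integral>\<^sup>+r\<in>{s<..t}. ?hh r \<omega> \<partial>lborel)"
    proof (cases "\<omega> \<in> G n t")
      case True
      moreover have "\<omega> \<in> G n s" using True G_mono[of s t n] st by auto
      ultimately show ?thesis using step by (simp add: en_def G_def \<delta>_def h_def)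
    qed (simp add: en_def G_def \<omega>)
  qed
  also have "\<dots> = (\<integral>\<^sup>+\<omega>. ?m \<omega> \<partial>M) + (\<integral>\<^sup>+\<omega>. (\<integral>\<^sup>+r\<in>{s<..t}. ?hh r \<omega> \<partial>lborel) \<partial>M)"
    by (rule nn_integral_add[OF mm hh_s(4)])
  also have "(\<integral>\<^sup>+\<omega>. ?m \<omega> \<partial>M) = energy n s + mean_sq M (\<lambda>\<omega>. indicator (G n s) \<omega> *\<^sub>R (N t \<omega> - N s \<omega>))"
    using martingale_step[OF st(1-3)] by (simp only: mean_sq_def)
  also have "(\<integral>\<^sup>+\<omega>. (\<integral>\<^sup>+r\<in>{s<..t}. ?hh r \<omega> \<partial>lborel) \<partial>M) = (\<integral>\<^sup>+r\<in>{s<..t}. (\<integral>\<^sup>+\<omega>. ?hh r \<omega> \<partial>M) \<partial>lborel)"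
    by (rule time_fubini[OF hh_joint])
  also have "\<dots> \<le> (\<integral>\<^sup>+r\<in>{s<..t}. (ennreal C * energy n r + ennreal (1 / \<delta>) * ?Rb + ennreal (\<delta> * K) * E\<alpha> r) \<partial>lborel)"
  proof (intro nn_integral_mono mult_indicator_mono)
    fix r assume r: "r \<in> {s<..t}"
    have "(\<integral>\<^sup>+\<omega>. ?hh r \<omega> \<partial>M) = ennreal C * energy n r + ennreal (1 / \<delta>) * (\<integral>\<^sup>+\<omega>. ?osc r \<omega> \<partial>M) + ennreal (\<delta> * K) * E\<alpha> r"
      unfolding energy_def using en_s(1) osc_s(1) al_s(1)
      by (simp only: nn_integral_add nn_integral_cmult borel_measurable_times_ennreal borel_measurable_const borel_measurable_add)
    also have "\<dots> \<le> ennreal C * energy n r + ennreal (1 / \<delta>) * ?Rb + ennreal (\<delta> * K) * E\<alpha> r"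
      using oscillation_le[of s r t] r st by (intro add_right_mono add_left_mono mult_left_mono) (auto simp: h_def)
    finally show "(\<integral>\<^sup>+\<omega>. ?hh r \<omega> \<partial>M) \<le> ennreal C * energy n r + ennreal (1 / \<delta>) * ?Rb + ennreal (\<delta> * K) * E\<alpha> r" .
  qed
  also have "\<dots> = (\<integral>\<^sup>+r. ennreal C * (energy n r * indicator {s<..t} r) + ennreal (1 / \<delta>) * ?Rb * indicator {s<..t} r +
      ennreal (\<delta> * K) * (E\<alpha> r * indicator {s<..t} r) \<partial>lborel)"
    by (intro nn_integral_cong) (simp only: distrib_right mult.assoc)
  also have "\<dots> = ennreal C * ?I + ennreal (1 / \<delta>) * ?Rb * ennreal h + ennreal (\<delta> * K) * ?a"
    using al_s(3) st by (simp add: nn_integral_add nn_integral_cmult nn_integral_cmult_indicator h_def)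
  also have "ennreal (1 / \<delta>) * ?Rb * ennreal h = ennreal \<delta> * ?Rb"
  proof -
    have "ennreal (1 / \<delta>) * ?Rb * ennreal h = ennreal (1 / \<delta>) * ennreal h * ?Rb" by (simp only: mult_ac)
    also have "ennreal (1 / \<delta>) * ennreal h = ennreal \<delta>" using \<delta> h by (metis ennreal_mult'' less_imp_le)
    finally show ?thesis .
  qed
  finally have 1: "energy n t \<le> energy n s + mean_sq M (\<lambda>\<omega>. indicator (G n s) \<omega> *\<^sub>R (N t \<omega> - N s \<omega>)) +
    (ennreal C * ?I + ennreal \<delta> * ?Rb + ennreal (\<delta> * K) * ?a)"
    by (simp add: add_left_mono)
  have 2: "mean_sq M (\<lambda>\<omega>. indicator (G n s) \<omega> *\<^sub>R (N t \<omega> - N s \<omega>)) \<le> ennreal (8 * L) * ?I + ennreal (8 * L * h) * ?pd"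
    using noise_increment_le(1)[OF st(1-3)] by (simp add: h_def)
  \<comment> \<open>As \<open>G n t\<close> is contained in \<open>G n s\<close>, the mismatch term
    of the noise estimate is exactly the decrement of \<open>p\<close>.\<close>
  have ps: "p s = ?pd + p t"
  proof -
    have "S \<omega> * indicator (G n s) \<omega> = S \<omega> * indicator (G n s - G n t) \<omega> + S \<omega> * indicator (G n t) \<omega>" for \<omega>
      using G_mono[of s t n] st by (auto simp: indicator_def)
    then show ?thesis unfolding p_def by (simp add: nn_integral_add)
  qed
  have Iq: "(\<integral>\<^sup>+r\<in>{s<..t}. (ennreal (C + 8 * L) * energy n r + ennreal (sqrt (t - s)) * q r) \<partial>lborel) =
    ennreal (C + 8 * L) * ?I + ennreal \<delta> * (ennreal (16 * L) * ES * ennreal h + ennreal (3 * K) * ?a)"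
  proof -
    have "(\<integral>\<^sup>+r\<in>{s<..t}. (ennreal (C + 8 * L) * energy n r + ennreal (sqrt (t - s)) * q r) \<partial>lborel) =
      (\<integral>\<^sup>+r. ennreal (C + 8 * L) * (energy n r * indicator {s<..t} r) +
        ennreal \<delta> * (ennreal (16 * L) * ES * indicator {s<..t} r + ennreal (3 * K) * (E\<alpha> r * indicator {s<..t} r)) \<partial>lborel)"
      unfolding q_def \<delta>_def h_def by (intro nn_integral_cong) (simp only: distrib_right distrib_left mult.assoc)
    also have "\<dots> = ennreal (C + 8 * L) * ?I + ennreal \<delta> * (ennreal (16 * L) * ES * ennreal h + ennreal (3 * K) * ?a)"
      using al_s(3) st by (simp add: nn_integral_add nn_integral_cmult nn_integral_cmult_indicator h_def)
    finally show ?thesis .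
  qed
  \<comment> \<open>The coefficient \<open>3 * K\<close> in \<open>q\<close> collects
    \<open>2 * K\<close> from the drift part of the oscillation, where \<open>h \<le> 1\<close> is
    used, and \<open>K\<close> from Young's inequality.\<close>
  have Rb: "ennreal \<delta> * ?Rb + ennreal (\<delta> * K) * ?a \<le> ennreal \<delta> * (ennreal (16 * L) * ES * ennreal h + ennreal (3 * K) * ?a)"
  proof -
    have "ennreal (2 * K * h) * ?a \<le> ennreal (2 * K) * ?a"
      using h K by (intro mult_right_mono ennreal_leI) (auto intro: mult_left_le)
    then have "?Rb + ennreal K * ?a \<le> ennreal (16 * L * h) * ES + ennreal (2 * K) * ?a + ennreal K * ?a"
      by (intro add_mono) auto
    also have "\<dots> = ennreal (16 * L * h) * ES + (ennreal (2 * K) + ennreal K) * ?a"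
      by (simp only: distrib_right add.assoc)
    also have "ennreal (2 * K) + ennreal K = ennreal (3 * K)"
      using K by (simp flip: ennreal_plus)
    finally have *: "?Rb + ennreal K * ?a \<le> ennreal (16 * L * h) * ES + ennreal (3 * K) * ?a" .
    have "ennreal (16 * L * h) * ES = ennreal (16 * L) * ES * ennreal h"
      using h by (simp add: ennreal_mult'' mult_ac)
    with * have "?Rb + ennreal K * ?a \<le> ennreal (16 * L) * ES * ennreal h + ennreal (3 * K) * ?a"
      by (simp only:)
    then have "ennreal \<delta> * (?Rb + ennreal K * ?a) \<le> ennreal \<delta> * (ennreal (16 * L) * ES * ennreal h + ennreal (3 * K) * ?a)"
      by (rule mult_left_mono) simp
    moreover have "ennreal (\<delta> * K) = ennreal \<delta> * ennreal K" using K by (intro ennreal_mult'') simp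
    ultimately show ?thesis by (simp only: distrib_left mult.assoc)
  qed
  have CL: "ennreal (C + 8 * L) = ennreal C + ennreal (8 * L)" using C L by (intro ennreal_plus) auto
  have "energy n t + ennreal (8 * L * h) * p t \<le>
    (energy n s + (ennreal (8 * L) * ?I + ennreal (8 * L * h) * ?pd) + (ennreal C * ?I + ennreal \<delta> * ?Rb + ennreal (\<delta> * K) * ?a)) +
      ennreal (8 * L * h) * p t"
    by (intro add_right_mono order_trans[OF 1] add_left_mono 2)
  also have "\<dots> = energy n s + ennreal (8 * L * h) * (?pd + p t) + ((ennreal C + ennreal (8 * L)) * ?I + (ennreal \<delta> * ?Rb + ennreal (\<delta> * K) * ?a))"
    by (simp only: distrib_left distrib_right add_ac)
  also have "\<dots> \<le> energy n s + ennreal (8 * L * h) * p s + (ennreal (C + 8 * L) * ?I +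
      ennreal \<delta> * (ennreal (16 * L) * ES * ennreal h + ennreal (3 * K) * ?a))"
    unfolding ps CL by (intro add_left_mono Rb)
  finally show ?thesis unfolding Iq by (simp only: h_def)
qed

text \<open>The error density is integrable up to \<open>T\<close> because the solutions are square
  integrable in D(A) and \<open>S\<close> has finite mean. The energy starts from zero by the
  convention for \<open>x\<close> at time zero.\<close>

lemma energy_vanishes:
  assumes t: "0 < t" "t \<le> T"
  shows "energy n t = 0"
proof (rule grid_gronwall_zero[where p="\<lambda>t. \<integral>\<^sup>+\<omega>. S \<omega> * indicator (G n t) \<omega> \<partial>M" and c="8 * L" and C="C + 8 * L"
      and q="\<lambda>r. ennreal (16 * L) * ES + ennreal (3 * K) * E\<alpha> r" and P=ES and T=T])
  have al: "E\<alpha> \<in> borel_measurable borel" by (rule section_measurable(3)[OF alpha_joint])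
  then show "(\<lambda>r. ennreal (16 * L) * ES + ennreal (3 * K) * E\<alpha> r) \<in> borel_measurable borel" by measurable
  show "(\<integral>\<^sup>+\<omega>. S \<omega> * indicator (G n 0) \<omega> \<partial>M) \<le> ES"
    by (intro nn_integral_mono) (auto simp: indicator_def)
  have "(\<integral>\<^sup>+r\<in>{0<..T}. (ennreal (16 * L) * ES + ennreal (3 * K) * E\<alpha> r) \<partial>lborel) =
    (\<integral>\<^sup>+r. ennreal (16 * L) * ES * indicator {0<..T} r + ennreal (3 * K) * (E\<alpha> r * indicator {0<..T} r) \<partial>lborel)"
    by (intro nn_integral_cong) (simp only: distrib_right mult.assoc)
  also have "\<dots> = ennreal (16 * L) * ES * ennreal T + ennreal (3 * K) * (\<integral>\<^sup>+r\<in>{0<..T}. E\<alpha> r \<partial>lborel)"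
    using al t by (simp add: nn_integral_add nn_integral_cmult nn_integral_cmult_indicator)
  also have "\<dots> < \<top>"
    using S_fin alpha_finite[of T] t by (simp add: ennreal_mult_less_top)
  finally show "(\<integral>\<^sup>+r\<in>{0<..T}. (ennreal (16 * L) * ES + ennreal (3 * K) * E\<alpha> r) \<partial>lborel) < \<top>" .
qed (use L C S_fin energy_zero energy_le energy_step t in auto)

end

section \<open>From vanishing energy to equality of the paths\<close>

context solution_pair
begin

text \<open>The estimate is run with horizon \<open>t\<close> and radius \<open>n\<close>; a
  nonnegative function of mean zero vanishes almost surely. The null set depends on both
  parameters.\<close>

lemma paths_agree_before:
  assumes t: "0 < t"
  shows "AE \<omega> in M. good (real n) t \<omega> \<longrightarrow> W t \<omega> = 0"
proof -
  obtain S where S: "S \<in> borel_measurable M" "(\<integral>\<^sup>+\<omega>. S \<omega> \<partial>M) < \<top>"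
    "AE \<omega> in M. \<forall>s\<in>{0..t}. ennreal ((norm (W s \<omega>))\<^sup>2) \<le> S \<omega>"
    using sup_bound[of t] t by auto
  obtain L where L: "0 \<le> L" "\<And>m r \<omega>. \<omega> \<in> space M \<Longrightarrow> 0 \<le> r \<Longrightarrow>
    ennreal (\<Sum>j<m. (norm (noise j r \<omega>))\<^sup>2) \<le> (if ennreal r \<le> \<tau> \<omega> then ennreal (L * (norm (W r \<omega>))\<^sup>2) else 0)"
    using noise_bound by blast
  obtain N where N: "\<forall>t\<ge>0. ito_process noise t (N t)"
    "\<forall>s t. 0 \<le> s \<longrightarrow> s < t \<longrightarrow> (AE \<omega> in M. ennreal t \<le> \<tau> \<omega> \<longrightarrow>
      set_integrable lebesgue {s<..t} (bd \<omega>) \<and>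
      x t \<omega> - x s \<omega> = N t \<omega> - N s \<omega> - (LINT r:{s<..t}|lebesgue. bd \<omega> r))"
    using increments by blast
  obtain C K where CK: "0 < C" "0 < K" "AE \<omega> in M. \<forall>t. good (real n) t \<omega> \<longrightarrow> (AE r in lborel. r \<in> {0<..t} \<longrightarrow>
    - 2 * (W r \<omega> \<bullet> bd \<omega> r) \<le> C * (norm (W r \<omega>))\<^sup>2 \<and> ennreal ((norm (bd \<omega> r))\<^sup>2) \<le> ennreal K * \<alpha> r \<omega>)"
    using good_drift_bounds[of "real n"] by auto
  interpret energy_estimate M F \<beta> D A e lam d B R g \<Phi>0 \<Phi>1 \<Phi>2 \<tau> "real n" t L C K S N
    by unfold_locales (use S L N CK in auto)
  have "energy (real n) t = 0" using t by (intro energy_vanishes) auto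
  then have "AE \<omega> in M. en (real n) t \<omega> = 0"
    unfolding energy_def by (simp add: nn_integral_0_iff_AE section_measurable(1)[OF en_joint])
  then show ?thesis
    using t by (auto elim!: eventually_mono simp: en_def x_def split: if_splits)
qed

text \<open>Countably many null sets are collected, one for each positive rational time and each
  integer radius. On the remaining paths compactness yields a radius for which a given rational time
  up to \<open>\<tau>\<close> is good, and continuity extends the equality to all times up to
  \<open>\<tau>\<close>.\<close>

lemma paths_agree: "AE \<omega> in M. 0 < \<tau> \<omega> \<longrightarrow> (\<forall>t\<ge>0. X1 t \<omega> = X2 t \<omega>)"
proof -
  have "AE \<omega> in M. \<forall>t\<in>\<rat> \<inter> {0<..}. \<forall>n. good (real n) t \<omega> \<longrightarrow> W t \<omega> = 0"
    by (subst AE_ball_countable[OF countable_Int1[OF countable_rat]], intro ballI AE_all_countable[THEN iffD2] allI paths_agree_before)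
      auto
  then show ?thesis
    using s1.X_continuous s2.X_continuous
  proof eventually_elim
    case (elim \<omega>)
    have Wc: "continuous_on {0..} (\<lambda>t. W t \<omega>)"
      unfolding W_def by (intro continuous_on_diff continuous_V_path(1) elim)
    have rat: "W t \<omega> = 0" if t: "t \<in> \<rat>" "0 < t" "ennreal t \<le> \<tau> \<omega>" for t
    proof -
      obtain n1 :: nat where n1: "\<forall>r\<in>{0..t}. Vball (real n1) (X1 r \<omega>)" using V_path_bounded[OF elim(2)] by blast
      obtain n2 :: nat where n2: "\<forall>r\<in>{0..t}. Vball (real n2) (X2 r \<omega>)" using V_path_bounded[OF elim(3)] by blast
      have "Vball (real (max n1 n2)) v" if "Vball (real n1) v \<or> Vball (real n2) v" for v
        using that by (auto simp: Vball_iff)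
      then have "good (real (max n1 n2)) t \<omega>" using n1 n2 t by (auto simp: good_def)
      then show ?thesis using elim(1) t by auto
    qed
    show ?case
    proof (intro impI allI)
      fix t :: real assume tau: "0 < \<tau> \<omega>" and t: "0 \<le> t"
      \<comment> \<open>The energy says nothing about \<open>W\<close> at time zero, where
        \<open>x\<close> is zero by definition. As \<open>\<tau>\<close> is positive, small rational
        times are available, and continuity from the right decides.\<close>
      have zero: "W 0 \<omega> = 0"
      proof -
        obtain u where u: "0 < u" "ennreal u \<le> \<tau> \<omega>"
        proof (cases "\<tau> \<omega>")
          case (real c)
          then show ?thesis using that[of c] tau by (auto simp: less_le)
        next
          case top
          then show ?thesis using that[of 1] by simp
        qed
        have lim: "(\<lambda>i. 1 / real (Suc i)) \<longlonglongrightarrow> 0" by (intro LIMSEQ_Suc lim_1_over_n)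
        then have "(\<lambda>i. W (1 / real (Suc i)) \<omega>) \<longlonglongrightarrow> W 0 \<omega>"
          using continuous_on_tendsto_compose[OF Wc, of "\<lambda>i. 1 / real (Suc i)" 0 sequentially] by auto
        moreover have "\<forall>\<^sub>F i in sequentially. W (1 / real (Suc i)) \<omega> = 0"
          using order_tendstoD(2)[OF lim u(1)]
        proof eventually_elim
          case (elim i)
          then have "ennreal (1 / real (Suc i)) \<le> \<tau> \<omega>" using u(2) by (meson ennreal_leI less_imp_le order_trans)
          then show ?case by (intro rat) auto
        qed
        ultimately have "(\<lambda>i. 0 :: 'h) \<longlonglongrightarrow> W 0 \<omega>" by (rule Lim_transform_eventually)
        then show ?thesis by (simp add: LIMSEQ_const_iff)
      qed
      have vanish: "W r \<omega> = 0" if r: "0 \<le> r" "ennreal r \<le> \<tau> \<omega>" for r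
      proof (rule closed_property_from_rationals[where P="\<lambda>v. v = 0" and t=r, OF Wc])
        fix q assume q: "q \<in> \<rat>" "0 \<le> q" "q \<le> r"
        have "ennreal q \<le> \<tau> \<omega>" using q(3) r(2) by (meson ennreal_leI order_trans)
        then show "W q \<omega> = 0" using rat[of q] zero q by (cases "q = 0") auto
      qed (use r in auto)
      \<comment> \<open>Stopping is idempotent: the stopped time does not exceed
        \<open>\<tau>\<close>, so the equality up to \<open>\<tau>\<close> covers it.\<close>
      have stop: "0 \<le> stopped \<tau> t \<omega>" "ennreal (stopped \<tau> t \<omega>) \<le> \<tau> \<omega>" "stopped \<tau> (stopped \<tau> t \<omega>) \<omega> = stopped \<tau> t \<omega>"
      proof -
        have fin: "min (ennreal t) (\<tau> \<omega>) < \<top>" by (simp add: min_less_iff_disj)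
        show 0: "0 \<le> stopped \<tau> t \<omega>" by (simp add: stopped_def)
        show 1: "ennreal (stopped \<tau> t \<omega>) \<le> \<tau> \<omega>" using fin by (simp add: stopped_def)
        show "stopped \<tau> (stopped \<tau> t \<omega>) \<omega> = stopped \<tau> t \<omega>" using 0 1 by (rule stopped_eq)
      qed
      have "W (stopped \<tau> t \<omega>) \<omega> = 0" using vanish stop by blast
      then show "X1 t \<omega> = X2 t \<omega>" by (simp add: W_def stop(3))
    qed
  qed
qed

end

theorem theorem4p9:
  fixes d :: nat
    and D :: "'h::{real_inner, banach, second_countable_topology} set"
    and A :: "'h \<Rightarrow> 'h" and e :: "nat \<Rightarrow> 'h" and lam :: "nat \<Rightarrow> real"
    and B :: "'h \<Rightarrow> 'h \<Rightarrow> 'h \<Rightarrow> real" and R :: "'h \<Rightarrow> 'h"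
    and g :: "'w \<Rightarrow> real \<Rightarrow> 'h \<Rightarrow> nat \<Rightarrow> 'h"
    and M :: "'w measure" and F :: "ennreal \<Rightarrow> 'w measure" and \<beta> :: "nat \<Rightarrow> real \<Rightarrow> 'w \<Rightarrow> real"
    and \<tau> :: "'w \<Rightarrow> ennreal" and \<Phi>0 :: "'w \<Rightarrow> 'h" and \<Phi>1 \<Phi>2 :: "real \<Rightarrow> 'w \<Rightarrow> 'h"
  assumes "d \<in> {1, 2, 3}"
    and "admissible_operator D A"
    and "eigenbasis D A e lam"
    and "cond_B d D A e lam B"
    and "cond_R D A e lam R"
    and "stochastic_basis M F \<beta>"
    and "cond_G M F D A e lam g"
    and "stopping_time F \<tau>"
    and "AE \<omega> in M. 0 < \<tau> \<omega>"
    and "Linf_rv M (V_space e lam) (V_norm e lam) \<Phi>0"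
    and "local_strong_solution M F \<beta> D A e lam B R g \<Phi>0 \<Phi>1 \<tau>"
    and "local_strong_solution M F \<beta> D A e lam B R g \<Phi>0 \<Phi>2 \<tau>"
  shows "measure M {\<omega> \<in> space M. \<forall>t\<ge>0. \<Phi>1 (stopped \<tau> t \<omega>) \<omega> = \<Phi>2 (stopped \<tau> t \<omega>) \<omega>} = 1"
proof -
  interpret prob_space M using assms(6) by (simp add: stochastic_basis_def)
  interpret brownian_basis M F \<beta> by unfold_locales (rule assms(6))
  interpret hilbert_eigenbasis D A e lam by unfold_locales (rule assms(2), rule assms(3))
  interpret solution_pair M F \<beta> D A e lam d B R g \<Phi>0 \<Phi>1 \<Phi>2 \<tau>
    by unfold_locales (use assms in auto)
  let ?P = "\<lambda>\<omega>. \<forall>t\<ge>0. \<Phi>1 (stopped \<tau> t \<omega>) \<omega> = \<Phi>2 (stopped \<tau> t \<omega>) \<omega>"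
  have AE: "AE \<omega> in M. ?P \<omega>" using paths_agree assms(9) by eventually_elim auto
  \<comment> \<open>The event quantifies over uncountably many times. It is measurable by
    completeness, its complement being contained in a null set.\<close>
  have "complete_measure M" using assms(6) by (simp add: stochastic_basis_def usual_conditions_def)
  then interpret complete_measure M .
  have null: "{\<omega> \<in> space M. \<not> ?P \<omega>} \<in> null_sets M" using AE by (simp add: AE_iff_null_sets complete_measure_axioms)
  have "{\<omega> \<in> space M. ?P \<omega>} = space M - {\<omega> \<in> space M. \<not> ?P \<omega>}" by auto
  then have "{\<omega> \<in> space M. ?P \<omega>} \<in> events" using null by (simp only: sets.Diff[OF sets.top null_setsD2])
  then show ?thesis using AE by (simp only: prob_Collect_eq_1)
qed

end
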